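(* Let $(X,\Sigma)$ be a $2$-strata space endowed with a stratified foliation $(\mathcal{X},\mathcal{S})$ which is $0$-dimensional on the links. Then the restrictions of the link bundle to the leaves of the singular stratum are flat bundles, i.e. for every leaf $S$ of $\mathcal{S}$ the bundle $\pi|:\pi^{-1}(S)\cap\rho^{-1}(1)\to S$ is flat.
   Context: **2-strata space.** A pair $(X,\Sigma)$ such that: (1) $X$ is a locally compact, Hausdorff, second-countable space, $\Sigma\subset X$ is a closed subspace and a closed, connected, smooth manifold, $X-\Sigma$ is a smooth manifold dense in $X$; (2) $\Sigma$ possesses control data $(T,\pi,\rho)$: $T\subset X$ is an open neighborhood of $\Sigma$, $\pi:T\to\Sigma$ a continuous retraction, $\rho:T\to[0,2)$ a continuous function with $\rho^{-1}(0)=\Sigma$, and $\pi,\rho$ are smooth on $T-\Sigma$; (3) $\pi:T\to\Sigma$ is a locally trivial fiber bundle with fiber the cone $cL=(L\times[0,2))/(L\times0)$ over a closed smooth manifold $L$ (the link), with structure group given by homeomorphisms $c(\phi):cL\to cL$, $\phi:L\to L$ a diffeomorphism, the $\phi$ varying smoothly with points in charts of $\Sigma$; (4) for every local trivialization $\psi:U\times cL\cong\pi^{-1}(U)$ (over open $U\subset\Sigma$, $\pi\psi=\mathrm{proj}_1$, $\psi$ the identity on $U\times\{c\}$, $c$ the cone vertex), $\rho(\psi(u,(l,t)))=t$. The link bundle is the smooth fiber bundle $\pi|:\rho^{-1}(1)\to\Sigma$ with fiber $L$. **Foliations.** A smooth $k$-dimensional foliation of a manifold without boundary is a decomposition into connected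 immersed $k$-dimensional submanifolds (leaves) that is locally diffeomorphic to the decomposition of $\mathbb{R}^m=\mathbb{R}^k\times\mathbb{R}^{m-k}$ into the subspaces $\mathbb{R}^k\times\mathrm{pt}$. For a foliation $\mathcal{F}$ of $M$ and an open $V\subset M$, $\mathcal{F}_V$ is the foliation of $V$ by connected components of the sets $V\cap F$, $F\in\mathcal{F}$. The cone on a foliation $\mathcal{L}$ of $L$ is the decomposition $c\mathcal{L}=\{K\times\{t\}\mid K\in\mathcal{L},\,t\in(0,2)\}\cup\{c\}$ of $cL$. **Stratified foliation** of $(X,\Sigma)$: a pair $(\mathcal{X},\mathcal{S})$ such that (1) $\mathcal{X}$ is a smooth foliation of $X-\Sigma$; (2) $\mathcal{S}$ is a smooth foliation of $\Sigma$; (3) every point of $\Sigma$ has an open neighborhood $U$ with a local trivialization $\psi:U\times cL\cong\pi^{-1}(U)$ as in (4) above, such that the leaves of the product foliation $\mathcal{S}_U\times(c\mathcal{L}-\{c\})$ correspond under $\psi$ to the leaves of $\mathcal{X}_{\pi^{-1}(U)-\Sigma}$ for some smooth foliation $\mathcal{L}$ on $L$. It is $0$-dimensional on the links if these foliations $\mathcal{L}$ are the $0$-dimensional foliation of $L$ by points. **Flat bundle.** The leaf $S$ carries its leaf (immersed submanifold) topology and smooth structure, and $\pi^{-1}(S)\cap\rho^{-1}(1)$ the corresponding structure of an immersed submanifold (the pullback of the link bundle to $S$). A smooth fiber bundle with fiber $L$ is flat if it has smooth local trivializations over an open cover whose transition functions have the form $(t,x)\mapsto(t,g(x))$ with $g$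 a diffeomorphism of $L$ locally independent of the base point $t$; equivalently, it is a transversely foliated bundle: the total space has a foliation which in suitable local trivializations $V\times L$ is the product foliation $\{V\times\{l\}\}_{l\in L}$. *)

theory Defs
  imports "HOL-Analysis.Analysis"
begin

section \<open>Smooth manifolds\<close>

text \<open>
  Dimensions are natural numbers (zero included), so \<open>\<real>\<^sup>n\<close> is the library's \<^const>\<open>Euclidean_space\<close>:
  sequences \<open>x :: nat \<Rightarrow> real\<close> with \<open>x i = 0\<close> for \<open>i \<ge> n\<close>.
\<close>

definition partial_deriv :: "nat \<Rightarrow> ((nat \<Rightarrow> real) \<Rightarrow> real) \<Rightarrow> (nat \<Rightarrow> real) \<Rightarrow> real" where
  "partial_deriv i f x = deriv (\<lambda>t. f (x(i := t))) (x i)"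

text \<open>\<open>C_k n k W f\<close>: \<open>f\<close> is \<open>k\<close> times continuously differentiable on the open set \<open>W \<subseteq> \<real>\<^sup>n\<close>.\<close>

primrec C_k :: "nat \<Rightarrow> nat \<Rightarrow> (nat \<Rightarrow> real) set \<Rightarrow> ((nat \<Rightarrow> real) \<Rightarrow> real) \<Rightarrow> bool" where
  "C_k n 0 W f \<longleftrightarrow> continuous_map (subtopology (Euclidean_space n) W) euclideanreal f"
| "C_k n (Suc k) W f \<longleftrightarrow>
     continuous_map (subtopology (Euclidean_space n) W) euclideanreal f \<and>
     (\<forall>i<n. (\<forall>x\<in>W. (\<lambda>t. f (x(i := t))) field_differentiable (at (x i))) \<and>
            C_k n k W (partial_deriv i f))"

definition smooth_Rn ::
    "nat \<Rightarrow> nat \<Rightarrow> (nat \<Rightarrow> real) set \<Rightarrow> ((nat \<Rightarrow> real) \<Rightarrow> (nat \<Rightarrow> real)) \<Rightarrow> bool" where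
  "smooth_Rn n m W f \<longleftrightarrow> (\<forall>j<m. \<forall>k. C_k n k W (\<lambda>x. f x j))"

text \<open>
  The atlas need not be maximal. The values of a chart map outside the domain of the chart are
  irrelevant.
\<close>

record 'a mfd =
  mtop :: "'a topology"
  mdim :: nat
  atlas :: "('a set \<times> ('a \<Rightarrow> nat \<Rightarrow> real)) set"

abbreviation carr :: "'a mfd \<Rightarrow> 'a set" where
  "carr M \<equiv> topspace (mtop M)"

definition smooth_manifold :: "'a mfd \<Rightarrow> bool" where
  "smooth_manifold M \<longleftrightarrow>
     Hausdorff_space (mtop M) \<and> second_countable (mtop M) \<and>
     (\<forall>(U, \<phi>)\<in>atlas M.
        openin (mtop M) U \<and> openin (Euclidean_space (mdim M)) (\<phi> ` U) \<and>
        homeomorphic_map (subtopology (mtop M) U)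
          (subtopology (Euclidean_space (mdim M)) (\<phi> ` U)) \<phi>) \<and>
     (\<Union>(U, \<phi>)\<in>atlas M. U) = carr M \<and>
     (\<forall>(U, \<phi>)\<in>atlas M. \<forall>(V, \<theta>)\<in>atlas M.
        smooth_Rn (mdim M) (mdim M) (\<phi> ` (U \<inter> V)) (\<theta> \<circ> inv_into U \<phi>))"

definition closed_manifold :: "'a mfd \<Rightarrow> bool" where
  "closed_manifold M \<longleftrightarrow> smooth_manifold M \<and> compact_space (mtop M)"

definition smooth_map :: "'a mfd \<Rightarrow> 'b mfd \<Rightarrow> ('a \<Rightarrow> 'b) \<Rightarrow> bool" where
  "smooth_map M N f \<longleftrightarrow>
     continuous_map (mtop M) (mtop N) f \<and>
     (\<forall>(U, \<phi>)\<in>atlas M. \<forall>(V, \<theta>)\<in>atlas N.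
        smooth_Rn (mdim M) (mdim N) (\<phi> ` {x \<in> U. f x \<in> V}) (\<theta> \<circ> f \<circ> inv_into U \<phi>))"

definition diffeomorphism :: "'a mfd \<Rightarrow> 'b mfd \<Rightarrow> ('a \<Rightarrow> 'b) \<Rightarrow> bool" where
  "diffeomorphism M N f \<longleftrightarrow>
     smooth_map M N f \<and>
     (\<exists>g. smooth_map N M g \<and> (\<forall>x\<in>carr M. g (f x) = x) \<and> (\<forall>y\<in>carr N. f (g y) = y))"

text \<open>Smooth, with injective Jacobian in charts at every point.\<close>

definition immersion :: "'a mfd \<Rightarrow> 'b mfd \<Rightarrow> ('a \<Rightarrow> 'b) \<Rightarrow> bool" where
  "immersion M N f \<longleftrightarrow>
     smooth_map M N f \<and>
     (\<forall>(U, \<phi>)\<in>atlas M. \<forall>(V, \<theta>)\<in>atlas N. \<forall>p\<in>U. f p \<in> V \<longrightarrow>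
        (\<forall>v :: nat \<Rightarrow> real.
           (\<forall>j<mdim N. (\<Sum>i<mdim M.
               partial_deriv i (\<lambda>x. \<theta> (f (inv_into U \<phi> x)) j) (\<phi> p) * v i) = 0)
           \<longrightarrow> (\<forall>i<mdim M. v i = 0)))"

definition restrict_mfd :: "'a mfd \<Rightarrow> 'a set \<Rightarrow> 'a mfd" where
  "restrict_mfd M W =
     \<lparr>mtop = subtopology (mtop M) W, mdim = mdim M, atlas = {(U \<inter> W, \<phi>) |U \<phi>. (U, \<phi>) \<in> atlas M}\<rparr>"

definition prod_mfd :: "'a mfd \<Rightarrow> 'b mfd \<Rightarrow> ('a \<times> 'b) mfd" where
  "prod_mfd M N =
     \<lparr>mtop = prod_topology (mtop M) (mtop N),
      mdim = mdim M + mdim N,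
      atlas = {(U \<times> V, \<lambda>(x, y) i. if i < mdim M then \<phi> x i else \<theta> y (i - mdim M)) |U \<phi> V \<theta>.
                 (U, \<phi>) \<in> atlas M \<and> (V, \<theta>) \<in> atlas N}\<rparr>"

definition Rn_mfd :: "nat \<Rightarrow> (nat \<Rightarrow> real) mfd" where
  "Rn_mfd n = \<lparr>mtop = Euclidean_space n, mdim = n, atlas = {(topspace (Euclidean_space n), \<lambda>x. x)}\<rparr>"

definition real_mfd :: "real mfd" where
  "real_mfd = \<lparr>mtop = euclideanreal, mdim = 1, atlas = {(UNIV, \<lambda>t i. if i = 0 then t else 0)}\<rparr>"


section \<open>Foliations\<close>

text \<open>
  A foliation is a set of leaves, each leaf being given together with its own topology and smooth
  structure as an immersed submanifold. In general the leaf topology is strictly finer than the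
  subspace topology, and it is the leaf topology whose connected components give the leaves of the
  restriction to an open set.
\<close>

definition restrict_foliation :: "'a mfd set \<Rightarrow> 'a set \<Rightarrow> 'a mfd set" where
  "restrict_foliation \<F> V =
     {restrict_mfd F C |F C.
        F \<in> \<F> \<and> C \<in> connected_components_of (subtopology (mtop F) (V \<inter> carr F))}"

text \<open>
  The decomposition of the open set \<open>V \<subseteq> \<real>\<^sup>m\<close> into the connected components of its intersections with
  the subspaces \<open>\<real>\<^sup>k \<times> {y}\<close>, where \<open>y \<in> \<real>\<^bsup>m-k\<^esup>\<close> is encoded by its coordinates \<open>k, \<dots>, m - 1\<close>.
\<close>

definition standard_leaves :: "nat \<Rightarrow> nat \<Rightarrow> (nat \<Rightarrow> real) set \<Rightarrow> (nat \<Rightarrow> real) set set" where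
  "standard_leaves m k V =
     (\<Union>y. connected_components_of
             (subtopology (Euclidean_space m) (V \<inter> {x. \<forall>i. k \<le> i \<and> i < m \<longrightarrow> x i = y i})))"

definition smooth_foliation :: "'a mfd \<Rightarrow> nat \<Rightarrow> 'a mfd set \<Rightarrow> bool" where
  "smooth_foliation M k \<F> \<longleftrightarrow>
     k \<le> mdim M \<and>
     (\<forall>F\<in>\<F>. smooth_manifold F \<and> mdim F = k \<and> connected_space (mtop F) \<and> carr F \<noteq> {} \<and>
             immersion F M (\<lambda>x. x)) \<and>
     (\<Union>F\<in>\<F>. carr F) = carr M \<and>
     (\<forall>F\<in>\<F>. \<forall>G\<in>\<F>. F \<noteq> G \<longrightarrow> carr F \<inter> carr G = {}) \<and>
     (\<forall>p\<in>carr M. \<exists>U V \<phi>.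
        p \<in> U \<and> openin (mtop M) U \<and> openin (Euclidean_space (mdim M)) V \<and>
        diffeomorphism (restrict_mfd M U) (restrict_mfd (Rn_mfd (mdim M)) V) \<phi> \<and>
        (\<lambda>F. \<phi> ` carr F) ` restrict_foliation \<F> U = standard_leaves (mdim M) k V)"

definition point_foliation :: "'a mfd \<Rightarrow> 'a mfd set \<Rightarrow> bool" where
  "point_foliation M \<F> \<longleftrightarrow> smooth_foliation M 0 \<F> \<and> carr ` \<F> = {{x} |x. x \<in> carr M}"


section \<open>Smooth fiber bundles and flatness\<close>

definition smooth_bundle_triv ::
    "'e mfd \<Rightarrow> 'b mfd \<Rightarrow> 'l mfd \<Rightarrow> ('e \<Rightarrow> 'b) \<Rightarrow> 'b set \<Rightarrow> ('b \<times> 'l \<Rightarrow> 'e) \<Rightarrow> bool" where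
  "smooth_bundle_triv E B L p V h \<longleftrightarrow>
     openin (mtop B) V \<and>
     diffeomorphism (prod_mfd (restrict_mfd B V) L) (restrict_mfd E {x \<in> carr E. p x \<in> V}) h \<and>
     (\<forall>b\<in>V. \<forall>l\<in>carr L. p (h (b, l)) = b)"

definition smooth_fiber_bundle :: "'e mfd \<Rightarrow> 'b mfd \<Rightarrow> 'l mfd \<Rightarrow> ('e \<Rightarrow> 'b) \<Rightarrow> bool" where
  "smooth_fiber_bundle E B L p \<longleftrightarrow>
     smooth_manifold E \<and> smooth_manifold B \<and> smooth_manifold L \<and> smooth_map E B p \<and>
     (\<forall>b\<in>carr B. \<exists>V h. b \<in> V \<and> smooth_bundle_triv E B L p V h)"

definition flat_bundle :: "'e mfd \<Rightarrow> 'b mfd \<Rightarrow> 'l mfd \<Rightarrow> ('e \<Rightarrow> 'b) \<Rightarrow> bool" where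
  "flat_bundle E B L p \<longleftrightarrow>
     smooth_fiber_bundle E B L p \<and>
     (\<exists>\<T>. (\<forall>(V, h)\<in>\<T>. smooth_bundle_triv E B L p V h) \<and>
          (\<Union>(V, h)\<in>\<T>. V) = carr B \<and>
          (\<forall>(V, h)\<in>\<T>. \<forall>(V', h')\<in>\<T>. \<forall>b \<in> V \<inter> V'. \<exists>N g.
             b \<in> N \<and> openin (mtop B) N \<and> N \<subseteq> V \<inter> V' \<and> diffeomorphism L L g \<and>
             (\<forall>t\<in>N. \<forall>x\<in>carr L. h (t, x) = h' (t, g x))))"


section \<open>Two-strata spaces\<close>

text \<open>
  The open cone \<open>(L \<times> [0,2)) / (L \<times> 0)\<close> with the quotient topology; \<open>None\<close> is the cone vertex and
  \<open>Some (l, t)\<close> with \<open>0 < t < 2\<close> is the class of \<open>(l, t)\<close>.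
\<close>

type_synonym 'l cone = "('l \<times> real) option"

definition cone_proj :: "'l \<times> real \<Rightarrow> 'l cone" where
  "cone_proj z = (if snd z = 0 then None else Some z)"

definition cone_carr :: "'l topology \<Rightarrow> 'l cone set" where
  "cone_carr L = insert None (Some ` (topspace L \<times> {0<..<2}))"

definition cone_topology :: "'l topology \<Rightarrow> 'l cone topology" where
  "cone_topology L = topology (\<lambda>W. W \<subseteq> cone_carr L \<and>
     openin (prod_topology L (top_of_set {0..<2})) {z \<in> topspace L \<times> {0..<2}. cone_proj z \<in> W})"

lemma openin_cone_topology:
  "openin (cone_topology L) W \<longleftrightarrow> W \<subseteq> cone_carr L \<and>
     openin (prod_topology L (top_of_set {0..<2})) {z \<in> topspace L \<times> {0..<2}. cone_proj z \<in> W}"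
proof -
  define P where "P = prod_topology L (top_of_set {0..<2::real})"
  define D where "D = topspace L \<times> {0..<2::real}"
  have "istopology (\<lambda>W. W \<subseteq> cone_carr L \<and> openin P {z \<in> D. cone_proj z \<in> W})"
    unfolding istopology_def
  proof (intro conjI allI impI)
    fix S T assume S: "S \<subseteq> cone_carr L \<and> openin P {z \<in> D. cone_proj z \<in> S}"
      and T: "T \<subseteq> cone_carr L \<and> openin P {z \<in> D. cone_proj z \<in> T}"
    show "S \<inter> T \<subseteq> cone_carr L" by (rule le_infI1) (use S in simp)
    have "{z \<in> D. cone_proj z \<in> S \<inter> T} = {z \<in> D. cone_proj z \<in> S} \<inter> {z \<in> D. cone_proj z \<in> T}"
      by auto
    then show "openin P {z \<in> D. cone_proj z \<in> S \<inter> T}" using S T by (simp only: openin_Int)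
  next
    fix \<K> assume K: "\<forall>K\<in>\<K>. K \<subseteq> cone_carr L \<and> openin P {z \<in> D. cone_proj z \<in> K}"
    show "\<Union>\<K> \<subseteq> cone_carr L" using K by (simp only: Union_least)
    have "{z \<in> D. cone_proj z \<in> \<Union>\<K>} = (\<Union>K\<in>\<K>. {z \<in> D. cone_proj z \<in> K})" by auto
    moreover have "openin P (\<Union>K\<in>\<K>. {z \<in> D. cone_proj z \<in> K})"
      by (rule openin_Union) (use K in auto)
    ultimately show "openin P {z \<in> D. cone_proj z \<in> \<Union>\<K>}" by (simp only:)
  qed
  then show ?thesis
    unfolding cone_topology_def P_def [symmetric] D_def [symmetric] by (simp only: topology_inverse')
qed

text \<open>
  A local trivialization \<open>\<psi> : U \<times> cL \<cong> \<pi>\<^sup>-\<^sup>1(U)\<close> of the cone bundle, respecting cone vertices and the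
  radial function \<open>\<rho>\<close>.
\<close>

definition cone_triv ::
    "'x topology \<Rightarrow> 'x mfd \<Rightarrow> 'x set \<Rightarrow> ('x \<Rightarrow> 'x) \<Rightarrow> ('x \<Rightarrow> real) \<Rightarrow> 'l mfd \<Rightarrow>
     'x set \<Rightarrow> ('x \<times> 'l cone \<Rightarrow> 'x) \<Rightarrow> bool" where
  "cone_triv X S\<^sub>0 T \<pi> \<rho> L U \<psi> \<longleftrightarrow>
     openin (mtop S\<^sub>0) U \<and>
     homeomorphic_map (prod_topology (subtopology (mtop S\<^sub>0) U) (cone_topology (mtop L)))
       (subtopology X {x \<in> T. \<pi> x \<in> U}) \<psi> \<and>
     (\<forall>u\<in>U. \<forall>z\<in>cone_carr (mtop L). \<pi> (\<psi> (u, z)) = u) \<and>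
     (\<forall>u\<in>U. \<psi> (u, None) = u) \<and>
     (\<forall>u\<in>U. \<forall>l\<in>carr L. \<forall>t\<in>{0<..<2}. \<rho> (\<psi> (u, Some (l, t))) = t)"

text \<open>
  The change of trivializations is given by homeomorphisms \<open>c(\<phi> u)\<close> with \<open>\<phi> u\<close> a diffeomorphism of \<open>L\<close>
  depending smoothly on \<open>u\<close>.
\<close>

definition cone_triv_change ::
    "'x mfd \<Rightarrow> 'l mfd \<Rightarrow> 'x set \<times> ('x \<times> 'l cone \<Rightarrow> 'x) \<Rightarrow> 'x set \<times> ('x \<times> 'l cone \<Rightarrow> 'x) \<Rightarrow> bool" where
  "cone_triv_change S\<^sub>0 L = (\<lambda>(U, \<psi>) (U', \<psi>'). \<exists>\<phi> :: 'x \<Rightarrow> 'l \<Rightarrow> 'l.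
     (\<forall>u \<in> U \<inter> U'. diffeomorphism L L (\<phi> u)) \<and>
     smooth_map (prod_mfd (restrict_mfd S\<^sub>0 (U \<inter> U')) L) L (\<lambda>(u, l). \<phi> u l) \<and>
     (\<forall>u \<in> U \<inter> U'. \<forall>l\<in>carr L. \<forall>t\<in>{0<..<2}. \<psi> (u, Some (l, t)) = \<psi>' (u, Some (\<phi> u l, t))))"

text \<open>
  Here \<open>S\<^sub>0\<close> is the singular stratum and \<open>R\<close> the regular stratum. The bundle with structure group
  \<open>\<pi> : T \<rightarrow> S\<^sub>0\<close> is given by an atlas \<open>\<A>\<close> of local trivializations, not necessarily maximal. The last
  assumption says that the restrictions of these trivializations to the link \<open>L \<times> {1}\<close> are smooth for
  the smooth structure of \<open>R\<close>; this is what makes \<open>\<pi> : \<rho>\<^sup>-\<^sup>1(1) \<rightarrow> S\<^sub>0\<close> a smooth fiber bundle whose total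
  space is a submanifold of \<open>R\<close>.
\<close>

locale two_strata_space =
  fixes X :: "'x topology" and S\<^sub>0 R :: "'x mfd"
    and T :: "'x set" and \<pi> :: "'x \<Rightarrow> 'x" and \<rho> :: "'x \<Rightarrow> real"
    and L :: "'l mfd" and \<A> :: "('x set \<times> ('x \<times> 'l cone \<Rightarrow> 'x)) set"
  assumes X: "locally_compact_space X" "Hausdorff_space X" "second_countable X"
    and singular_closed: "closedin X (carr S\<^sub>0)"
    and singular_subspace: "mtop S\<^sub>0 = subtopology X (carr S\<^sub>0)"
    and singular_manifold: "closed_manifold S\<^sub>0" "connected_space (mtop S\<^sub>0)"
    and regular_manifold: "mtop R = subtopology X (topspace X - carr S\<^sub>0)" "smooth_manifold R"
    and regular_dense: "X closure_of carr R = topspace X"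
    and T: "openin X T" "carr S\<^sub>0 \<subseteq> T"
    and \<pi>: "continuous_map (subtopology X T) (mtop S\<^sub>0) \<pi>" "\<And>x. x \<in> carr S\<^sub>0 \<Longrightarrow> \<pi> x = x"
      "smooth_map (restrict_mfd R (T - carr S\<^sub>0)) S\<^sub>0 \<pi>"
    and \<rho>: "continuous_map (subtopology X T) (top_of_set {0..<2}) \<rho>" "{x \<in> T. \<rho> x = 0} = carr S\<^sub>0"
      "smooth_map (restrict_mfd R (T - carr S\<^sub>0)) real_mfd \<rho>"
    and L: "closed_manifold L"
    and triv: "\<And>U \<psi>. (U, \<psi>) \<in> \<A> \<Longrightarrow> cone_triv X S\<^sub>0 T \<pi> \<rho> L U \<psi>"
    and triv_cover: "(\<Union>(U, \<psi>)\<in>\<A>. U) = carr S\<^sub>0"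
    and triv_change: "\<And>c c'. c \<in> \<A> \<Longrightarrow> c' \<in> \<A> \<Longrightarrow> cone_triv_change S\<^sub>0 L c c'"
    and link_smooth: "\<And>U \<psi>. (U, \<psi>) \<in> \<A> \<Longrightarrow>
      immersion (prod_mfd (restrict_mfd S\<^sub>0 U) L) R (\<lambda>(u, l). \<psi> (u, Some (l, 1)))"

text \<open>The local trivializations of the bundle: the maximal atlas determined by \<open>\<A>\<close>.\<close>

definition bundle_cone_triv ::
    "'x topology \<Rightarrow> 'x mfd \<Rightarrow> 'x set \<Rightarrow> ('x \<Rightarrow> 'x) \<Rightarrow> ('x \<Rightarrow> real) \<Rightarrow> 'l mfd \<Rightarrow>
     ('x set \<times> ('x \<times> 'l cone \<Rightarrow> 'x)) set \<Rightarrow> 'x set \<Rightarrow> ('x \<times> 'l cone \<Rightarrow> 'x) \<Rightarrow> bool" where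
  "bundle_cone_triv X S\<^sub>0 T \<pi> \<rho> L \<A> U \<psi> \<longleftrightarrow>
     cone_triv X S\<^sub>0 T \<pi> \<rho> L U \<psi> \<and>
     (\<forall>c\<in>\<A>. cone_triv_change S\<^sub>0 L (U, \<psi>) c \<and> cone_triv_change S\<^sub>0 L c (U, \<psi>))"

text \<open>
  The pullback of the link bundle to an immersed submanifold \<open>S\<close> of the singular stratum, e.g. a leaf
  (for \<open>S\<close> the singular stratum itself this is the link bundle). Its topology is that of the fiber
  product of \<open>S\<close>, in its own topology, with \<open>\<rho>\<^sup>-\<^sup>1(1)\<close>; its smooth structure is carried over from
  \<open>(U \<inter> S) \<times> L\<close> by the local trivializations.
\<close>

definition link_bundle_over ::
    "'x topology \<Rightarrow> 'x set \<Rightarrow> ('x \<Rightarrow> 'x) \<Rightarrow> ('x \<Rightarrow> real) \<Rightarrow> 'l mfd \<Rightarrow>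
     ('x set \<times> ('x \<times> 'l cone \<Rightarrow> 'x)) set \<Rightarrow> 'x mfd \<Rightarrow> 'x mfd" where
  "link_bundle_over X T \<pi> \<rho> L \<A> S =
     \<lparr>mtop = pullback_topology {x \<in> T. \<pi> x \<in> carr S \<and> \<rho> x = 1} (\<lambda>x. (\<pi> x, x))
               (prod_topology (mtop S) X),
      mdim = mdim S + mdim L,
      atlas = {(h ` Z, \<theta> \<circ> inv_into Z h) |U \<psi> h Z \<theta>.
                 (U, \<psi>) \<in> \<A> \<and> h = (\<lambda>(u, l). \<psi> (u, Some (l, 1))) \<and>
                 (Z, \<theta>) \<in> atlas (prod_mfd (restrict_mfd S U) L)}\<rparr>"


section \<open>Stratified foliations\<close>

text \<open>
  Under \<open>\<psi>\<close> the leaves \<open>A \<times> (K \<times> {t})\<close> of the product of the restriction of \<open>\<S>\<close> to \<open>U\<close> with the cone on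
  \<open>\<L>\<close> minus its vertex correspond to the leaves of \<open>\<X>\<close> restricted to \<open>\<pi>\<^sup>-\<^sup>1(U)\<close> minus the singular stratum.
\<close>

definition foliated_cone_triv ::
    "'x mfd \<Rightarrow> 'x set \<Rightarrow> ('x \<Rightarrow> 'x) \<Rightarrow> 'x mfd set \<Rightarrow> 'x mfd set \<Rightarrow>
     'x set \<Rightarrow> ('x \<times> 'l cone \<Rightarrow> 'x) \<Rightarrow> 'l mfd set \<Rightarrow> bool" where
  "foliated_cone_triv S\<^sub>0 T \<pi> \<X> \<S> U \<psi> \<L> \<longleftrightarrow>
     {\<psi> ` (carr A \<times> Some ` (carr K \<times> {t})) |A K t.
        A \<in> restrict_foliation \<S> U \<and> K \<in> \<L> \<and> t \<in> {0<..<2}}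
     = carr ` restrict_foliation \<X> ({x \<in> T. \<pi> x \<in> U} - carr S\<^sub>0)"

definition stratified_foliation ::
    "'x topology \<Rightarrow> 'x mfd \<Rightarrow> 'x mfd \<Rightarrow> 'x set \<Rightarrow> ('x \<Rightarrow> 'x) \<Rightarrow> ('x \<Rightarrow> real) \<Rightarrow> 'l mfd \<Rightarrow>
     ('x set \<times> ('x \<times> 'l cone \<Rightarrow> 'x)) set \<Rightarrow> 'x mfd set \<Rightarrow> 'x mfd set \<Rightarrow> bool" where
  "stratified_foliation X S\<^sub>0 R T \<pi> \<rho> L \<A> \<X> \<S> \<longleftrightarrow>
     (\<exists>k. smooth_foliation R k \<X>) \<and> (\<exists>k. smooth_foliation S\<^sub>0 k \<S>) \<and>
     (\<forall>p\<in>carr S\<^sub>0. \<exists>U \<psi> \<L> k.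
        p \<in> U \<and> bundle_cone_triv X S\<^sub>0 T \<pi> \<rho> L \<A> U \<psi> \<and> smooth_foliation L k \<L> \<and>
        foliated_cone_triv S\<^sub>0 T \<pi> \<X> \<S> U \<psi> \<L>)"

definition zero_dim_on_links ::
    "'x topology \<Rightarrow> 'x mfd \<Rightarrow> 'x set \<Rightarrow> ('x \<Rightarrow> 'x) \<Rightarrow> ('x \<Rightarrow> real) \<Rightarrow> 'l mfd \<Rightarrow>
     ('x set \<times> ('x \<times> 'l cone \<Rightarrow> 'x)) set \<Rightarrow> 'x mfd set \<Rightarrow> 'x mfd set \<Rightarrow> bool" where
  "zero_dim_on_links X S\<^sub>0 T \<pi> \<rho> L \<A> \<X> \<S> \<longleftrightarrow>
     (\<forall>p\<in>carr S\<^sub>0. \<exists>U \<psi> \<L>.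
        p \<in> U \<and> bundle_cone_triv X S\<^sub>0 T \<pi> \<rho> L \<A> U \<psi> \<and> point_foliation L \<L> \<and>
        foliated_cone_triv S\<^sub>0 T \<pi> \<X> \<S> U \<psi> \<L>)"

end

theory Submission
  imports Defs
begin

text \<open>
  Along a leaf \<open>S\<close> of the singular stratum the transition functions between the given trivializations
  are families of diffeomorphisms of \<open>L\<close>, and in the foliated trivializations the plaques of
  \<open>\<X>\<close> are the slices \<open>A \<times> {l} \<times> {t}\<close>. Follow a point \<open>l\<close> of the link over a connected open \<open>N \<subseteq> S\<close>: in
  one trivialization the slice stays in a single leaf \<open>F\<close> of \<open>\<X>\<close>, and since \<open>F\<close> is second countable
  and locally connected it meets the other trivialized neighbourhood in only countably many plaques.
  So the transition function takes countably many values at \<open>l\<close>; they form a connected subset of the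
  compact Hausdorff space \<open>L\<close>, hence a single point, and the transition functions are locally constant.

  Smoothness of the pulled back link bundle rests on the chain rule; for coordinatewise
  differentiability it comes from a telescoping sum over the coordinates and the mean value theorem.
\<close>

section \<open>Calculus in coordinates\<close>

text \<open>A leaf of \<open>\<X>\<close> may return to the same trivialized neighbourhood
  infinitely often and accumulate on itself, so lying on a common leaf does not fix the link
  coordinate. That is why plaques are counted rather than separated, and why the count has to be
  combined with continuity of the transition functions. A Urysohn function on \<open>L\<close> moves
  the last step to the real line, where a connected set with two points is uncountable.
  Connectedness and countability are taken in the leaf topologies: the leaves of a restricted
  foliation are components for those, and a leaf is second countable as a manifold in its own right.
  A second obstacle is formal. Flatness includes that the pulled back link bundle is a smooth
  bundle, and its charts are built from \<open>\<A>\<close> only, whereas the foliated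
  trivializations are merely compatible with \<open>\<A>\<close>. Hence two of them are never
  compared directly, but through a member of \<open>\<A>\<close>, and smoothness of one of them is
  checked near each point through such a member.\<close>

lemma Euclidean_space_box:
  assumes W: "openin (Euclidean_space n) W" and p: "p \<in> W"
  obtains e where "e > 0"
    "\<And>y. y \<in> topspace (Euclidean_space n) \<Longrightarrow> (\<And>i. i < n \<Longrightarrow> \<bar>y i - p i\<bar> < e) \<Longrightarrow> y \<in> W"
proof -
  obtain W' where W': "openin (powertop_real UNIV) W'" "W = W' \<inter> {x. \<forall>i\<ge>n. x i = 0}"
    using W unfolding Euclidean_space_def openin_subtopology by auto
  obtain B where B: "p \<in> (\<Pi>\<^sub>E i\<in>UNIV. B i)" "\<And>i. open (B i)" "(\<Pi>\<^sub>E i\<in>UNIV. B i) \<subseteq> W'"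
    using product_topology_open_contains_basis [OF W'(1), of p] p W'(2) by auto
  have "\<exists>e>0. ball (p i) e \<subseteq> B i" for i
    using B(1,2) open_contains_ball by (metis PiE_mem UNIV_I)
  then obtain e where e: "\<And>i. e i > 0" "\<And>i. ball (p i) (e i) \<subseteq> B i" by metis
  define d where "d = Min (insert 1 (e ` {..<n}))"
  have "d > 0" unfolding d_def using e(1) by (subst Min_gr_iff) auto
  moreover have "y \<in> W" if y: "y \<in> topspace (Euclidean_space n)" "\<And>i. i < n \<Longrightarrow> \<bar>y i - p i\<bar> < d" for y
  proof -
    have "y i \<in> B i" for i
    proof (cases "i < n")
      case True
      then have "d \<le> e i" unfolding d_def by (intro Min_le) auto
      then have "y i \<in> ball (p i) (e i)" using y(2) [OF True] by (auto simp: dist_real_def)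
      then show ?thesis using e(2) by blast
    next
      case False
      then have "y i = p i" using y(1) p W'(2) by (auto simp: topspace_Euclidean_space)
      then show ?thesis using e(1,2) by (metis centre_in_ball subsetD)
    qed
    then show ?thesis using B(3) W'(2) y(1) by (auto simp: topspace_Euclidean_space)
  qed
  ultimately show thesis using that by blast
qed

lemma continuous_map_Euclidean_box:
  assumes W: "openin (Euclidean_space n) W" and p: "p \<in> W" and "e > 0"
    and f: "continuous_map (subtopology (Euclidean_space n) W) euclideanreal f"
  obtains d where "d > 0"
    "\<And>y. y \<in> topspace (Euclidean_space n) \<Longrightarrow> (\<And>i. i < n \<Longrightarrow> \<bar>y i - p i\<bar> < d) \<Longrightarrow>
       y \<in> W \<and> \<bar>f y - f p\<bar> < e"
proof -
  have "openin (subtopology (Euclidean_space n) W)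
      {x \<in> topspace (subtopology (Euclidean_space n) W). f x \<in> ball (f p) e}"
    by (rule openin_continuous_map_preimage [OF f]) simp
  then have "openin (Euclidean_space n) {x \<in> topspace (subtopology (Euclidean_space n) W). f x \<in> ball (f p) e}"
    using W openin_trans_full by blast
  moreover have "p \<in> {x \<in> topspace (subtopology (Euclidean_space n) W). f x \<in> ball (f p) e}"
    using p W \<open>e > 0\<close> openin_subset by fastforce
  ultimately obtain d where "d > 0"
    "\<And>y. y \<in> topspace (Euclidean_space n) \<Longrightarrow> (\<And>i. i < n \<Longrightarrow> \<bar>y i - p i\<bar> < d) \<Longrightarrow>
        y \<in> {x \<in> topspace (subtopology (Euclidean_space n) W). f x \<in> ball (f p) e}"
    by (rule Euclidean_space_box) blast
  then show thesis using that by (force simp: dist_real_def abs_minus_commute)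
qed

lemma eventually_update_in:
  assumes W: "openin (Euclidean_space n) W" and x: "x \<in> W" and i: "i < n"
  shows "\<forall>\<^sub>F t in nhds (x i). x(i := t) \<in> W"
proof -
  obtain e where e: "e > 0"
    "\<And>y. y \<in> topspace (Euclidean_space n) \<Longrightarrow> (\<And>i. i < n \<Longrightarrow> \<bar>y i - x i\<bar> < e) \<Longrightarrow> y \<in> W"
    using Euclidean_space_box [OF W x] by blast
  have "x \<in> topspace (Euclidean_space n)" using W x openin_subset by blast
  then have "x(i := t) \<in> W" if "dist t (x i) < e" for t
    using that i \<open>e > 0\<close> by (intro e(2)) (auto simp: topspace_Euclidean_space dist_real_def)
  then show ?thesis using \<open>e > 0\<close> unfolding eventually_nhds_metric by blast
qed

text \<open>The form along a curve is the one that partial derivatives of a composite need: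
  \<open>partial_deriv i\<close> of \<open>g\<close> after \<open>f\<close> is the derivative of
  \<open>g\<close> along the curve \<open>t \<mapsto> f (x(i := t))\<close>. Continuity of the
  partial derivatives of \<open>g\<close> replaces total differentiability.\<close>

lemma chain_rule_partials:
  fixes c :: "real \<Rightarrow> nat \<Rightarrow> real"
  assumes W: "openin (Euclidean_space m) W" and g: "C_k m (Suc 0) W g"
    and c: "\<forall>\<^sub>F t in nhds t\<^sub>0. c t \<in> W"
    and c': "\<And>j. j < m \<Longrightarrow> ((\<lambda>t. c t j) has_field_derivative c' j) (at t\<^sub>0)"
  shows "((\<lambda>t. g (c t)) has_field_derivative (\<Sum>j<m. partial_deriv j g (c t\<^sub>0) * c' j)) (at t\<^sub>0)"
proof -
  define p where "p = c t\<^sub>0"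
  have p: "p \<in> W" using eventually_nhds_x_imp_x [OF c] p_def by simp
  have Wsub: "W \<subseteq> topspace (Euclidean_space m)" using W openin_subset by blast
  \<comment> \<open>\<open>z j t\<close> has the first \<open>j\<close> coordinates of
    \<open>c t\<close> and the others of \<open>p\<close>. It runs from \<open>p\<close> at
    \<open>j = 0\<close> to \<open>c t\<close> at \<open>j = m\<close>, one coordinate at a time,
    and \<open>D j\<close> is the increment of \<open>g\<close> in step \<open>j\<close>.\<close>
  define z where "z = (\<lambda>j t i. if i < j then c t i else p i)"
  define D where "D = (\<lambda>j t. g (z (Suc j) t) - g (z j t))"
  have cont: "((\<lambda>t. c t j) \<longlongrightarrow> p j) (at t\<^sub>0)" if "j < m" for j
    using DERIV_isCont [OF c' [OF that]] unfolding isCont_def p_def .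
  have step: "((\<lambda>t. D j t / (t - t\<^sub>0)) \<longlongrightarrow> partial_deriv j g p * c' j) (at t\<^sub>0)" if j: "j < m" for j
  proof -
    \<comment> \<open>The difference quotient of \<open>g\<close> in direction \<open>j\<close>. The
      value chosen where the denominator vanishes keeps both the factorization \<open>Dq\<close> and
      the limit of \<open>q\<close> valid, although \<open>c t j\<close> may return to
      \<open>p j\<close> arbitrarily near \<open>t\<^sub>0\<close>.\<close>
    define q where
      "q = (\<lambda>t. if c t j = p j then partial_deriv j g p else D j t / (c t j - p j))"
    have Dq: "D j t = q t * (c t j - p j)" for t
    proof (cases "c t j = p j")
      case True
      then have "z (Suc j) t = z j t" unfolding z_def by (auto simp: less_Suc_eq)
      then show ?thesis using True by (simp add: D_def)
    qed (simp add: q_def)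
    have q: "(q \<longlongrightarrow> partial_deriv j g p) (at t\<^sub>0)"
    proof (rule tendstoI)
      fix e :: real assume "e > 0"
      obtain d where d: "d > 0"
        "\<And>y. y \<in> topspace (Euclidean_space m) \<Longrightarrow> (\<And>i. i < m \<Longrightarrow> \<bar>y i - p i\<bar> < d) \<Longrightarrow>
          y \<in> W \<and> \<bar>partial_deriv j g y - partial_deriv j g p\<bar> < e"
        using continuous_map_Euclidean_box [OF W p \<open>e > 0\<close>, of "partial_deriv j g"] g j by auto
      have "\<forall>\<^sub>F t in at t\<^sub>0. \<forall>i\<in>{..<m}. \<bar>c t i - p i\<bar> < d"
        by (rule eventually_ball_finite) (use tendstoD [OF cont \<open>d > 0\<close>] in \<open>auto simp: dist_real_def\<close>)
      moreover have "\<forall>\<^sub>F t in at t\<^sub>0. c t \<in> W" using c eventually_at_filter eventually_mono by fastforce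
      ultimately show "\<forall>\<^sub>F t in at t\<^sub>0. dist (q t) (partial_deriv j g p) < e"
      proof eventually_elim
        case (elim t)
        \<comment> \<open>The segment from \<open>z j t\<close> to \<open>z (Suc j) t\<close>. It
          stays in the box of radius \<open>d\<close> around \<open>p\<close>, so the mean value
          theorem evaluates \<open>q t\<close> as a partial derivative within \<open>e\<close> of
          the one at \<open>p\<close>.\<close>
        define y where "y = (\<lambda>s. (z j t)(j := s))"
        have y: "y s \<in> W \<and> \<bar>partial_deriv j g (y s) - partial_deriv j g p\<bar> < e"
          if "\<bar>s - p j\<bar> \<le> \<bar>c t j - p j\<bar>" for s
        proof (rule d(2))
          show "y s \<in> topspace (Euclidean_space m)"
            using elim(2) p Wsub j unfolding y_def z_def by (auto simp: topspace_Euclidean_space)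
          show "\<bar>y s i - p i\<bar> < d" if "i < m" for i
            using elim(1) that j \<open>d > 0\<close> \<open>\<bar>s - p j\<bar> \<le> \<bar>c t j - p j\<bar>\<close> unfolding y_def z_def
            by (auto intro: le_less_trans)
        qed
        have der: "((\<lambda>s. g (y s)) has_field_derivative partial_deriv j g (y s)) (at s)"
          if "\<bar>s - p j\<bar> \<le> \<bar>c t j - p j\<bar>" for s
        proof -
          have "(\<lambda>u. g ((y s)(j := u))) field_differentiable (at (y s j))"
            using g j y [OF that] by auto
          then have "((\<lambda>u. g ((y s)(j := u))) has_field_derivative partial_deriv j g (y s)) (at (y s j))"
            unfolding partial_deriv_def using field_differentiable_derivI by blast
          then show ?thesis by (simp add: y_def)
        qed
        have z1: "z (Suc j) t = y (c t j)" and z0: "z j t = y (p j)"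
          unfolding z_def y_def by (auto simp: less_Suc_eq fun_eq_iff)
        show ?case
        proof (cases "c t j = p j")
          case True
          then show ?thesis using \<open>e > 0\<close> by (simp add: q_def)
        next
          case False
          obtain s where s: "\<bar>s - p j\<bar> \<le> \<bar>c t j - p j\<bar>"
            "g (y (c t j)) - g (y (p j)) = (c t j - p j) * partial_deriv j g (y s)"
          proof (cases "p j < c t j")
            case True
            obtain s where "p j < s" "s < c t j"
              "g (y (c t j)) - g (y (p j)) = (c t j - p j) * partial_deriv j g (y s)"
              using MVT2 [OF True, of "\<lambda>s. g (y s)" "\<lambda>s. partial_deriv j g (y s)"] der by auto
            then show thesis using that [of s] by auto
          next
            case False
            then have lt: "c t j < p j" using \<open>c t j \<noteq> p j\<close> by simp
            obtain s where "c t j < s" "s < p j"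
              "g (y (p j)) - g (y (c t j)) = (p j - c t j) * partial_deriv j g (y s)"
              using MVT2 [OF lt, of "\<lambda>s. g (y s)" "\<lambda>s. partial_deriv j g (y s)"] der by auto
            then show thesis using that [of s] by (auto simp: algebra_simps)
          qed
          then have "q t = partial_deriv j g (y s)"
            using False by (simp add: q_def D_def z1 z0)
          then show ?thesis using y [OF s(1)] by (simp add: dist_real_def)
        qed
      qed
    qed
    have "((\<lambda>t. (c t j - p j) / (t - t\<^sub>0)) \<longlongrightarrow> c' j) (at t\<^sub>0)"
      using c' [OF j] unfolding has_field_derivative_iff p_def .
    from tendsto_mult [OF q this] show ?thesis by (simp add: Dq)
  qed
  have telescope: "g (c t) - g p = (\<Sum>j<m. D j t)" if "c t \<in> W" for t
  proof -
    have "z m t = c t"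
    proof
      fix i
      have "c t i = p i" if "\<not> i < m"
        using that subsetD [OF Wsub \<open>c t \<in> W\<close>] subsetD [OF Wsub p]
        by (simp add: topspace_Euclidean_space)
      then show "z m t i = c t i" by (simp add: z_def)
    qed
    moreover have "z 0 t = p" by (simp add: z_def)
    moreover have "(\<Sum>j<m. D j t) = g (z m t) - g (z 0 t)"
      unfolding D_def by (rule sum_lessThan_telescope)
    ultimately show ?thesis by simp
  qed
  have "((\<lambda>t. \<Sum>j<m. D j t / (t - t\<^sub>0)) \<longlongrightarrow> (\<Sum>j<m. partial_deriv j g p * c' j)) (at t\<^sub>0)"
    by (rule tendsto_sum) (use step in auto)
  moreover have "\<forall>\<^sub>F t in at t\<^sub>0. (\<Sum>j<m. D j t / (t - t\<^sub>0)) = (g (c t) - g (c t\<^sub>0)) / (t - t\<^sub>0)"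
  proof -
    have "\<forall>\<^sub>F t in at t\<^sub>0. c t \<in> W" using c eventually_at_filter eventually_mono by fastforce
    then show ?thesis
    proof eventually_elim
      case (elim t)
      then show ?case using telescope [OF elim] by (simp add: p_def sum_divide_distrib)
    qed
  qed
  ultimately show ?thesis
    unfolding has_field_derivative_iff p_def by (rule Lim_transform_eventually)
qed

section \<open>Rules for functions of class C^k on open subsets of R^n\<close>

lemma C_k_imp_continuous:
  "C_k n k W f \<Longrightarrow> continuous_map (subtopology (Euclidean_space n) W) euclideanreal f"
  by (cases k) auto

text \<open>Because \<open>W\<close> is open, the coordinate line through a point of
  \<open>W\<close> stays in \<open>W\<close> for a while. Values off \<open>W\<close> therefore do
  not matter, which is essential for functions written with \<open>inv_into\<close>, whose values
  outside a chart image are arbitrary.\<close>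

lemma partial_deriv_cong:
  assumes W: "openin (Euclidean_space n) W" and x: "x \<in> W" and i: "i < n"
    and fg: "\<And>x. x \<in> W \<Longrightarrow> f x = g x"
  shows "(\<lambda>t. f (x(i := t))) field_differentiable (at (x i)) \<longleftrightarrow>
         (\<lambda>t. g (x(i := t))) field_differentiable (at (x i))"
    and "partial_deriv i f x = partial_deriv i g x"
proof -
  have ev: "\<forall>\<^sub>F t in nhds (x i). f (x(i := t)) = g (x(i := t))"
    using eventually_update_in [OF W x i] by eventually_elim (rule fg)
  show "(\<lambda>t. f (x(i := t))) field_differentiable (at (x i)) \<longleftrightarrow>
         (\<lambda>t. g (x(i := t))) field_differentiable (at (x i))"
    unfolding field_differentiable_def using DERIV_cong_ev [OF refl ev refl] by auto
  show "partial_deriv i f x = partial_deriv i g x"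
    unfolding partial_deriv_def by (rule deriv_cong_ev [OF ev refl])
qed

lemma C_k_cong:
  assumes W: "openin (Euclidean_space n) W"
  shows "(\<And>x. x \<in> W \<Longrightarrow> f x = g x) \<Longrightarrow> C_k n k W f \<Longrightarrow> C_k n k W g"
proof (induction k arbitrary: f g)
  case 0
  then show ?case by (auto intro: continuous_map_eq)
next
  case (Suc k)
  show ?case
    unfolding C_k.simps
  proof (intro conjI allI impI ballI)
    show "continuous_map (subtopology (Euclidean_space n) W) euclideanreal g"
      using Suc.prems by (auto intro: continuous_map_eq)
    fix i assume i: "i < n"
    show "C_k n k W (partial_deriv i g)"
      by (rule Suc.IH [of "partial_deriv i f"])
        (use Suc.prems i partial_deriv_cong(2) [OF W _ i, of _ f g] in auto)
    show "(\<lambda>t. g (x(i := t))) field_differentiable at (x i)" if "x \<in> W" for x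
      using Suc.prems that i partial_deriv_cong(1) [OF W that i, of f g] by auto
  qed
qed

lemma C_k_subset: "C_k n k W f \<Longrightarrow> W' \<subseteq> W \<Longrightarrow> C_k n k W' f"
  by (induction k arbitrary: f) (auto intro: continuous_map_from_subtopology_mono)

lemma C_k_Suc_imp: "C_k n (Suc k) W f \<Longrightarrow> C_k n k W f"
proof (induction k arbitrary: f)
  case (Suc k)
  then show ?case unfolding C_k.simps(2) [of n "Suc k"] C_k.simps(2) [of n k W f] by blast
qed simp

lemma C_k_const: "C_k n k W (\<lambda>x. a)"
proof (induction k arbitrary: a)
  case (Suc k)
  have "partial_deriv i (\<lambda>x. a) = (\<lambda>x. 0)" for i by (auto simp: partial_deriv_def)
  then show ?case using Suc by simp
qed simp

lemma C_k_coordinate: "C_k n k W (\<lambda>x. x i)"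
proof -
  have cont: "continuous_map (subtopology (Euclidean_space n) W) euclideanreal (\<lambda>x. x i)"
    unfolding Euclidean_space_def
    using continuous_map_product_coordinates [of i UNIV "\<lambda>_. euclideanreal"]
    by (intro continuous_map_from_subtopology) simp
  have "partial_deriv j (\<lambda>x. x i) = (\<lambda>x. if i = j then 1 else 0)" for j
    by (auto simp: partial_deriv_def fun_upd_def)
  moreover have "(\<lambda>t. (x(j := t)) i) field_differentiable at (x j)" for j and x :: "nat \<Rightarrow> real"
    by (cases "i = j") (auto simp: field_differentiable_ident field_differentiable_const)
  ultimately show ?thesis using cont by (cases k) (auto simp: C_k_const)
qed

lemma C_k_add:
  assumes W: "openin (Euclidean_space n) W"
  shows "C_k n k W f \<Longrightarrow> C_k n k W g \<Longrightarrow> C_k n k W (\<lambda>x. f x + g x)"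
proof (induction k arbitrary: f g)
  case 0
  then show ?case by (auto intro: continuous_map_add)
next
  case (Suc k)
  show ?case
    unfolding C_k.simps
  proof (intro conjI allI impI ballI)
    show "continuous_map (subtopology (Euclidean_space n) W) euclideanreal (\<lambda>x. f x + g x)"
      using Suc.prems by (auto intro: continuous_map_add)
    fix i assume i: "i < n"
    show "(\<lambda>t. f (x(i := t)) + g (x(i := t))) field_differentiable at (x i)" if "x \<in> W" for x
      using Suc.prems i that by (auto intro: field_differentiable_add)
    show "C_k n k W (partial_deriv i (\<lambda>x. f x + g x))"
    proof (rule C_k_cong [OF W])
      show "C_k n k W (\<lambda>x. partial_deriv i f x + partial_deriv i g x)"
        by (rule Suc.IH) (use Suc.prems i in auto)
      show "partial_deriv i f x + partial_deriv i g x = partial_deriv i (\<lambda>x. f x + g x) x" if "x \<in> W" for x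
        unfolding partial_deriv_def using Suc.prems i that by (subst deriv_add) auto
    qed
  qed
qed

lemma C_k_mult:
  assumes W: "openin (Euclidean_space n) W"
  shows "C_k n k W f \<Longrightarrow> C_k n k W g \<Longrightarrow> C_k n k W (\<lambda>x. f x * g x)"
proof (induction k arbitrary: f g)
  case 0
  then show ?case by (auto intro: continuous_map_real_mult)
next
  case (Suc k)
  show ?case
    unfolding C_k.simps
  proof (intro conjI allI impI ballI)
    show "continuous_map (subtopology (Euclidean_space n) W) euclideanreal (\<lambda>x. f x * g x)"
      using Suc.prems by (auto intro: continuous_map_real_mult)
    fix i assume i: "i < n"
    show "(\<lambda>t. f (x(i := t)) * g (x(i := t))) field_differentiable at (x i)" if "x \<in> W" for x
      using Suc.prems i that by (auto intro: field_differentiable_mult)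
    show "C_k n k W (partial_deriv i (\<lambda>x. f x * g x))"
    proof (rule C_k_cong [OF W])
      show "C_k n k W (\<lambda>x. f x * partial_deriv i g x + partial_deriv i f x * g x)"
        by (intro C_k_add [OF W] Suc.IH) (use Suc.prems i in \<open>simp_all add: C_k_Suc_imp [OF Suc.prems(1)] C_k_Suc_imp [OF Suc.prems(2)]\<close>)
      show "f x * partial_deriv i g x + partial_deriv i f x * g x = partial_deriv i (\<lambda>x. f x * g x) x"
        if "x \<in> W" for x
        unfolding partial_deriv_def using Suc.prems i that by (subst deriv_mult) auto
    qed
  qed
qed

lemma C_k_sum:
  assumes "openin (Euclidean_space n) W" and "\<And>j. j \<in> J \<Longrightarrow> C_k n k W (f j)"
  shows "C_k n k W (\<lambda>x. \<Sum>j\<in>J. f j x)"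
  using assms(2) by (induction J rule: infinite_finite_induct) (auto simp: C_k_const C_k_add [OF assms(1)])

text \<open>Induction on \<open>k\<close> with \<open>g\<close> arbitrary. By the chain rule a
  partial derivative of the composite is a sum of products of \<open>partial_deriv j g\<close> after
  \<open>f\<close>, covered by the induction hypothesis, with partial derivatives of the coordinates
  of \<open>f\<close>.\<close>

lemma C_k_compose:
  assumes W: "openin (Euclidean_space n) W" and W': "openin (Euclidean_space m) W'"
    and fW: "\<And>x. x \<in> W \<Longrightarrow> f x \<in> W'"
  shows "(\<And>j. j < m \<Longrightarrow> C_k n k W (\<lambda>x. f x j)) \<Longrightarrow> C_k m k W' g \<Longrightarrow> C_k n k W (\<lambda>x. g (f x))"
proof (induction k arbitrary: g)
  have cont: "continuous_map (subtopology (Euclidean_space n) W) euclideanreal (\<lambda>x. g (f x))"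
    if f: "\<And>j. j < m \<Longrightarrow> continuous_map (subtopology (Euclidean_space n) W) euclideanreal (\<lambda>x. f x j)"
      and g: "continuous_map (subtopology (Euclidean_space m) W') euclideanreal g" for g
  proof -
    \<comment> \<open>Nothing is assumed about the coordinates of \<open>f\<close> beyond
      \<open>m\<close>. On \<open>W\<close> they vanish, since \<open>f\<close> maps
      \<open>W\<close> into \<open>W'\<close>, which lies in R^m.\<close>
    have "continuous_map (subtopology (Euclidean_space n) W) (Euclidean_space m) (\<lambda>x i. if i < m then f x i else 0)"
      using f by (simp add: continuous_map_componentwise_Euclidean_space)
    then have "continuous_map (subtopology (Euclidean_space n) W) (Euclidean_space m) f"
    proof (rule continuous_map_eq)
      fix x assume "x \<in> topspace (subtopology (Euclidean_space n) W)"
      then have "f x \<in> topspace (Euclidean_space m)" using fW W' openin_subset by fastforce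
      then show "(\<lambda>i. if i < m then f x i else 0) = f x" by (auto simp: topspace_Euclidean_space)
    qed
    then have "continuous_map (subtopology (Euclidean_space n) W) (subtopology (Euclidean_space m) W') f"
      using fW by (auto simp: continuous_map_in_subtopology)
    then show ?thesis using continuous_map_compose [OF _ g] by (simp add: o_def)
  qed
  {
    case 0
    then show ?case using cont by simp
  next
    case (Suc k)
    have f: "C_k n k W (\<lambda>x. f x j)" if "j < m" for j using Suc.prems(1) [OF that] by (rule C_k_Suc_imp)
    have g1: "C_k m (Suc 0) W' g" using Suc.prems(2) C_k_imp_continuous by auto
    have der: "((\<lambda>t. g (f (x(i := t)))) has_field_derivative
        (\<Sum>j<m. partial_deriv j g (f x) * partial_deriv i (\<lambda>x. f x j) x)) (at (x i))"
      if "x \<in> W" "i < n" for x i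
    proof -
      have "((\<lambda>t. g (f (x(i := t)))) has_field_derivative
        (\<Sum>j<m. partial_deriv j g (f (x(i := x i))) * partial_deriv i (\<lambda>x. f x j) x)) (at (x i))"
      proof (rule chain_rule_partials [OF W' g1])
        show "\<forall>\<^sub>F t in nhds (x i). f (x(i := t)) \<in> W'"
          using eventually_update_in [OF W that] by eventually_elim (rule fW)
        show "((\<lambda>t. f (x(i := t)) j) has_field_derivative partial_deriv i (\<lambda>x. f x j) x) (at (x i))"
          if "j < m" for j
          unfolding partial_deriv_def
          using Suc.prems(1) [OF that] \<open>x \<in> W\<close> \<open>i < n\<close> field_differentiable_derivI by auto
      qed
      then show ?thesis by simp
    qed
    show ?case
      unfolding C_k.simps
    proof (intro conjI allI impI ballI)
      show "continuous_map (subtopology (Euclidean_space n) W) euclideanreal (\<lambda>x. g (f x))"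
        by (rule cont [OF C_k_imp_continuous [OF Suc.prems(1)] C_k_imp_continuous [OF Suc.prems(2)]])
      fix i assume i: "i < n"
      show "(\<lambda>t. g (f (x(i := t)))) field_differentiable at (x i)" if "x \<in> W" for x
        using der [OF that i] field_differentiable_def by blast
      show "C_k n k W (partial_deriv i (\<lambda>x. g (f x)))"
      proof (rule C_k_cong [OF W])
        show "C_k n k W (\<lambda>x. \<Sum>j<m. partial_deriv j g (f x) * partial_deriv i (\<lambda>x. f x j) x)"
        proof (rule C_k_sum [OF W], rule C_k_mult [OF W])
          fix j assume j: "j \<in> {..<m}"
          show "C_k n k W (\<lambda>x. partial_deriv j g (f x))"
            using Suc.IH [of "partial_deriv j g"] f Suc.prems(2) j by auto
          show "C_k n k W (partial_deriv i (\<lambda>x. f x j))" using Suc.prems(1) [of j] i j by simp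
        qed
        show "(\<Sum>j<m. partial_deriv j g (f x) * partial_deriv i (\<lambda>x. f x j) x)
            = partial_deriv i (\<lambda>x. g (f x)) x" if "x \<in> W" for x
          using DERIV_imp_deriv [OF der [OF that i]] by (simp add: partial_deriv_def)
      qed
    qed
  }
qed

text \<open>The passage from pointwise smoothness, as in \<open>smooth_at\<close>, to smoothness on
  a whole chart image. The neighbourhoods \<open>V\<close> may stick out of
  \<open>W\<close>.\<close>

lemma C_k_local:
  assumes "openin (Euclidean_space n) W"
  shows "(\<And>x. x \<in> W \<Longrightarrow> \<exists>V. openin (Euclidean_space n) V \<and> x \<in> V \<and> C_k n k V f) \<Longrightarrow> C_k n k W f"
proof (induction k arbitrary: f)
  have cont: "continuous_map (subtopology (Euclidean_space n) W) euclideanreal f"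
    if loc: "\<And>x. x \<in> W \<Longrightarrow> \<exists>V. openin (Euclidean_space n) V \<and> x \<in> V \<and>
           continuous_map (subtopology (Euclidean_space n) V) euclideanreal f" for f
    unfolding continuous_map_eq_topcontinuous_at
  proof
    fix x assume "x \<in> topspace (subtopology (Euclidean_space n) W)"
    then have x: "x \<in> W" by simp
    then obtain V where V: "openin (Euclidean_space n) V" "x \<in> V"
      "continuous_map (subtopology (Euclidean_space n) V) euclideanreal f" using loc by blast
    show "topcontinuous_at (subtopology (Euclidean_space n) W) euclideanreal f x"
      unfolding topcontinuous_at_def
    proof (intro conjI allI impI)
      show "x \<in> topspace (subtopology (Euclidean_space n) W)" by fact
      fix B assume B: "openin euclideanreal B \<and> f x \<in> B"
      have "openin (subtopology (Euclidean_space n) V) {y \<in> topspace (subtopology (Euclidean_space n) V). f y \<in> B}"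
        by (rule openin_continuous_map_preimage [OF V(3)]) (use B in auto)
      then have "openin (Euclidean_space n) {y \<in> topspace (subtopology (Euclidean_space n) V). f y \<in> B}"
        using V(1) openin_trans_full by blast
      then have "openin (subtopology (Euclidean_space n) W)
          (W \<inter> {y \<in> topspace (subtopology (Euclidean_space n) V). f y \<in> B})"
        by (rule openin_subtopology_Int2)
      moreover have "x \<in> topspace (Euclidean_space n)" using V openin_subset by blast
      ultimately show "\<exists>U. openin (subtopology (Euclidean_space n) W) U \<and> x \<in> U \<and> (\<forall>y\<in>U. f y \<in> B)"
        using x V B by (intro exI [of _ "W \<inter> {y \<in> topspace (subtopology (Euclidean_space n) V). f y \<in> B}"]) auto
    qed auto
  qed
  {
    case 0
    then show ?case using cont by simp
  next
    case (Suc k)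
    show ?case
      unfolding C_k.simps
    proof (intro conjI allI impI ballI)
      show "continuous_map (subtopology (Euclidean_space n) W) euclideanreal f"
      proof (rule cont)
        fix x assume "x \<in> W"
        then obtain V where V: "openin (Euclidean_space n) V" "x \<in> V" "C_k n (Suc k) V f"
          using Suc.prems by blast
        then show "\<exists>V. openin (Euclidean_space n) V \<and> x \<in> V \<and>
            continuous_map (subtopology (Euclidean_space n) V) euclideanreal f"
          using C_k_imp_continuous [OF V(3)] by blast
      qed
      fix i assume i: "i < n"
      show "(\<lambda>t. f (x(i := t))) field_differentiable at (x i)" if "x \<in> W" for x
        using Suc.prems [OF that] i by auto
      show "C_k n k W (partial_deriv i f)"
      proof (rule Suc.IH)
        fix x assume "x \<in> W"
        then obtain V where V: "openin (Euclidean_space n) V" "x \<in> V" "C_k n (Suc k) V f"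
          using Suc.prems by blast
        then show "\<exists>V. openin (Euclidean_space n) V \<and> x \<in> V \<and> C_k n k V (partial_deriv i f)"
          using i by auto
      qed
    qed
  }
qed

section \<open>Smooth functions and smooth maps\<close>

text \<open>Smoothness of a germ of a real function, asked in one chart on one neighbourhood that
  serves all orders \<open>k\<close>. It replaces the quantification over pairs of charts in
  \<open>smooth_map\<close> by a local condition that does not mention charts of the source.\<close>

definition smooth_at :: "'a mfd \<Rightarrow> ('a \<Rightarrow> real) \<Rightarrow> 'a \<Rightarrow> bool" where
  "smooth_at M u p \<longleftrightarrow> (\<exists>U \<phi> Q. (U, \<phi>) \<in> atlas M \<and> openin (mtop M) Q \<and> p \<in> Q \<and> Q \<subseteq> U \<and>
     (\<forall>k. C_k (mdim M) k (\<phi> ` Q) (\<lambda>x. u (inv_into U \<phi> x))))"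

lemma
  assumes "smooth_manifold M" "(U, \<phi>) \<in> atlas M"
  shows chart_open: "openin (mtop M) U"
    and chart_subset: "U \<subseteq> carr M"
    and chart_image_open': "openin (Euclidean_space (mdim M)) (\<phi> ` U)"
    and chart_homeo: "homeomorphic_map (subtopology (mtop M) U)
          (subtopology (Euclidean_space (mdim M)) (\<phi> ` U)) \<phi>"
    and chart_inj: "inj_on \<phi> U"
proof -
  show o: "openin (mtop M) U" and "openin (Euclidean_space (mdim M)) (\<phi> ` U)"
    and h: "homeomorphic_map (subtopology (mtop M) U)
          (subtopology (Euclidean_space (mdim M)) (\<phi> ` U)) \<phi>"
    using assms unfolding smooth_manifold_def by blast+
  show s: "U \<subseteq> carr M" using o openin_subset by blast
  have "inj_on \<phi> (topspace (subtopology (mtop M) U))"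
    using h homeomorphic_imp_injective_map by blast
  then show "inj_on \<phi> U" using s by (simp add: inf_absorb2)
qed

lemma chart_image_open:
  assumes "smooth_manifold M" "(U, \<phi>) \<in> atlas M" "openin (mtop M) Q" "Q \<subseteq> U"
  shows "openin (Euclidean_space (mdim M)) (\<phi> ` Q)"
proof -
  have "openin (subtopology (mtop M) U) Q" using assms(3,4) openin_subset_topspace_eq
    by (metis inf.absorb_iff2 openin_subtopology_Int2)
  then have "openin (subtopology (Euclidean_space (mdim M)) (\<phi> ` U)) (\<phi> ` Q)"
    using chart_homeo [OF assms(1,2)] homeomorphic_map_openness_eq by blast
  then show ?thesis using chart_image_open' [OF assms(1,2)] openin_trans_full by blast
qed

lemma chart_cover:
  assumes "smooth_manifold M" "p \<in> carr M"
  obtains U \<phi> where "(U, \<phi>) \<in> atlas M" "p \<in> U"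
  using assms unfolding smooth_manifold_def by blast

lemma chart_transition:
  assumes "smooth_manifold M" "(U, \<phi>) \<in> atlas M" "(V, \<theta>) \<in> atlas M" "j < mdim M"
  shows "C_k (mdim M) k (\<phi> ` (U \<inter> V)) (\<lambda>x. \<theta> (inv_into U \<phi> x) j)"
proof -
  have "\<forall>(U, \<phi>)\<in>atlas M. \<forall>(V, \<theta>)\<in>atlas M.
      smooth_Rn (mdim M) (mdim M) (\<phi> ` (U \<inter> V)) (\<theta> \<circ> inv_into U \<phi>)"
    using assms(1) unfolding smooth_manifold_def by (elim conjE)
  from bspec [OF this assms(2)]
  have "\<forall>(V, \<theta>)\<in>atlas M. smooth_Rn (mdim M) (mdim M) (\<phi> ` (U \<inter> V)) (\<theta> \<circ> inv_into U \<phi>)"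
    unfolding prod.case .
  from bspec [OF this assms(3)]
  have "smooth_Rn (mdim M) (mdim M) (\<phi> ` (U \<inter> V)) (\<theta> \<circ> inv_into U \<phi>)"
    unfolding prod.case .
  then show ?thesis using assms(4) unfolding smooth_Rn_def by simp
qed

lemma smooth_at_in_carr: "smooth_at M u p \<Longrightarrow> p \<in> carr M"
  unfolding smooth_at_def using openin_subset by blast

text \<open>Independence of the chart: on the overlap, \<open>u\<close> in the chart
  \<open>\<phi>\<close> is \<open>u\<close> in the chart \<open>\<theta>\<close> composed with a
  transition function, so \<open>C_k_compose\<close> applies.\<close>

lemma smooth_at_chart:
  assumes M: "smooth_manifold M" and u: "smooth_at M u p" and U: "(U, \<phi>) \<in> atlas M" "p \<in> U"
  obtains Q where "openin (mtop M) Q" "p \<in> Q" "Q \<subseteq> U"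
    "\<And>k. C_k (mdim M) k (\<phi> ` Q) (\<lambda>x. u (inv_into U \<phi> x))"
proof -
  obtain V \<theta> Q where V: "(V, \<theta>) \<in> atlas M" "openin (mtop M) Q" "p \<in> Q" "Q \<subseteq> V"
     "\<And>k. C_k (mdim M) k (\<theta> ` Q) (\<lambda>x. u (inv_into V \<theta> x))"
    using u unfolding smooth_at_def by blast
  define P where "P = Q \<inter> U"
  have P: "openin (mtop M) P" "p \<in> P" "P \<subseteq> U" "P \<subseteq> V" "P \<subseteq> Q"
    using V U chart_open [OF M U(1)] unfolding P_def by auto
  note injU = chart_inj [OF M U(1)] and injV = chart_inj [OF M V(1)]
  have pre: "inv_into U \<phi> x \<in> P \<and> \<phi> (inv_into U \<phi> x) = x" if "x \<in> \<phi> ` P" for x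
    using that injU P(3) by (auto simp: subset_iff)
  have "C_k (mdim M) k (\<phi> ` P) (\<lambda>x. u (inv_into U \<phi> x))" for k
  proof (rule C_k_cong [OF chart_image_open [OF M U(1) P(1,3)]])
    show "C_k (mdim M) k (\<phi> ` P) (\<lambda>x. u (inv_into V \<theta> (\<theta> (inv_into U \<phi> x))))"
    proof (rule C_k_compose [where g = "\<lambda>y. u (inv_into V \<theta> y)"])
      show "openin (Euclidean_space (mdim M)) (\<phi> ` P)" by (rule chart_image_open [OF M U(1) P(1,3)])
      show "openin (Euclidean_space (mdim M)) (\<theta> ` Q)" by (rule chart_image_open [OF M V(1) V(2,4)])
      show "\<theta> (inv_into U \<phi> x) \<in> \<theta> ` Q" if "x \<in> \<phi> ` P" for x using pre [OF that] P(5) by blast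
      show "C_k (mdim M) k (\<phi> ` P) (\<lambda>x. \<theta> (inv_into U \<phi> x) j)" if "j < mdim M" for j
        by (rule C_k_subset [OF chart_transition [OF M U(1) V(1) that]]) (use P(3,4) in auto)
      show "C_k (mdim M) k (\<theta> ` Q) (\<lambda>y. u (inv_into V \<theta> y))" by (rule V(5))
    qed
    show "u (inv_into V \<theta> (\<theta> (inv_into U \<phi> x))) = u (inv_into U \<phi> x)" if "x \<in> \<phi> ` P" for x
      using pre [OF that] P(4) injV by (simp add: subset_iff)
  qed
  then show thesis using that P by blast
qed

lemma smooth_at_iff_C_k:
  assumes M: "smooth_manifold M" and U: "(U, \<phi>) \<in> atlas M" and Q: "openin (mtop M) Q" "Q \<subseteq> U"
  shows "(\<forall>k. C_k (mdim M) k (\<phi> ` Q) (\<lambda>x. u (inv_into U \<phi> x))) \<longleftrightarrow> (\<forall>p\<in>Q. smooth_at M u p)"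
proof
  assume "\<forall>k. C_k (mdim M) k (\<phi> ` Q) (\<lambda>x. u (inv_into U \<phi> x))"
  then show "\<forall>p\<in>Q. smooth_at M u p" unfolding smooth_at_def using U Q by blast
next
  assume R: "\<forall>p\<in>Q. smooth_at M u p"
  show "\<forall>k. C_k (mdim M) k (\<phi> ` Q) (\<lambda>x. u (inv_into U \<phi> x))"
  proof (intro allI C_k_local)
    fix k x
    show "openin (Euclidean_space (mdim M)) (\<phi> ` Q)" by (rule chart_image_open [OF M U Q])
    assume "x \<in> \<phi> ` Q"
    then obtain p where p: "p \<in> Q" "x = \<phi> p" by blast
    then have "smooth_at M u p" "p \<in> U" using R Q by auto
    then obtain P where "openin (mtop M) P" "p \<in> P" "P \<subseteq> U"
      "\<And>k. C_k (mdim M) k (\<phi> ` P) (\<lambda>x. u (inv_into U \<phi> x))"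
      using smooth_at_chart [OF M _ U] by blast
    then show "\<exists>V. openin (Euclidean_space (mdim M)) V \<and> x \<in> V \<and> C_k (mdim M) k V (\<lambda>x. u (inv_into U \<phi> x))"
      using chart_image_open [OF M U] p by blast
  qed
qed

lemma smooth_at_cong:
  assumes M: "smooth_manifold M" and u: "smooth_at M u p"
    and Q: "openin (mtop M) Q" "p \<in> Q" and uv: "\<And>x. x \<in> Q \<Longrightarrow> u x = v x"
  shows "smooth_at M v p"
proof -
  obtain U \<phi> where U: "(U, \<phi>) \<in> atlas M" "p \<in> U"
    using chart_cover [OF M smooth_at_in_carr [OF u]] .
  obtain P where P: "openin (mtop M) P" "p \<in> P" "P \<subseteq> U"
      "\<And>k. C_k (mdim M) k (\<phi> ` P) (\<lambda>x. u (inv_into U \<phi> x))"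
    using smooth_at_chart [OF M u U] by blast
  have PQ: "openin (mtop M) (P \<inter> Q)" "P \<inter> Q \<subseteq> U" using P Q by auto
  have "C_k (mdim M) k (\<phi> ` (P \<inter> Q)) (\<lambda>x. v (inv_into U \<phi> x))" for k
  proof (rule C_k_cong [OF chart_image_open [OF M U(1) PQ]])
    show "C_k (mdim M) k (\<phi> ` (P \<inter> Q)) (\<lambda>x. u (inv_into U \<phi> x))" by (rule C_k_subset [OF P(4)]) auto
    show "u (inv_into U \<phi> x) = v (inv_into U \<phi> x)" if "x \<in> \<phi> ` (P \<inter> Q)" for x
      using that inv_into_f_f [OF chart_inj [OF M U(1)]] P(3) by (auto simp: subset_iff intro!: uv)
  qed
  then show ?thesis unfolding smooth_at_def using U(1) PQ P(2) Q(2) by blast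
qed

lemma smooth_at_coordinate:
  assumes M: "smooth_manifold M" and V: "(V, \<theta>) \<in> atlas M" "q \<in> V"
  shows "smooth_at M (\<lambda>x. \<theta> x j) q"
proof -
  have "C_k (mdim M) k (\<theta> ` V) (\<lambda>x. \<theta> (inv_into V \<theta> x) j)" for k
    by (rule C_k_cong [OF chart_image_open' [OF M V(1)] _ C_k_coordinate])
      (simp add: f_inv_into_f)
  then show ?thesis unfolding smooth_at_def using V chart_open [OF M V(1)] by blast
qed

text \<open>Smoothness of \<open>f\<close> is asked only at \<open>p\<close> and only in one chart
  of the target. In this form the lemma also yields the change of target chart in
  \<open>smooth_mapI\<close>, where smoothness of \<open>f\<close> as a map is still to be
  shown.\<close>

lemma smooth_at_compose_chart:
  assumes M: "smooth_manifold M" and N: "smooth_manifold N"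
    and f: "continuous_map (mtop M) (mtop N) f"
    and p: "p \<in> carr M" and V: "(V, \<theta>) \<in> atlas N" "f p \<in> V"
    and sm: "\<And>j. j < mdim N \<Longrightarrow> smooth_at M (\<lambda>x. \<theta> (f x) j) p"
    and u: "smooth_at N u (f p)"
  shows "smooth_at M (\<lambda>x. u (f x)) p"
proof -
  obtain U \<phi> where U: "(U, \<phi>) \<in> atlas M" "p \<in> U" using chart_cover [OF M p] .
  obtain Q where Q: "openin (mtop N) Q" "f p \<in> Q" "Q \<subseteq> V"
      "\<And>k. C_k (mdim N) k (\<theta> ` Q) (\<lambda>x. u (inv_into V \<theta> x))"
    using smooth_at_chart [OF N u V] by blast
  have "\<exists>P. openin (mtop M) P \<and> p \<in> P \<and> P \<subseteq> U \<and>
      (\<forall>k. C_k (mdim M) k (\<phi> ` P) (\<lambda>x. \<theta> (f (inv_into U \<phi> x)) j))" if "j < mdim N" for j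
    using smooth_at_chart [OF M sm [OF that] U] by metis
  then obtain P where P: "\<And>j. j < mdim N \<Longrightarrow> openin (mtop M) (P j) \<and> p \<in> P j \<and> P j \<subseteq> U \<and>
      (\<forall>k. C_k (mdim M) k (\<phi> ` (P j)) (\<lambda>x. \<theta> (f (inv_into U \<phi> x)) j))" by metis
  define O' where "O' = {x \<in> carr M. f x \<in> Q}"
  have "openin (mtop M) O'" unfolding O'_def by (rule openin_continuous_map_preimage [OF f Q(1)])
  \<comment> \<open>The neighbourhoods \<open>P j\<close> depend on the coordinate, and there are
    finitely many of them. The inserted set keeps the family nonempty when \<open>N\<close> has
    dimension zero.\<close>
  define R where "R = \<Inter>(insert (U \<inter> O') (P ` {..<mdim N}))"
  have R: "openin (mtop M) R" "p \<in> R" "R \<subseteq> U" "R \<subseteq> O'"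
  proof -
    show "openin (mtop M) R" unfolding R_def
      by (rule openin_Inter) (use \<open>openin (mtop M) O'\<close> chart_open [OF M U(1)] P in auto)
    show "p \<in> R" using P U(2) p Q(2) unfolding R_def O'_def by auto
  qed (auto simp: R_def)
  have RP: "R \<subseteq> P j" if "j < mdim N" for j using that unfolding R_def by auto
  note oR = chart_image_open [OF M U(1) R(1,3)]
  have pre: "inv_into U \<phi> x \<in> R" if "x \<in> \<phi> ` R" for x
    using that chart_inj [OF M U(1)] R(3) by (auto simp: subset_iff)
  have "C_k (mdim M) k (\<phi> ` R) (\<lambda>x. u (f (inv_into U \<phi> x)))" for k
  proof (rule C_k_cong [OF oR])
    show "C_k (mdim M) k (\<phi> ` R) (\<lambda>x. u (inv_into V \<theta> (\<theta> (f (inv_into U \<phi> x)))))"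
    proof (rule C_k_compose [OF oR, where g = "\<lambda>y. u (inv_into V \<theta> y)"])
      show "openin (Euclidean_space (mdim N)) (\<theta> ` Q)" by (rule chart_image_open [OF N V(1) Q(1,3)])
      show "\<theta> (f (inv_into U \<phi> x)) \<in> \<theta> ` Q" if "x \<in> \<phi> ` R" for x
        using pre [OF that] R(4) unfolding O'_def by blast
      show "C_k (mdim M) k (\<phi> ` R) (\<lambda>x. \<theta> (f (inv_into U \<phi> x)) j)" if "j < mdim N" for j
        using P [OF that] RP [OF that] C_k_subset image_mono by metis
      show "C_k (mdim N) k (\<theta> ` Q) (\<lambda>y. u (inv_into V \<theta> y))" by (rule Q(4))
    qed
    show "u (inv_into V \<theta> (\<theta> (f (inv_into U \<phi> x)))) = u (f (inv_into U \<phi> x))" if "x \<in> \<phi> ` R" for x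
      using pre [OF that] R(4) Q(3) chart_inj [OF N V(1)] unfolding O'_def
      by (simp add: subset_iff)
  qed
  then show ?thesis unfolding smooth_at_def using U R by blast
qed

text \<open>For continuous \<open>f\<close> the set of points of \<open>U\<close> mapped into
  \<open>V\<close> is open, so smoothness in a pair of charts amounts to \<open>smooth_at\<close> at
  each of its points.\<close>

lemma smooth_map_iff:
  assumes M: "smooth_manifold M" and N: "smooth_manifold N"
  shows "smooth_map M N f \<longleftrightarrow> continuous_map (mtop M) (mtop N) f \<and>
    (\<forall>p\<in>carr M. \<forall>(V, \<theta>)\<in>atlas N. f p \<in> V \<longrightarrow> (\<forall>j<mdim N. smooth_at M (\<lambda>x. \<theta> (f x) j) p))"
    (is "_ \<longleftrightarrow> ?c \<and> ?r")
proof (cases ?c)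
  case True
  have key: "smooth_Rn (mdim M) (mdim N) (\<phi> ` {x \<in> U. f x \<in> V}) (\<theta> \<circ> f \<circ> inv_into U \<phi>) \<longleftrightarrow>
      (\<forall>j<mdim N. \<forall>p\<in>{x \<in> U. f x \<in> V}. smooth_at M (\<lambda>x. \<theta> (f x) j) p)"
    if U: "(U, \<phi>) \<in> atlas M" and V: "(V, \<theta>) \<in> atlas N" for U \<phi> V \<theta>
  proof -
    have "openin (mtop M) (U \<inter> {x \<in> carr M. f x \<in> V})"
      using chart_open [OF M U] openin_continuous_map_preimage [OF True chart_open [OF N V]] by blast
    moreover have "U \<inter> {x \<in> carr M. f x \<in> V} = {x \<in> U. f x \<in> V}" using chart_subset [OF M U] by auto
    ultimately have "openin (mtop M) {x \<in> U. f x \<in> V}" by simp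
    moreover have "{x \<in> U. f x \<in> V} \<subseteq> U" by auto
    ultimately have "(\<forall>k. C_k (mdim M) k (\<phi> ` {x \<in> U. f x \<in> V}) (\<lambda>x. \<theta> (f (inv_into U \<phi> x)) j)) \<longleftrightarrow>
        (\<forall>p\<in>{x \<in> U. f x \<in> V}. smooth_at M (\<lambda>x. \<theta> (f x) j) p)" for j
      by (rule smooth_at_iff_C_k [OF M U])
    then show ?thesis unfolding smooth_Rn_def by simp
  qed
  have "smooth_map M N f \<longleftrightarrow> (\<forall>(U, \<phi>)\<in>atlas M. \<forall>(V, \<theta>)\<in>atlas N.
      \<forall>j<mdim N. \<forall>p\<in>{x \<in> U. f x \<in> V}. smooth_at M (\<lambda>x. \<theta> (f x) j) p)"
    unfolding smooth_map_def using True key by fast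
  also have "\<dots> \<longleftrightarrow> ?r"
  proof
    assume l: "\<forall>(U, \<phi>)\<in>atlas M. \<forall>(V, \<theta>)\<in>atlas N.
      \<forall>j<mdim N. \<forall>p\<in>{x \<in> U. f x \<in> V}. smooth_at M (\<lambda>x. \<theta> (f x) j) p"
    show ?r
    proof (intro ballI, clarify)
      fix p V \<theta> j assume "p \<in> carr M" "(V, \<theta>) \<in> atlas N" "f p \<in> V" "j < mdim N"
      moreover from chart_cover [OF M \<open>p \<in> carr M\<close>] obtain U \<phi> where "(U, \<phi>) \<in> atlas M" "p \<in> U" .
      ultimately show "smooth_at M (\<lambda>x. \<theta> (f x) j) p" using l by fast
    qed
  next
    assume ?r
    then show "\<forall>(U, \<phi>)\<in>atlas M. \<forall>(V, \<theta>)\<in>atlas N.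
      \<forall>j<mdim N. \<forall>p\<in>{x \<in> U. f x \<in> V}. smooth_at M (\<lambda>x. \<theta> (f x) j) p"
      using chart_subset [OF M] by fast
  qed
  finally show ?thesis using True by simp
qed (auto simp: smooth_map_def)

lemma smooth_mapD:
  assumes "smooth_manifold M" "smooth_manifold N" "smooth_map M N f"
    "p \<in> carr M" "(V, \<theta>) \<in> atlas N" "f p \<in> V" "j < mdim N"
  shows "smooth_at M (\<lambda>x. \<theta> (f x) j) p"
  using assms unfolding smooth_map_iff [OF assms(1,2)] by fast

lemma smooth_map_imp_continuous: "smooth_map M N f \<Longrightarrow> continuous_map (mtop M) (mtop N) f"
  by (simp add: smooth_map_def)

lemma smooth_map_imp_into: "smooth_map M N f \<Longrightarrow> x \<in> carr M \<Longrightarrow> f x \<in> carr N"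
  using smooth_map_imp_continuous continuous_map_image_subset_topspace by fastforce

lemma smooth_at_compose:
  assumes M: "smooth_manifold M" and N: "smooth_manifold N" and f: "smooth_map M N f"
    and p: "p \<in> carr M" and u: "smooth_at N u (f p)"
  shows "smooth_at M (\<lambda>x. u (f x)) p"
proof -
  obtain V \<theta> where V: "(V, \<theta>) \<in> atlas N" "f p \<in> V"
    using chart_cover [OF N smooth_at_in_carr [OF u]] .
  show ?thesis
    by (rule smooth_at_compose_chart [OF M N smooth_map_imp_continuous [OF f] p V _ u])
      (rule smooth_mapD [OF M N f p V])
qed

text \<open>The practical criterion: around each image point a single target chart may be chosen.
  The other charts follow because their coordinates are smooth functions on
  \<open>N\<close>.\<close>

lemma smooth_mapI:
  assumes M: "smooth_manifold M" and N: "smooth_manifold N"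
    and c: "continuous_map (mtop M) (mtop N) f"
    and sm: "\<And>p. p \<in> carr M \<Longrightarrow> \<exists>V \<theta>. (V, \<theta>) \<in> atlas N \<and> f p \<in> V \<and>
      (\<forall>j<mdim N. smooth_at M (\<lambda>x. \<theta> (f x) j) p)"
  shows "smooth_map M N f"
  unfolding smooth_map_iff [OF M N]
proof (intro conjI c ballI, clarify)
  fix p V \<theta> j assume p: "p \<in> carr M" and V: "(V, \<theta>) \<in> atlas N" "f p \<in> V" and "j < mdim N"
  obtain V' \<theta>' where V': "(V', \<theta>') \<in> atlas N" "f p \<in> V'"
    "\<And>j. j < mdim N \<Longrightarrow> smooth_at M (\<lambda>x. \<theta>' (f x) j) p" using sm [OF p] by blast
  show "smooth_at M (\<lambda>x. \<theta> (f x) j) p"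
    by (rule smooth_at_compose_chart [OF M N c p V'(1,2) V'(3), where u = "\<lambda>y. \<theta> y j"])
      (auto intro: smooth_at_coordinate [OF N V])
qed

lemma smooth_map_compose:
  assumes M: "smooth_manifold M" and N: "smooth_manifold N" and P: "smooth_manifold P"
    and f: "smooth_map M N f" and g: "smooth_map N P g"
  shows "smooth_map M P (\<lambda>x. g (f x))"
proof (rule smooth_mapI [OF M P])
  show "continuous_map (mtop M) (mtop P) (\<lambda>x. g (f x))"
    using continuous_map_compose [OF smooth_map_imp_continuous [OF f] smooth_map_imp_continuous [OF g]]
    by (simp add: o_def)
  fix p assume p: "p \<in> carr M"
  have fp: "f p \<in> carr N" using smooth_map_imp_into [OF f p] .
  obtain V \<theta> where V: "(V, \<theta>) \<in> atlas P" "g (f p) \<in> V"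
    using chart_cover [OF P smooth_map_imp_into [OF g fp]] .
  have "smooth_at M (\<lambda>x. \<theta> (g (f x)) j) p" if "j < mdim P" for j
    by (rule smooth_at_compose [OF M N f p]) (rule smooth_mapD [OF N P g fp V that])
  then show "\<exists>V \<theta>. (V, \<theta>) \<in> atlas P \<and> g (f p) \<in> V \<and> (\<forall>j<mdim P. smooth_at M (\<lambda>x. \<theta> (g (f x)) j) p)"
    using V by blast
qed

lemma smooth_map_cong:
  assumes f: "smooth_map M N f" and fg: "\<And>x. x \<in> carr M \<Longrightarrow> f x = g x"
    and M: "smooth_manifold M" and N: "smooth_manifold N"
  shows "smooth_map M N g"
  unfolding smooth_map_iff [OF M N]
proof (intro conjI ballI, goal_cases)
  case 1
  show ?case using continuous_map_eq [OF smooth_map_imp_continuous [OF f]] fg by blast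
next
  case (2 p c)
  obtain V \<theta> where c: "c = (V, \<theta>)" by (cases c)
  have "smooth_at M (\<lambda>x. \<theta> (g x) j) p" if "g p \<in> V" "j < mdim N" for j
  proof (rule smooth_at_cong [OF M])
    show "smooth_at M (\<lambda>x. \<theta> (f x) j) p" using f fg that 2 c by (auto intro: smooth_mapD [OF M N f])
    show "openin (mtop M) (carr M)" "p \<in> carr M" using 2 by auto
  qed (simp add: fg)
  then show ?case using c by auto
qed

section \<open>Restriction of manifolds and smooth maps to open subsets\<close>

lemma restrict_mfd_simps [simp]:
  "mtop (restrict_mfd M W) = subtopology (mtop M) W" "mdim (restrict_mfd M W) = mdim M"
  "atlas (restrict_mfd M W) = {(U \<inter> W, \<phi>) |U \<phi>. (U, \<phi>) \<in> atlas M}"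
  by (auto simp: restrict_mfd_def)

lemma inv_into_Int: "inj_on f U \<Longrightarrow> x \<in> f ` (U \<inter> W) \<Longrightarrow> inv_into (U \<inter> W) f x = inv_into U f x"
  by (auto simp: inj_on_Int inv_into_f_eq)

text \<open>Openness is asked of the trace \<open>carr M \<inter> W\<close>, since the sets used
  later are not contained in the carrier: open sets of the singular stratum cut down a leaf, and
  sets such as \<open>{x. h x \<in> A}\<close> are defined on the whole type.\<close>

lemma smooth_manifold_restrict:
  assumes M: "smooth_manifold M" and W: "openin (mtop M) (carr M \<inter> W)"
  shows "smooth_manifold (restrict_mfd M W)"
proof -
  have oUW: "openin (mtop M) (U \<inter> W)" if "(U, \<phi>) \<in> atlas M" for U \<phi>
  proof -
    have "U \<inter> W = U \<inter> (carr M \<inter> W)" using chart_subset [OF M that] by auto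
    then show ?thesis using chart_open [OF M that] W by auto
  qed
  have hom: "homeomorphic_map (subtopology (subtopology (mtop M) W) (U \<inter> W))
          (subtopology (Euclidean_space (mdim M)) (\<phi> ` (U \<inter> W))) \<phi>" if U: "(U, \<phi>) \<in> atlas M" for U \<phi>
  proof -
    have eq: "\<phi> ` topspace (subtopology (mtop M) U) = topspace (subtopology (Euclidean_space (mdim M)) (\<phi> ` U))"
      using chart_homeo [OF M U] homeomorphic_imp_surjective_map by blast
    have s: "U \<subseteq> carr M" by (rule chart_subset [OF M U])
    have "homeomorphic_map (subtopology (subtopology (mtop M) U) (U \<inter> W))
       (subtopology (subtopology (Euclidean_space (mdim M)) (\<phi> ` U)) (\<phi> ` (U \<inter> W))) \<phi>"
      by (rule homeomorphic_map_subtopologies [OF chart_homeo [OF M U]])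
        (use eq s chart_inj [OF M U] in \<open>auto simp: inj_on_def\<close>)
    moreover have "\<phi> ` U \<inter> \<phi> ` (U \<inter> W) = \<phi> ` (U \<inter> W)" by auto
    ultimately show ?thesis by (simp add: subtopology_subtopology Int_commute Int_left_commute inf_absorb2)
  qed
  have tr: "smooth_Rn (mdim M) (mdim M) (\<phi> ` ((U \<inter> W) \<inter> (V \<inter> W))) (\<theta> \<circ> inv_into (U \<inter> W) \<phi>)"
    if U: "(U, \<phi>) \<in> atlas M" and V: "(V, \<theta>) \<in> atlas M" for U \<phi> V \<theta>
    unfolding smooth_Rn_def
  proof (intro allI impI)
    fix j k assume j: "j < mdim M"
    have o: "openin (Euclidean_space (mdim M)) (\<phi> ` ((U \<inter> W) \<inter> (V \<inter> W)))"
      by (rule chart_image_open [OF M U]) (use oUW [OF U] oUW [OF V] in auto)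
    show "C_k (mdim M) k (\<phi> ` ((U \<inter> W) \<inter> (V \<inter> W))) (\<lambda>x. (\<theta> \<circ> inv_into (U \<inter> W) \<phi>) x j)"
    proof (rule C_k_cong [OF o])
      show "C_k (mdim M) k (\<phi> ` ((U \<inter> W) \<inter> (V \<inter> W))) (\<lambda>x. \<theta> (inv_into U \<phi> x) j)"
        by (rule C_k_subset [OF chart_transition [OF M U V j]]) auto
      show "\<theta> (inv_into U \<phi> x) j = (\<theta> \<circ> inv_into (U \<inter> W) \<phi>) x j" if "x \<in> \<phi> ` ((U \<inter> W) \<inter> (V \<inter> W))" for x
        using that by (subst o_apply, subst inv_into_Int [OF chart_inj [OF M U]]) auto
    qed
  qed
  have cov: "(\<Union>(U, \<phi>)\<in>atlas (restrict_mfd M W). U) = carr (restrict_mfd M W)"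
  proof -
    have "(\<Union>(U, \<phi>)\<in>atlas M. U) = carr M" using M unfolding smooth_manifold_def by (elim conjE)
    moreover have "(\<Union>(U, \<phi>)\<in>atlas (restrict_mfd M W). U) = (\<Union>(U, \<phi>)\<in>atlas M. U) \<inter> W"
      unfolding restrict_mfd_simps by blast
    ultimately show ?thesis by simp
  qed
  have "Hausdorff_space (mtop M)" "second_countable (mtop M)" using M by (auto simp: smooth_manifold_def)
  moreover have "openin (subtopology (mtop M) W) (U \<inter> W)" if "(U, \<phi>) \<in> atlas M" for U \<phi>
    using oUW [OF that] by (metis inf.right_idem openin_subtopology)
  moreover have "openin (Euclidean_space (mdim M)) (\<phi> ` (U \<inter> W))" if "(U, \<phi>) \<in> atlas M" for U \<phi>
    by (rule chart_image_open [OF M that oUW [OF that]]) auto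
  ultimately show ?thesis
    unfolding smooth_manifold_def cov
    using hom tr by (auto simp: Hausdorff_space_subtopology second_countable_subtopology simp del: o_apply)
qed

lemma smooth_at_restrict:
  assumes M: "smooth_manifold M" and W: "openin (mtop M) (carr M \<inter> W)" and p: "p \<in> W"
  shows "smooth_at (restrict_mfd M W) u p \<longleftrightarrow> smooth_at M u p"
proof
  assume "smooth_at (restrict_mfd M W) u p"
  then obtain U \<phi> Q where U: "(U, \<phi>) \<in> atlas M" and Q: "openin (subtopology (mtop M) W) Q" "p \<in> Q" "Q \<subseteq> U \<inter> W"
     and C: "\<And>k. C_k (mdim M) k (\<phi> ` Q) (\<lambda>x. u (inv_into (U \<inter> W) \<phi> x))"
    unfolding smooth_at_def by auto
  have oQ: "openin (mtop M) Q" using Q(1) W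
    by (metis openin_trans_full subtopology_restrict)
  have "C_k (mdim M) k (\<phi> ` Q) (\<lambda>x. u (inv_into U \<phi> x))" for k
  proof (rule C_k_cong [OF chart_image_open [OF M U oQ] _ C])
    show "u (inv_into (U \<inter> W) \<phi> x) = u (inv_into U \<phi> x)" if "x \<in> \<phi> ` Q" for x
      using that Q(3) by (subst inv_into_Int [OF chart_inj [OF M U]]) auto
  qed (use Q in auto)
  then show "smooth_at M u p" unfolding smooth_at_def using U oQ Q by blast
next
  assume u: "smooth_at M u p"
  then obtain U \<phi> Q where U: "(U, \<phi>) \<in> atlas M" and Q: "openin (mtop M) Q" "p \<in> Q" "Q \<subseteq> U"
     and C: "\<And>k. C_k (mdim M) k (\<phi> ` Q) (\<lambda>x. u (inv_into U \<phi> x))"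
    unfolding smooth_at_def by auto
  have eq: "Q \<inter> W = Q \<inter> (carr M \<inter> W)" using Q chart_subset [OF M U] by auto
  have oQ: "openin (mtop M) (Q \<inter> W)" unfolding eq using Q(1) W by blast
  have "C_k (mdim M) k (\<phi> ` (Q \<inter> W)) (\<lambda>x. u (inv_into (U \<inter> W) \<phi> x))" for k
  proof (rule C_k_cong [OF chart_image_open [OF M U oQ]])
    show "C_k (mdim M) k (\<phi> ` (Q \<inter> W)) (\<lambda>x. u (inv_into U \<phi> x))" by (rule C_k_subset [OF C]) auto
    show "u (inv_into U \<phi> x) = u (inv_into (U \<inter> W) \<phi> x)" if "x \<in> \<phi> ` (Q \<inter> W)" for x
      using that Q(3) by (subst inv_into_Int [OF chart_inj [OF M U]]) auto
  qed (use Q in auto)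
  moreover have "openin (subtopology (mtop M) W) (Q \<inter> W)" using Q(1) openin_subtopology by blast
  ultimately show "smooth_at (restrict_mfd M W) u p"
    unfolding smooth_at_def using U Q p by (intro exI [of _ "U \<inter> W"] exI [of _ \<phi>] exI [of _ "Q \<inter> W"]) auto
qed

lemma smooth_map_restrict:
  assumes M: "smooth_manifold M" and N: "smooth_manifold N" and W: "openin (mtop M) (carr M \<inter> W)"
    and f: "smooth_map M N f"
  shows "smooth_map (restrict_mfd M W) N f"
  using f by (auto simp: smooth_map_iff [OF M N] smooth_map_iff [OF smooth_manifold_restrict [OF M W] N]
    smooth_at_restrict [OF M W] continuous_map_from_subtopology)

lemma smooth_map_into_restrict:
  assumes M: "smooth_manifold M" and N: "smooth_manifold N" and W: "openin (mtop N) (carr N \<inter> W)"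
    and f: "smooth_map M N f" and fW: "\<And>x. x \<in> carr M \<Longrightarrow> f x \<in> W"
  shows "smooth_map M (restrict_mfd N W) f"
  using f fW by (fastforce simp: smooth_map_iff [OF M N] smooth_map_iff [OF M smooth_manifold_restrict [OF N W]]
    continuous_map_in_subtopology)

lemma smooth_map_from_restrict:
  assumes M: "smooth_manifold M" and N: "smooth_manifold N" and W: "openin (mtop N) (carr N \<inter> W)"
    and f: "smooth_map M (restrict_mfd N W) f"
  shows "smooth_map M N f"
proof (rule smooth_mapI [OF M N])
  show "continuous_map (mtop M) (mtop N) f"
    using smooth_map_imp_continuous [OF f] by (simp add: continuous_map_in_subtopology)
  fix p assume p: "p \<in> carr M"
  then have "f p \<in> carr N" "f p \<in> W" using smooth_map_imp_into [OF f] by auto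
  moreover obtain V \<theta> where V: "(V, \<theta>) \<in> atlas N" "f p \<in> V" using chart_cover [OF N \<open>f p \<in> carr N\<close>] .
  moreover from V have "(V \<inter> W, \<theta>) \<in> atlas (restrict_mfd N W)" by auto
  ultimately have "smooth_at M (\<lambda>x. \<theta> (f x) j) p" if "j < mdim N" for j
    using f p that unfolding smooth_map_iff [OF M smooth_manifold_restrict [OF N W]] by fastforce
  then show "\<exists>V \<theta>. (V, \<theta>) \<in> atlas N \<and> f p \<in> V \<and> (\<forall>j<mdim N. smooth_at M (\<lambda>x. \<theta> (f x) j) p)"
    using V by blast
qed

text \<open>For maps into or out of the link bundle, whose smoothness is visible only over the sets
  of a trivializing cover.\<close>

lemma smooth_map_local:
  assumes M: "smooth_manifold M" and N: "smooth_manifold N"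
    and loc: "\<And>p. p \<in> carr M \<Longrightarrow> \<exists>W. openin (mtop M) W \<and> p \<in> W \<and> smooth_map (restrict_mfd M W) N f"
  shows "smooth_map M N f"
  unfolding smooth_map_iff [OF M N]
proof (intro conjI ballI)
  show "continuous_map (mtop M) (mtop N) f"
    unfolding continuous_map_eq_topcontinuous_at
  proof
    fix p assume p: "p \<in> carr M"
    obtain W where W: "openin (mtop M) W" "p \<in> W" "smooth_map (restrict_mfd M W) N f" using loc [OF p] by blast
    then have "continuous_map (subtopology (mtop M) W) (mtop N) f" using smooth_map_imp_continuous by force
    then have cont: "topcontinuous_at (subtopology (mtop M) W) (mtop N) f p"
      unfolding continuous_map_eq_topcontinuous_at using p W by simp
    have into: "f x \<in> carr N" if "x \<in> carr M" for x
    proof -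
      from loc [OF that] obtain W where "x \<in> W" "smooth_map (restrict_mfd M W) N f" by blast
      then show ?thesis using smooth_map_imp_into that by fastforce
    qed
    show "topcontinuous_at (mtop M) (mtop N) f p"
      unfolding topcontinuous_at_def
    proof (intro conjI allI impI)
      fix B assume B: "openin (mtop N) B \<and> f p \<in> B"
      obtain U where "openin (subtopology (mtop M) W) U" "p \<in> U" "\<forall>y\<in>U. f y \<in> B"
        using cont B unfolding topcontinuous_at_def by blast
      then show "\<exists>U. openin (mtop M) U \<and> p \<in> U \<and> (\<forall>y\<in>U. f y \<in> B)"
        using openin_trans_full [OF _ W(1)] by blast
    qed (use p into in auto)
  qed
  fix p c assume p: "p \<in> carr M" and "c \<in> atlas N"
  obtain V \<theta> where c: "c = (V, \<theta>)" by (cases c)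
  obtain W where W: "openin (mtop M) W" "p \<in> W" "smooth_map (restrict_mfd M W) N f" using loc [OF p] by blast
  have W': "openin (mtop M) (carr M \<inter> W)" using W(1) by auto
  show "case c of (V, \<theta>) \<Rightarrow> f p \<in> V \<longrightarrow> (\<forall>j<mdim N. smooth_at M (\<lambda>x. \<theta> (f x) j) p)"
    unfolding c prod.case
  proof (intro impI allI)
    fix j assume "f p \<in> V" "j < mdim N"
    then have "smooth_at (restrict_mfd M W) (\<lambda>x. \<theta> (f x) j) p"
      using smooth_mapD [OF smooth_manifold_restrict [OF M W'] N W(3)] p W(2) \<open>c \<in> atlas N\<close> c by simp
    then show "smooth_at M (\<lambda>x. \<theta> (f x) j) p" using smooth_at_restrict [OF M W' W(2)] by simp
  qed
qed

section \<open>Products and gluing of manifolds\<close>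

lemma second_countable_prod_topology:
  assumes "second_countable X" "second_countable Y"
  shows "second_countable (prod_topology X Y)"
proof -
  obtain \<B> \<C> where B: "countable \<B>" "\<And>V. V \<in> \<B> \<Longrightarrow> openin X V"
      "\<And>U x. openin X U \<Longrightarrow> x \<in> U \<Longrightarrow> \<exists>V\<in>\<B>. x \<in> V \<and> V \<subseteq> U"
    and C: "countable \<C>" "\<And>V. V \<in> \<C> \<Longrightarrow> openin Y V"
      "\<And>U x. openin Y U \<Longrightarrow> x \<in> U \<Longrightarrow> \<exists>V\<in>\<C>. x \<in> V \<and> V \<subseteq> U"
    using assms unfolding second_countable_def by metis
  show ?thesis
    unfolding second_countable_def
  proof (intro exI [of _ "(\<lambda>(U, V). U \<times> V) ` (\<B> \<times> \<C>)"] conjI ballI allI impI)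
    show "countable ((\<lambda>(U, V). U \<times> V) ` (\<B> \<times> \<C>))" using B(1) C(1) by blast
    show "openin (prod_topology X Y) V" if "V \<in> (\<lambda>(U, V). U \<times> V) ` (\<B> \<times> \<C>)" for V
      using that B(2) C(2) by (auto simp: openin_prod_Times_iff)
    fix U x assume U: "openin (prod_topology X Y) U \<and> x \<in> U"
    obtain a b where x: "x = (a, b)" by (cases x)
    have "\<exists>V W. openin X V \<and> openin Y W \<and> a \<in> V \<and> b \<in> W \<and> V \<times> W \<subseteq> U"
      by (rule openin_prod_topology_alt [THEN iffD1, rule_format]) (use U x in auto)
    then obtain V W where VW: "openin X V" "openin Y W" "a \<in> V" "b \<in> W" "V \<times> W \<subseteq> U" by blast
    obtain V' W' where "V' \<in> \<B>" "a \<in> V'" "V' \<subseteq> V" "W' \<in> \<C>" "b \<in> W'" "W' \<subseteq> W"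
      using B(3) [OF VW(1,3)] C(3) [OF VW(2,4)] by blast
    then show "\<exists>V\<in>(\<lambda>(U, V). U \<times> V) ` (\<B> \<times> \<C>). x \<in> V \<and> V \<subseteq> U"
      using VW(5) x by (intro bexI [of _ "V' \<times> W'"]) auto
  qed
qed

section \<open>The splitting of R^(m+n) into R^m and R^n, and product charts\<close>

definition join_coords :: "nat \<Rightarrow> (nat \<Rightarrow> real) \<Rightarrow> (nat \<Rightarrow> real) \<Rightarrow> nat \<Rightarrow> real" where
  "join_coords m x y = (\<lambda>i. if i < m then x i else y (i - m))"

text \<open>Points of R^m are sequences vanishing from index \<open>m\<close> on, so the first block
  must be cut off by zeros. The second block, defined by a shift, inherits its zeros from
  R^(m+n).\<close>

definition fst_coords :: "nat \<Rightarrow> (nat \<Rightarrow> real) \<Rightarrow> nat \<Rightarrow> real" where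
  "fst_coords m w = (\<lambda>i. if i < m then w i else 0)"

definition snd_coords :: "nat \<Rightarrow> (nat \<Rightarrow> real) \<Rightarrow> nat \<Rightarrow> real" where
  "snd_coords m w = (\<lambda>i. w (i + m))"

lemma coords_join:
  "x \<in> topspace (Euclidean_space m) \<Longrightarrow> fst_coords m (join_coords m x y) = x"
  "snd_coords m (join_coords m x y) = y"
  "join_coords m (fst_coords m w) (snd_coords m w) = w"
  by (auto simp: join_coords_def fst_coords_def snd_coords_def topspace_Euclidean_space)

lemma continuous_map_coordinate:
  "continuous_map (Euclidean_space n) euclideanreal (\<lambda>w. w i)"
  unfolding Euclidean_space_def
  using continuous_map_product_coordinates [of i UNIV "\<lambda>_. euclideanreal"]
  by (intro continuous_map_from_subtopology) simp

lemma continuous_map_fst_coords: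
  "continuous_map (Euclidean_space n) (Euclidean_space m) (fst_coords m)"
  unfolding fst_coords_def
  by (subst continuous_map_componentwise_Euclidean_space) (simp add: continuous_map_coordinate)

lemma continuous_map_snd_coords:
  "continuous_map (Euclidean_space (m + n)) (Euclidean_space n) (snd_coords m)"
proof (rule continuous_map_eq)
  show "continuous_map (Euclidean_space (m + n)) (Euclidean_space n) (\<lambda>w i. if i < n then w (i + m) else 0)"
    by (subst continuous_map_componentwise_Euclidean_space) (simp add: continuous_map_coordinate)
qed (auto simp: snd_coords_def topspace_Euclidean_space)

lemma continuous_map_join_coords:
  assumes f: "continuous_map X (Euclidean_space m) f" and g: "continuous_map X (Euclidean_space n) g"
  shows "continuous_map X (Euclidean_space (m + n)) (\<lambda>x. join_coords m (f x) (g x))"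
proof (rule continuous_map_eq)
  have "continuous_map X euclideanreal (\<lambda>x. f x i)" "continuous_map X euclideanreal (\<lambda>x. g x i)" for i
    using continuous_map_compose [OF f continuous_map_coordinate]
      continuous_map_compose [OF g continuous_map_coordinate] by (auto simp: o_def)
  then show "continuous_map X (Euclidean_space (m + n))
      (\<lambda>x i. if i < m + n then (\<lambda>x i. if i < m then f x i else g x (i - m)) x i else 0)"
    by (subst continuous_map_componentwise_Euclidean_space) auto
  fix x assume "x \<in> topspace X"
  then have "f x \<in> topspace (Euclidean_space m)" "g x \<in> topspace (Euclidean_space n)"
    using f g continuous_map_image_subset_topspace by fastforce+
  then show "(\<lambda>i. if i < m + n then (\<lambda>x i. if i < m then f x i else g x (i - m)) x i else 0)
      = join_coords m (f x) (g x)"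
    by (auto simp: join_coords_def topspace_Euclidean_space)
qed

lemma prod_mfd_simps [simp]:
  "mtop (prod_mfd M N) = prod_topology (mtop M) (mtop N)" "mdim (prod_mfd M N) = mdim M + mdim N"
  "atlas (prod_mfd M N) = {(U \<times> V, \<lambda>(x, y). join_coords (mdim M) (\<phi> x) (\<theta> y)) |U \<phi> V \<theta>.
                 (U, \<phi>) \<in> atlas M \<and> (V, \<theta>) \<in> atlas N}"
  by (simp_all add: prod_mfd_def join_coords_def)

lemma chart_in_Euclidean:
  assumes "smooth_manifold M" "(U, \<phi>) \<in> atlas M" "x \<in> U"
  shows "\<phi> x \<in> topspace (Euclidean_space (mdim M))"
  using chart_image_open' [OF assms(1,2)] assms(3) openin_subset by blast

text \<open>The two blocks of coordinates recover the factors, which gives injectivity. They also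
  describe the image of a rectangle as an intersection of preimages under continuous projections,
  which gives openness. An open map is then obtained by covering an open set by rectangles.\<close>

lemma prod_chart:
  assumes M: "smooth_manifold M" and N: "smooth_manifold N"
    and U: "(U, \<phi>) \<in> atlas M" and V: "(V, \<theta>) \<in> atlas N"
  defines "\<eta> \<equiv> (\<lambda>(x, y). join_coords (mdim M) (\<phi> x) (\<theta> y))"
  shows prod_chart_inj: "inj_on \<eta> (U \<times> V)"
    and prod_chart_coords: "\<And>z. z \<in> U \<times> V \<Longrightarrow> fst_coords (mdim M) (\<eta> z) = \<phi> (fst z)"
      "\<And>z. z \<in> U \<times> V \<Longrightarrow> snd_coords (mdim M) (\<eta> z) = \<theta> (snd z)"
    and prod_chart_image: "\<And>P Q. P \<subseteq> U \<Longrightarrow> Q \<subseteq> V \<Longrightarrow> \<eta> ` (P \<times> Q) =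
       {w \<in> topspace (Euclidean_space (mdim M + mdim N)).
         fst_coords (mdim M) w \<in> \<phi> ` P \<and> snd_coords (mdim M) w \<in> \<theta> ` Q}"
    and prod_chart_image_open: "\<And>P Q. openin (mtop M) P \<Longrightarrow> openin (mtop N) Q \<Longrightarrow> P \<subseteq> U \<Longrightarrow> Q \<subseteq> V \<Longrightarrow>
       openin (Euclidean_space (mdim M + mdim N)) (\<eta> ` (P \<times> Q))"
    and prod_chart_homeo: "homeomorphic_map (subtopology (prod_topology (mtop M) (mtop N)) (U \<times> V))
       (subtopology (Euclidean_space (mdim M + mdim N)) (\<eta> ` (U \<times> V))) \<eta>"
proof -
  let ?m = "mdim M" and ?n = "mdim N"
  note EU = chart_in_Euclidean [OF M U] and EV = chart_in_Euclidean [OF N V]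
  show c1: "fst_coords ?m (\<eta> z) = \<phi> (fst z)" and c2: "snd_coords ?m (\<eta> z) = \<theta> (snd z)" if "z \<in> U \<times> V" for z
    using that EU by (auto simp: \<eta>_def coords_join)
  show inj: "inj_on \<eta> (U \<times> V)"
  proof (rule inj_onI)
    fix z z' assume z: "z \<in> U \<times> V" "z' \<in> U \<times> V" "\<eta> z = \<eta> z'"
    have "\<phi> (fst z) = \<phi> (fst z')" "\<theta> (snd z) = \<theta> (snd z')"
      using c1 [OF z(1)] c1 [OF z(2)] c2 [OF z(1)] c2 [OF z(2)] z(3) by simp_all
    then have "fst z = fst z'" "snd z = snd z'"
      using z(1,2) inj_onD [OF chart_inj [OF M U]] inj_onD [OF chart_inj [OF N V]] by (auto simp: mem_Times_iff)
    then show "z = z'" by (rule prod_eqI)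
  qed
  show im: "\<eta> ` (P \<times> Q) = {w \<in> topspace (Euclidean_space (?m + ?n)).
         fst_coords ?m w \<in> \<phi> ` P \<and> snd_coords ?m w \<in> \<theta> ` Q}" if "P \<subseteq> U" "Q \<subseteq> V" for P Q
  proof (intro equalityI subsetI)
    fix w assume "w \<in> \<eta> ` (P \<times> Q)"
    then obtain x y where xy: "x \<in> P" "y \<in> Q" "w = \<eta> (x, y)" by blast
    moreover have "(x, y) \<in> U \<times> V" using xy that by auto
    moreover have "w \<in> topspace (Euclidean_space (?m + ?n))"
      using EU [of x] EV [of y] xy that by (auto simp: \<eta>_def join_coords_def topspace_Euclidean_space)
    ultimately show "w \<in> {w \<in> topspace (Euclidean_space (?m + ?n)).
         fst_coords ?m w \<in> \<phi> ` P \<and> snd_coords ?m w \<in> \<theta> ` Q}" using c1 c2 by auto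
  next
    fix w assume "w \<in> {w \<in> topspace (Euclidean_space (?m + ?n)).
         fst_coords ?m w \<in> \<phi> ` P \<and> snd_coords ?m w \<in> \<theta> ` Q}"
    then obtain x y where xy: "x \<in> P" "y \<in> Q" "fst_coords ?m w = \<phi> x" "snd_coords ?m w = \<theta> y" by blast
    then have "w = \<eta> (x, y)" using coords_join(3) [of ?m w] by (simp add: \<eta>_def)
    then show "w \<in> \<eta> ` (P \<times> Q)" using xy by blast
  qed
  show op: "openin (Euclidean_space (?m + ?n)) (\<eta> ` (P \<times> Q))"
    if "openin (mtop M) P" "openin (mtop N) Q" "P \<subseteq> U" "Q \<subseteq> V" for P Q
  proof -
    have "openin (Euclidean_space (?m + ?n)) {w \<in> topspace (Euclidean_space (?m + ?n)). fst_coords ?m w \<in> \<phi> ` P}"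
      by (rule openin_continuous_map_preimage [OF continuous_map_fst_coords chart_image_open [OF M U that(1,3)]])
    moreover have "openin (Euclidean_space (?m + ?n)) {w \<in> topspace (Euclidean_space (?m + ?n)). snd_coords ?m w \<in> \<theta> ` Q}"
      by (rule openin_continuous_map_preimage [OF continuous_map_snd_coords chart_image_open [OF N V that(2,4)]])
    ultimately have "openin (Euclidean_space (?m + ?n))
       ({w \<in> topspace (Euclidean_space (?m + ?n)). fst_coords ?m w \<in> \<phi> ` P} \<inter>
        {w \<in> topspace (Euclidean_space (?m + ?n)). snd_coords ?m w \<in> \<theta> ` Q})" by (rule openin_Int)
    also have "\<dots> = {w \<in> topspace (Euclidean_space (?m + ?n)).
         fst_coords ?m w \<in> \<phi> ` P \<and> snd_coords ?m w \<in> \<theta> ` Q}" by auto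
    finally show ?thesis unfolding im [OF that(3,4)] .
  qed
  let ?X = "subtopology (prod_topology (mtop M) (mtop N)) (U \<times> V)"
  have s: "U \<subseteq> carr M" "V \<subseteq> carr N" using chart_subset M N U V by blast+
  have tX: "topspace ?X = U \<times> V" using s by auto
  show "homeomorphic_map ?X (subtopology (Euclidean_space (?m + ?n)) (\<eta> ` (U \<times> V))) \<eta>"
  proof (rule bijective_open_imp_homeomorphic_map)
    have "continuous_map (subtopology (mtop M) U) (Euclidean_space ?m) \<phi>"
      "continuous_map (subtopology (mtop N) V) (Euclidean_space ?n) \<theta>"
      using homeomorphic_imp_continuous_map [OF chart_homeo [OF M U]]
        homeomorphic_imp_continuous_map [OF chart_homeo [OF N V]]
      by (auto simp: continuous_map_in_subtopology)
    then have "continuous_map ?X (Euclidean_space ?m) (\<lambda>z. \<phi> (fst z))"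
      "continuous_map ?X (Euclidean_space ?n) (\<lambda>z. \<theta> (snd z))"
      using continuous_map_compose [OF continuous_map_fst] continuous_map_compose [OF continuous_map_snd]
      by (auto simp: subtopology_Times o_def)
    then have "continuous_map ?X (Euclidean_space (?m + ?n)) (\<lambda>z. join_coords ?m (\<phi> (fst z)) (\<theta> (snd z)))"
      by (rule continuous_map_join_coords)
    then show "continuous_map ?X (subtopology (Euclidean_space (?m + ?n)) (\<eta> ` (U \<times> V))) \<eta>"
      unfolding continuous_map_in_subtopology \<eta>_def using tX by (simp add: case_prod_unfold)
    show "open_map ?X (subtopology (Euclidean_space (?m + ?n)) (\<eta> ` (U \<times> V))) \<eta>"
      unfolding open_map_def
    proof (intro allI impI)
      fix W assume W: "openin ?X W"
      have WUV: "W \<subseteq> U \<times> V" using openin_subset [OF W] tX by simp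
      have "openin (prod_topology (mtop M) (mtop N)) (U \<times> V)"
        using chart_open [OF M U] chart_open [OF N V] by (simp add: openin_prod_Times_iff)
      then have oW: "openin (prod_topology (mtop M) (mtop N)) W" using W openin_trans_full by blast
      have "\<exists>T. openin (Euclidean_space (?m + ?n)) T \<and> \<eta> z \<in> T \<and> T \<subseteq> \<eta> ` W" if z: "z \<in> W" for z
      proof -
        have "\<exists>P Q. openin (mtop M) P \<and> openin (mtop N) Q \<and> fst z \<in> P \<and> snd z \<in> Q \<and> P \<times> Q \<subseteq> W"
          by (rule openin_prod_topology_alt [THEN iffD1, rule_format]) (use oW z in auto)
        then obtain P Q where PQ: "openin (mtop M) P" "openin (mtop N) Q" "z \<in> P \<times> Q" "P \<times> Q \<subseteq> W"
          unfolding mem_Times_iff by blast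
        then have "P \<subseteq> U" "Q \<subseteq> V" using WUV by blast+
        then have "openin (Euclidean_space (?m + ?n)) (\<eta> ` (P \<times> Q))" by (rule op [OF PQ(1,2)])
        moreover have "\<eta> z \<in> \<eta> ` (P \<times> Q)" using PQ(3) by (rule imageI)
        moreover have "\<eta> ` (P \<times> Q) \<subseteq> \<eta> ` W" using PQ(4) by (rule image_mono)
        ultimately show ?thesis by blast
      qed
      then have "openin (Euclidean_space (?m + ?n)) (\<eta> ` W)"
        by (subst openin_subopen) blast
      then show "openin (subtopology (Euclidean_space (?m + ?n)) (\<eta> ` (U \<times> V))) (\<eta> ` W)"
        using WUV by (metis image_mono inf.absorb_iff2 openin_subtopology_Int2)
    qed
    show "\<eta> ` topspace ?X = topspace (subtopology (Euclidean_space (?m + ?n)) (\<eta> ` (U \<times> V)))"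
      unfolding tX using im [of U V] by auto
    show "inj_on \<eta> (topspace ?X)" unfolding tX by (rule inj)
  qed
qed

lemma C_k_fst_coords:
  assumes "openin (Euclidean_space (m + n)) W" "openin (Euclidean_space m) W'" "C_k m k W' g"
    "\<And>w. w \<in> W \<Longrightarrow> fst_coords m w \<in> W'"
  shows "C_k (m + n) k W (\<lambda>w. g (fst_coords m w))"
  by (rule C_k_compose [OF assms(1,2,4) _ assms(3)])
    (auto simp: fst_coords_def intro: C_k_coordinate)

lemma C_k_snd_coords:
  assumes "openin (Euclidean_space (m + n)) W" "openin (Euclidean_space n) W'" "C_k n k W' g"
    "\<And>w. w \<in> W \<Longrightarrow> snd_coords m w \<in> W'"
  shows "C_k (m + n) k W (\<lambda>w. g (snd_coords m w))"
  by (rule C_k_compose [OF assms(1,2,4) _ assms(3)])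
    (auto simp: snd_coords_def intro: C_k_coordinate)

text \<open>Each coordinate of a transition function of product charts involves one factor only: it
  is a coordinate of a transition function of \<open>M\<close> or \<open>N\<close>, precomposed with
  \<open>fst_coords\<close> or \<open>snd_coords\<close> according to whether its index is below
  \<open>mdim M\<close>.\<close>

lemma smooth_manifold_prod:
  assumes M: "smooth_manifold M" and N: "smooth_manifold N"
  shows "smooth_manifold (prod_mfd M N)"
proof -
  let ?m = "mdim M" and ?n = "mdim N"
  let ?P = "prod_topology (mtop M) (mtop N)"
  have top: "Hausdorff_space ?P" "second_countable ?P"
    using M N by (auto simp: smooth_manifold_def Hausdorff_space_prod_topology second_countable_prod_topology)
  have tr: "smooth_Rn (?m + ?n) (?m + ?n)
      ((\<lambda>(x, y). join_coords ?m (\<phi> x) (\<theta> y)) ` ((U \<times> V) \<inter> (U' \<times> V')))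
      ((\<lambda>(x, y). join_coords ?m (\<phi>' x) (\<theta>' y)) \<circ> inv_into (U \<times> V) (\<lambda>(x, y). join_coords ?m (\<phi> x) (\<theta> y)))"
    if U: "(U, \<phi>) \<in> atlas M" and V: "(V, \<theta>) \<in> atlas N"
      and U': "(U', \<phi>') \<in> atlas M" and V': "(V', \<theta>') \<in> atlas N" for U \<phi> V \<theta> U' \<phi>' V' \<theta>'
  proof -
    define \<eta> where "\<eta> = (\<lambda>(x, y). join_coords ?m (\<phi> x) (\<theta> y))"
    note pc = prod_chart [OF M N U V, folded \<eta>_def]
    have eq: "(U \<times> V) \<inter> (U' \<times> V') = (U \<inter> U') \<times> (V \<inter> V')" by auto
    let ?W = "\<eta> ` ((U \<inter> U') \<times> (V \<inter> V'))"
    have oU: "openin (mtop M) (U \<inter> U')" and oV: "openin (mtop N) (V \<inter> V')"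
      using chart_open M N U U' V V' by blast+
    have oW: "openin (Euclidean_space (?m + ?n)) ?W" by (rule pc(5)) (use oU oV in auto)
    have inv: "\<exists>x\<in>U \<inter> U'. \<exists>y\<in>V \<inter> V'. inv_into (U \<times> V) \<eta> w = (x, y) \<and>
        inv_into U \<phi> (fst_coords ?m w) = x \<and> inv_into V \<theta> (snd_coords ?m w) = y \<and>
        fst_coords ?m w = \<phi> x \<and> snd_coords ?m w = \<theta> y" if w: "w \<in> ?W" for w
    proof -
      obtain x y where xy: "x \<in> U \<inter> U'" "y \<in> V \<inter> V'" "w = \<eta> (x, y)" using w by blast
      then have "inv_into (U \<times> V) \<eta> w = (x, y)" using pc(1) by (simp add: inv_into_f_f)
      moreover have "fst_coords ?m w = \<phi> x" "snd_coords ?m w = \<theta> y"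
        using pc(2,3) [of "(x, y)"] xy by auto
      ultimately show ?thesis using xy chart_inj [OF M U] chart_inj [OF N V]
        by (intro bexI [of _ x] bexI [of _ y]) (auto simp: inv_into_f_f)
    qed
    have "C_k (?m + ?n) k ?W (\<lambda>w. ((\<lambda>(x, y). join_coords ?m (\<phi>' x) (\<theta>' y)) (inv_into (U \<times> V) \<eta> w)) j)"
      if j: "j < ?m + ?n" for j k
    proof (cases "j < ?m")
      case True
      show ?thesis
      proof (rule C_k_cong [OF oW])
        show "C_k (?m + ?n) k ?W (\<lambda>w. \<phi>' (inv_into U \<phi> (fst_coords ?m w)) j)"
          by (rule C_k_fst_coords [OF oW chart_image_open [OF M U oU] chart_transition [OF M U U' True]])
            (use inv in fastforce)+
        show "\<phi>' (inv_into U \<phi> (fst_coords ?m w)) j =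
           (case inv_into (U \<times> V) \<eta> w of (x, y) \<Rightarrow> join_coords ?m (\<phi>' x) (\<theta>' y)) j" if "w \<in> ?W" for w
          using inv [OF that] True by (auto simp: join_coords_def)
      qed
    next
      case False
      then have j': "j - ?m < ?n" using j by auto
      show ?thesis
      proof (rule C_k_cong [OF oW])
        show "C_k (?m + ?n) k ?W (\<lambda>w. \<theta>' (inv_into V \<theta> (snd_coords ?m w)) (j - ?m))"
          by (rule C_k_snd_coords [OF oW chart_image_open [OF N V oV] chart_transition [OF N V V' j']])
            (use inv in fastforce)+
        show "\<theta>' (inv_into V \<theta> (snd_coords ?m w)) (j - ?m) =
           (case inv_into (U \<times> V) \<eta> w of (x, y) \<Rightarrow> join_coords ?m (\<phi>' x) (\<theta>' y)) j" if "w \<in> ?W" for w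
          using inv [OF that] False by (auto simp: join_coords_def)
      qed
    qed
    then show ?thesis unfolding smooth_Rn_def eq \<eta>_def [symmetric] by simp
  qed
  have cov: "(\<Union>(U, \<phi>)\<in>atlas (prod_mfd M N). U) = carr (prod_mfd M N)"
  proof (intro equalityI subsetI)
    fix z assume "z \<in> carr (prod_mfd M N)"
    then have z: "fst z \<in> carr M" "snd z \<in> carr N" by auto
    obtain U \<phi> where U: "(U, \<phi>) \<in> atlas M" "fst z \<in> U" using chart_cover [OF M z(1)] .
    obtain V \<theta> where V: "(V, \<theta>) \<in> atlas N" "snd z \<in> V" using chart_cover [OF N z(2)] .
    have "(U \<times> V, \<lambda>(x, y). join_coords (mdim M) (\<phi> x) (\<theta> y)) \<in> atlas (prod_mfd M N)" using U V by auto
    moreover have "z \<in> U \<times> V" using U V by (auto simp: mem_Times_iff)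
    ultimately show "z \<in> (\<Union>(U, \<phi>)\<in>atlas (prod_mfd M N). U)" by blast
  qed (use chart_subset [OF M] chart_subset [OF N] in fastforce)
  have ch: "openin ?P (U \<times> V)" "openin (Euclidean_space (?m + ?n)) ((\<lambda>(x, y). join_coords ?m (\<phi> x) (\<theta> y)) ` (U \<times> V))"
    if "(U, \<phi>) \<in> atlas M" "(V, \<theta>) \<in> atlas N" for U \<phi> V \<theta>
    using that chart_open [OF M that(1)] chart_open [OF N that(2)] prod_chart_image_open [OF M N that, of U V]
    by (auto simp: openin_prod_Times_iff)
  show ?thesis
    unfolding smooth_manifold_def
  proof (intro conjI ballI)
    show "Hausdorff_space (mtop (prod_mfd M N))" "second_countable (mtop (prod_mfd M N))" using top by simp_all
    show "(\<Union>(U, \<phi>)\<in>atlas (prod_mfd M N). U) = carr (prod_mfd M N)" by (rule cov)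
    fix c assume c: "c \<in> atlas (prod_mfd M N)"
    then obtain U \<phi> V \<theta> where UV: "(U, \<phi>) \<in> atlas M" "(V, \<theta>) \<in> atlas N"
      "c = (U \<times> V, \<lambda>(x, y). join_coords ?m (\<phi> x) (\<theta> y))" by auto
    show "case c of (U, \<phi>) \<Rightarrow> openin (mtop (prod_mfd M N)) U \<and>
        openin (Euclidean_space (mdim (prod_mfd M N))) (\<phi> ` U) \<and>
        homeomorphic_map (subtopology (mtop (prod_mfd M N)) U)
         (subtopology (Euclidean_space (mdim (prod_mfd M N))) (\<phi> ` U)) \<phi>"
      unfolding UV(3) prod.case prod_mfd_simps
      using ch [OF UV(1,2)] prod_chart_homeo [OF M N UV(1,2)] by blast
    show "case c of (U, \<phi>) \<Rightarrow> \<forall>(V, \<theta>)\<in>atlas (prod_mfd M N).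
        smooth_Rn (mdim (prod_mfd M N)) (mdim (prod_mfd M N)) (\<phi> ` (U \<inter> V)) (\<theta> \<circ> inv_into U \<phi>)"
      unfolding UV(3) prod.case
    proof
      fix c' assume "c' \<in> atlas (prod_mfd M N)"
      then obtain U' \<phi>' V' \<theta>' where UV': "(U', \<phi>') \<in> atlas M" "(V', \<theta>') \<in> atlas N"
        "c' = (U' \<times> V', \<lambda>(x, y). join_coords ?m (\<phi>' x) (\<theta>' y))" by auto
      show "case c' of (V', \<theta>'') \<Rightarrow>
        smooth_Rn (mdim (prod_mfd M N)) (mdim (prod_mfd M N))
          ((\<lambda>(x, y). join_coords ?m (\<phi> x) (\<theta> y)) ` (U \<times> V \<inter> V'))
          (\<theta>'' \<circ> inv_into (U \<times> V) (\<lambda>(x, y). join_coords ?m (\<phi> x) (\<theta> y)))"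
        unfolding UV'(3) prod.case prod_mfd_simps by (rule tr [OF UV(1,2) UV'(1,2)])
    qed
  qed
qed

lemma smooth_map_fst:
  assumes M: "smooth_manifold M" and N: "smooth_manifold N"
  shows "smooth_map (prod_mfd M N) M fst"
proof (rule smooth_mapI [OF smooth_manifold_prod [OF M N] M])
  show "continuous_map (mtop (prod_mfd M N)) (mtop M) fst" by (simp add: continuous_map_fst)
  fix p assume "p \<in> carr (prod_mfd M N)"
  then have p: "fst p \<in> carr M" "snd p \<in> carr N" by auto
  obtain U \<phi> where U: "(U, \<phi>) \<in> atlas M" "fst p \<in> U" using chart_cover [OF M p(1)] .
  obtain V \<theta> where V: "(V, \<theta>) \<in> atlas N" "snd p \<in> V" using chart_cover [OF N p(2)] .
  have UV: "(U \<times> V, \<lambda>(x, y). join_coords (mdim M) (\<phi> x) (\<theta> y)) \<in> atlas (prod_mfd M N)" using U V by auto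
  have pUV: "p \<in> U \<times> V" using U V by (auto simp: mem_Times_iff)
  note P = smooth_manifold_prod [OF M N]
  have "smooth_at (prod_mfd M N) (\<lambda>x. \<phi> (fst x) j) p" if "j < mdim M" for j
    by (rule smooth_at_cong [OF P smooth_at_coordinate [OF P UV pUV, of j] chart_open [OF P UV] pUV])
      (use that in \<open>auto simp: join_coords_def\<close>)
  then show "\<exists>V \<theta>. (V, \<theta>) \<in> atlas M \<and> fst p \<in> V \<and> (\<forall>j<mdim M. smooth_at (prod_mfd M N) (\<lambda>x. \<theta> (fst x) j) p)"
    using U by blast
qed

lemma smooth_map_snd:
  assumes M: "smooth_manifold M" and N: "smooth_manifold N"
  shows "smooth_map (prod_mfd M N) N snd"
proof (rule smooth_mapI [OF smooth_manifold_prod [OF M N] N])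
  show "continuous_map (mtop (prod_mfd M N)) (mtop N) snd" by (simp add: continuous_map_snd)
  fix p assume "p \<in> carr (prod_mfd M N)"
  then have p: "fst p \<in> carr M" "snd p \<in> carr N" by auto
  obtain U \<phi> where U: "(U, \<phi>) \<in> atlas M" "fst p \<in> U" using chart_cover [OF M p(1)] .
  obtain V \<theta> where V: "(V, \<theta>) \<in> atlas N" "snd p \<in> V" using chart_cover [OF N p(2)] .
  have UV: "(U \<times> V, \<lambda>(x, y). join_coords (mdim M) (\<phi> x) (\<theta> y)) \<in> atlas (prod_mfd M N)" using U V by auto
  have pUV: "p \<in> U \<times> V" using U V by (auto simp: mem_Times_iff)
  note P = smooth_manifold_prod [OF M N]
  have "smooth_at (prod_mfd M N) (\<lambda>x. \<theta> (snd x) j) p" if "j < mdim N" for j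
    by (rule smooth_at_cong [OF P smooth_at_coordinate [OF P UV pUV, of "mdim M + j"] chart_open [OF P UV] pUV])
      (use that in \<open>auto simp: join_coords_def\<close>)
  then show "\<exists>V \<theta>. (V, \<theta>) \<in> atlas N \<and> snd p \<in> V \<and> (\<forall>j<mdim N. smooth_at (prod_mfd M N) (\<lambda>x. \<theta> (snd x) j) p)"
    using V by blast
qed

lemma smooth_map_Pair:
  assumes P: "smooth_manifold P" and M: "smooth_manifold M" and N: "smooth_manifold N"
    and f: "smooth_map P M f" and g: "smooth_map P N g"
  shows "smooth_map P (prod_mfd M N) (\<lambda>x. (f x, g x))"
proof (rule smooth_mapI [OF P smooth_manifold_prod [OF M N]])
  show "continuous_map (mtop P) (mtop (prod_mfd M N)) (\<lambda>x. (f x, g x))"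
    using smooth_map_imp_continuous [OF f] smooth_map_imp_continuous [OF g] by (simp add: continuous_map_pairedI)
  fix p assume p: "p \<in> carr P"
  obtain U \<phi> where U: "(U, \<phi>) \<in> atlas M" "f p \<in> U" using chart_cover [OF M smooth_map_imp_into [OF f p]] .
  obtain V \<theta> where V: "(V, \<theta>) \<in> atlas N" "g p \<in> V" using chart_cover [OF N smooth_map_imp_into [OF g p]] .
  let ?\<eta> = "\<lambda>(x, y). join_coords (mdim M) (\<phi> x) (\<theta> y)"
  have UV: "(U \<times> V, ?\<eta>) \<in> atlas (prod_mfd M N)" using U V by auto
  have "smooth_at P (\<lambda>x. ?\<eta> (f x, g x) j) p" if "j < mdim (prod_mfd M N)" for j
  proof (cases "j < mdim M")
    case True
    then show ?thesis using smooth_mapD [OF P M f p U True] by (simp add: join_coords_def)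
  next
    case False
    then have "j - mdim M < mdim N" using that by auto
    then show ?thesis using False smooth_mapD [OF P N g p V] by (simp add: join_coords_def)
  qed
  then show "\<exists>V \<theta>. (V, \<theta>) \<in> atlas (prod_mfd M N) \<and> (f p, g p) \<in> V \<and>
      (\<forall>j<mdim (prod_mfd M N). smooth_at P (\<lambda>x. \<theta> (f x, g x) j) p)"
    using UV U V by (intro exI [of _ "U \<times> V"] exI [of _ ?\<eta>]) auto
qed

section \<open>Manifolds glued from open pieces\<close>

definition glued_atlas :: "('b mfd \<times> ('b \<Rightarrow> 'e)) set \<Rightarrow> ('e set \<times> ('e \<Rightarrow> nat \<Rightarrow> real)) set" where
  "glued_atlas I = {(h ` Z, \<theta> \<circ> inv_into Z h) |P h Z \<theta>. (P, h) \<in> I \<and> (Z, \<theta>) \<in> atlas P}"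

text \<open>The topology of \<open>E\<close> is given in advance and only the smooth structure is
  transported, each \<open>h\<close> being a homeomorphism of a manifold \<open>P\<close> onto an
  open subset. This isolates what \<open>link_bundle_over\<close> does with the pieces
  \<open>(U \<inter> S) \<times> L\<close>; compatibility of the charts is reduced to smoothness of
  the maps between pieces.\<close>

locale gluing =
  fixes E :: "'e mfd" and I :: "('b mfd \<times> ('b \<Rightarrow> 'e)) set"
  assumes top: "Hausdorff_space (mtop E)" "second_countable (mtop E)"
    and atlas: "atlas E = glued_atlas I"
    and piece: "\<And>P h. (P, h) \<in> I \<Longrightarrow> smooth_manifold P"
    and piece_dim: "\<And>P h. (P, h) \<in> I \<Longrightarrow> mdim P = mdim E"
    and piece_open: "\<And>P h. (P, h) \<in> I \<Longrightarrow> openin (mtop E) (h ` carr P)"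
    and piece_homeo: "\<And>P h. (P, h) \<in> I \<Longrightarrow>
          homeomorphic_map (mtop P) (subtopology (mtop E) (h ` carr P)) h"
    and pieces_cover: "carr E \<subseteq> (\<Union>(P, h)\<in>I. h ` carr P)"
    and transition: "\<And>P h P' h'. (P, h) \<in> I \<Longrightarrow> (P', h') \<in> I \<Longrightarrow>
          smooth_map (restrict_mfd P {x. h x \<in> h' ` carr P'}) P' (\<lambda>x. inv_into (carr P') h' (h x))"
begin

lemma piece_inj: "(P, h) \<in> I \<Longrightarrow> inj_on h (carr P)"
  using piece_homeo homeomorphic_imp_injective_map by blast

lemma piece_continuous: "(P, h) \<in> I \<Longrightarrow> continuous_map (mtop P) (mtop E) h"
  using homeomorphic_imp_continuous_map [OF piece_homeo] by (simp add: continuous_map_in_subtopology)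

lemma piece_image_open:
  assumes "(P, h) \<in> I" "openin (mtop P) Z"
  shows "openin (mtop E) (h ` Z)"
proof -
  have "openin (subtopology (mtop E) (h ` carr P)) (h ` Z)"
    using piece_homeo [OF assms(1)] assms(2) homeomorphic_map_openness_eq by blast
  then show ?thesis using piece_open [OF assms(1)] openin_trans_full by blast
qed

lemma glued_inv:
  assumes I: "(P, h) \<in> I" and Z: "(Z, \<theta>) \<in> atlas P" and w: "w \<in> \<theta> ` Z"
  shows "inv_into (h ` Z) (\<theta> \<circ> inv_into Z h) w = h (inv_into Z \<theta> w)"
proof -
  have s: "Z \<subseteq> carr P" by (rule chart_subset [OF piece [OF I] Z])
  have ih: "inj_on h Z" using piece_inj [OF I] s inj_on_subset by blast
  have it: "inj_on \<theta> Z" by (rule chart_inj [OF piece [OF I] Z])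
  have inj: "inj_on (\<theta> \<circ> inv_into Z h) (h ` Z)"
    using ih it by (auto simp: inj_on_def)
  obtain z where z: "z \<in> Z" "w = \<theta> z" using w by blast
  then have "(\<theta> \<circ> inv_into Z h) (h z) = w" using ih by simp
  then have "inv_into (h ` Z) (\<theta> \<circ> inv_into Z h) w = h z" using inj z inv_into_f_eq by fastforce
  then show ?thesis using z it by simp
qed

lemma glued_chart_image:
  assumes I: "(P, h) \<in> I" and Z: "(Z, \<theta>) \<in> atlas P" and A: "A \<subseteq> Z"
  shows "(\<theta> \<circ> inv_into Z h) ` h ` A = \<theta> ` A"
proof -
  have "inj_on h Z" using piece_inj [OF I] chart_subset [OF piece [OF I] Z] inj_on_subset by blast
  then show ?thesis using A by (force simp: image_iff)
qed

lemma glued_chart_homeo: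
  assumes I: "(P, h) \<in> I" and Z: "(Z, \<theta>) \<in> atlas P"
  shows "homeomorphic_map (subtopology (mtop E) (h ` Z))
    (subtopology (Euclidean_space (mdim E)) (\<theta> ` Z)) (\<theta> \<circ> inv_into Z h)"
proof -
  note P = piece [OF I]
  have s: "Z \<subseteq> carr P" by (rule chart_subset [OF P Z])
  have hZ: "h ` Z \<subseteq> carr E" using piece_image_open [OF I chart_open [OF P Z]] openin_subset by blast
  have ih: "inj_on h (carr P)" by (rule piece_inj [OF I])
  have ihZ: "inj_on h Z" using ih s inj_on_subset by blast
  have h1: "homeomorphic_map (subtopology (mtop P) Z) (subtopology (mtop E) (h ` Z)) h"
  proof -
    have "homeomorphic_map (subtopology (mtop P) Z) (subtopology (subtopology (mtop E) (h ` carr P)) (h ` Z)) h"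
      by (rule homeomorphic_map_subtopologies [OF piece_homeo [OF I]])
        (use s ih hZ in \<open>auto simp: inj_on_def\<close>)
    moreover have "h ` carr P \<inter> h ` Z = h ` Z" using s by auto
    ultimately show ?thesis by (simp add: subtopology_subtopology)
  qed
  obtain g where g: "homeomorphic_maps (subtopology (mtop P) Z) (subtopology (mtop E) (h ` Z)) h g"
    using h1 homeomorphic_map_maps by blast
  then have "homeomorphic_map (subtopology (mtop E) (h ` Z)) (subtopology (mtop P) Z) g"
    using homeomorphic_map_maps homeomorphic_maps_sym by blast
  moreover have "g y = inv_into Z h y" if "y \<in> topspace (subtopology (mtop E) (h ` Z))" for y
  proof -
    from that obtain z where "z \<in> Z" "y = h z" by auto
    then show ?thesis using g s ihZ by (auto simp: homeomorphic_maps_def)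
  qed
  ultimately have "homeomorphic_map (subtopology (mtop E) (h ` Z)) (subtopology (mtop P) Z) (inv_into Z h)"
    using homeomorphic_map_eq by blast
  moreover have "homeomorphic_map (subtopology (mtop P) Z)
      (subtopology (Euclidean_space (mdim E)) (\<theta> ` Z)) \<theta>"
    using chart_homeo [OF P Z] piece_dim [OF I] by simp
  ultimately show ?thesis by (rule homeomorphic_map_compose)
qed

text \<open>The transition function from the chart carried over by \<open>h\<close> to the one
  carried over by \<open>h'\<close> is \<open>\<theta>'\<close> after \<open>f\<close> after the
  inverse of \<open>\<theta>\<close>, where \<open>f\<close> is the map between pieces in the
  assumption \<open>transition\<close>.\<close>

lemma glued_manifold: "smooth_manifold E"
proof -
  have cov: "(\<Union>(U, \<phi>)\<in>atlas E. U) = carr E"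
  proof (intro equalityI subsetI)
    fix x assume "x \<in> (\<Union>(U, \<phi>)\<in>atlas E. U)"
    then obtain P h Z \<theta> where I: "(P, h) \<in> I" "(Z, \<theta>) \<in> atlas P" "x \<in> h ` Z"
      unfolding atlas glued_atlas_def by blast
    then show "x \<in> carr E" using piece_image_open [OF I(1) chart_open [OF piece [OF I(1)] I(2)]] openin_subset
      by blast
  next
    fix x assume "x \<in> carr E"
    then obtain P h p where I: "(P, h) \<in> I" "p \<in> carr P" "x = h p" using pieces_cover by blast
    obtain Z \<theta> where Z: "(Z, \<theta>) \<in> atlas P" "p \<in> Z" using chart_cover [OF piece [OF I(1)] I(2)] .
    then have "(h ` Z, \<theta> \<circ> inv_into Z h) \<in> atlas E" unfolding atlas glued_atlas_def using I by blast
    then show "x \<in> (\<Union>(U, \<phi>)\<in>atlas E. U)" using I Z by blast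
  qed
  show ?thesis
    unfolding smooth_manifold_def
  proof (intro conjI ballI)
    show "Hausdorff_space (mtop E)" "second_countable (mtop E)" by (fact top)+
    show "(\<Union>(U, \<phi>)\<in>atlas E. U) = carr E" by (rule cov)
    fix c assume "c \<in> atlas E"
    then obtain P h Z \<theta> where I: "(P, h) \<in> I" and Z: "(Z, \<theta>) \<in> atlas P" and c: "c = (h ` Z, \<theta> \<circ> inv_into Z h)"
      unfolding atlas glued_atlas_def by blast
    note P = piece [OF I]
    have s: "Z \<subseteq> carr P" by (rule chart_subset [OF P Z])
    note im = glued_chart_image [OF I Z order_refl]
    show "case c of (U, \<phi>) \<Rightarrow> openin (mtop E) U \<and> openin (Euclidean_space (mdim E)) (\<phi> ` U) \<and>
        homeomorphic_map (subtopology (mtop E) U) (subtopology (Euclidean_space (mdim E)) (\<phi> ` U)) \<phi>"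
      unfolding c prod.case im
      using piece_image_open [OF I chart_open [OF P Z]] chart_image_open' [OF P Z] piece_dim [OF I]
        glued_chart_homeo [OF I Z] by simp
    show "case c of (U, \<phi>) \<Rightarrow> \<forall>(V, \<theta>)\<in>atlas E.
        smooth_Rn (mdim E) (mdim E) (\<phi> ` (U \<inter> V)) (\<theta> \<circ> inv_into U \<phi>)"
      unfolding c prod.case
    proof
      fix c' assume "c' \<in> atlas E"
      then obtain P' h' Z' \<theta>' where I': "(P', h') \<in> I" and Z': "(Z', \<theta>') \<in> atlas P'"
        and c': "c' = (h' ` Z', \<theta>' \<circ> inv_into Z' h')" unfolding atlas glued_atlas_def by blast
      note P' = piece [OF I']
      have s': "Z' \<subseteq> carr P'" by (rule chart_subset [OF P' Z'])
      define W where "W = {x. h x \<in> h' ` carr P'}"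
      define f where "f = (\<lambda>x. inv_into (carr P') h' (h x))"
      \<comment> \<open>The overlap of the two carried over charts, pulled back to the piece
        \<open>P\<close>.\<close>
      define A where "A = {x \<in> Z. h x \<in> h' ` Z'}"
      have f: "smooth_map (restrict_mfd P W) P' f" unfolding W_def f_def by (rule transition [OF I I'])
      have ih': "inj_on h' (carr P')" by (rule piece_inj [OF I'])
      have A: "A = {x \<in> Z \<inter> W. f x \<in> Z'}"
        using s s' ih' unfolding A_def W_def f_def by (auto simp: inv_into_f_f subset_iff)
      have "(Z \<inter> W, \<theta>) \<in> atlas (restrict_mfd P W)" using Z by auto
      then have sm: "smooth_Rn (mdim P) (mdim P') (\<theta> ` A) (\<theta>' \<circ> f \<circ> inv_into (Z \<inter> W) \<theta>)"
        using f Z' unfolding smooth_map_def A by fastforce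
      have iA: "h ` Z \<inter> h' ` Z' = h ` A" unfolding A_def by auto
      have "openin (mtop P) A"
      proof -
        have "openin (mtop P) {x \<in> carr P. h x \<in> h' ` Z'}"
          by (rule openin_continuous_map_preimage [OF piece_continuous [OF I] piece_image_open [OF I' chart_open [OF P' Z']]])
        moreover have "A = Z \<inter> {x \<in> carr P. h x \<in> h' ` Z'}" using s by (auto simp: A_def)
        ultimately show ?thesis using chart_open [OF P Z] by auto
      qed
      then have oA: "openin (Euclidean_space (mdim E)) (\<theta> ` A)"
        using chart_image_open [OF P Z] piece_dim [OF I] unfolding A_def by fastforce
      have AZ: "A \<subseteq> Z" by (auto simp: A_def)
      have "C_k (mdim E) k (\<theta> ` A) (\<lambda>w. ((\<theta>' \<circ> inv_into Z' h') (inv_into (h ` Z) (\<theta> \<circ> inv_into Z h) w)) j)"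
        if j: "j < mdim E" for j k
      proof (rule C_k_cong [OF oA])
        show "C_k (mdim E) k (\<theta> ` A) (\<lambda>w. (\<theta>' \<circ> f \<circ> inv_into (Z \<inter> W) \<theta>) w j)"
          using sm j piece_dim [OF I] piece_dim [OF I'] unfolding smooth_Rn_def by simp
        fix w assume "w \<in> \<theta> ` A"
        then obtain z where z: "z \<in> A" "w = \<theta> z" by blast
        have "inv_into (h ` Z) (\<theta> \<circ> inv_into Z h) w = h z"
          using glued_inv [OF I Z] z AZ chart_inj [OF P Z] by (auto simp: subset_iff)
        moreover have "inv_into (Z \<inter> W) \<theta> w = z"
          using z chart_inj [OF P Z] unfolding A by (auto simp: inv_into_f_eq inj_on_Int)
        moreover have "inv_into Z' h' (h z) = f z"
        proof -
          obtain z' where "z' \<in> Z'" "h z = h' z'" using z by (auto simp: A_def)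
          moreover have "inj_on h' Z'" using ih' s' inj_on_subset by blast
          ultimately show ?thesis using ih' s' unfolding f_def by (auto simp: inv_into_f_f)
        qed
        ultimately show "(\<theta>' \<circ> f \<circ> inv_into (Z \<inter> W) \<theta>) w j =
            ((\<theta>' \<circ> inv_into Z' h') (inv_into (h ` Z) (\<theta> \<circ> inv_into Z h) w)) j" by simp
      qed
      then show "case c' of (V, \<theta>'') \<Rightarrow> smooth_Rn (mdim E) (mdim E)
          ((\<theta> \<circ> inv_into Z h) ` (h ` Z \<inter> V)) (\<theta>'' \<circ> inv_into (h ` Z) (\<theta> \<circ> inv_into Z h))"
        unfolding c' prod.case iA glued_chart_image [OF I Z AZ] smooth_Rn_def by simp
    qed
  qed
qed

text \<open>In the chart of \<open>E\<close> carried over from \<open>(Z, \<theta>)\<close> by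
  \<open>h\<close> itself, the map \<open>h\<close> has the coordinates of \<open>\<theta>\<close>.
  Compatibility with charts from other pieces is already contained in
  \<open>glued_manifold\<close>.\<close>

lemma smooth_piece:
  assumes I: "(P, h) \<in> I"
  shows "smooth_map P E h"
proof (rule smooth_mapI [OF piece [OF I] glued_manifold piece_continuous [OF I]])
  fix p assume p: "p \<in> carr P"
  obtain Z \<theta> where Z: "(Z, \<theta>) \<in> atlas P" "p \<in> Z" using chart_cover [OF piece [OF I] p] .
  have ih: "inj_on h Z" using piece_inj [OF I] chart_subset [OF piece [OF I] Z(1)] inj_on_subset by blast
  have "smooth_at P (\<lambda>x. (\<theta> \<circ> inv_into Z h) (h x) j) p" for j
    by (rule smooth_at_cong [OF piece [OF I] smooth_at_coordinate [OF piece [OF I] Z, of j] chart_open [OF piece [OF I] Z(1)] Z(2)])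
      (simp add: ih)
  moreover have "(h ` Z, \<theta> \<circ> inv_into Z h) \<in> atlas E" unfolding atlas glued_atlas_def using I Z by blast
  ultimately show "\<exists>V \<theta>. (V, \<theta>) \<in> atlas E \<and> h p \<in> V \<and> (\<forall>j<mdim E. smooth_at P (\<lambda>x. \<theta> (h x) j) p)"
    using Z(2) by blast
qed

lemma smooth_piece_inv:
  assumes I: "(P, h) \<in> I"
  shows "smooth_map (restrict_mfd E (h ` carr P)) P (inv_into (carr P) h)"
proof -
  note P = piece [OF I] and E = glued_manifold
  have oW: "openin (mtop E) (carr E \<inter> h ` carr P)" using piece_open [OF I] by auto
  note R = smooth_manifold_restrict [OF E oW]
  show ?thesis
  proof (rule smooth_mapI [OF R P])
    obtain g where g: "homeomorphic_maps (mtop P) (subtopology (mtop E) (h ` carr P)) h g"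
      using piece_homeo [OF I] homeomorphic_map_maps by blast
    then have "continuous_map (subtopology (mtop E) (h ` carr P)) (mtop P) g" by (simp add: homeomorphic_maps_def)
    then show "continuous_map (mtop (restrict_mfd E (h ` carr P))) (mtop P) (inv_into (carr P) h)"
      unfolding restrict_mfd_simps
    proof (rule continuous_map_eq)
      fix y assume "y \<in> topspace (subtopology (mtop E) (h ` carr P))"
      then obtain z where "z \<in> carr P" "y = h z" by auto
      then show "g y = inv_into (carr P) h y" using g piece_inj [OF I] by (auto simp: homeomorphic_maps_def)
    qed
    fix p assume "p \<in> carr (restrict_mfd E (h ` carr P))"
    then obtain x where x: "x \<in> carr P" "p = h x" by auto
    have px: "inv_into (carr P) h p = x" using x piece_inj [OF I] by simp
    obtain Z \<theta> where Z: "(Z, \<theta>) \<in> atlas P" "x \<in> Z" using chart_cover [OF P x(1)] .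
    have s: "Z \<subseteq> carr P" by (rule chart_subset [OF P Z(1)])
    have ih: "inj_on h Z" using piece_inj [OF I] s inj_on_subset by blast
    have at: "(h ` Z, \<theta> \<circ> inv_into Z h) \<in> atlas E" unfolding atlas glued_atlas_def using I Z by blast
    have pZ: "p \<in> h ` Z" using x Z by blast
    have "smooth_at (restrict_mfd E (h ` carr P)) (\<lambda>y. \<theta> (inv_into (carr P) h y) j) p" for j
    proof (subst smooth_at_restrict [OF E oW])
      show "p \<in> h ` carr P" using x by blast
      show "smooth_at E (\<lambda>y. \<theta> (inv_into (carr P) h y) j) p"
      proof (rule smooth_at_cong [OF E smooth_at_coordinate [OF E at pZ] chart_open [OF E at] pZ])
        fix y assume "y \<in> h ` Z"
        then show "(\<theta> \<circ> inv_into Z h) y j = \<theta> (inv_into (carr P) h y) j"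
          using ih piece_inj [OF I] s by auto
      qed
    qed
    then show "\<exists>V \<theta>. (V, \<theta>) \<in> atlas P \<and> inv_into (carr P) h p \<in> V \<and>
        (\<forall>j<mdim P. smooth_at (restrict_mfd E (h ` carr P)) (\<lambda>x. \<theta> (inv_into (carr P) h x) j) p)"
      using Z px by blast
  qed
qed

end

section \<open>The link bundle over an immersed submanifold\<close>

lemma second_countable_pullback_topology:
  assumes "second_countable Y"
  shows "second_countable (pullback_topology A f Y)"
proof -
  obtain \<B> where B: "countable \<B>" "\<And>V. V \<in> \<B> \<Longrightarrow> openin Y V"
      "\<And>U x. openin Y U \<Longrightarrow> x \<in> U \<Longrightarrow> \<exists>V\<in>\<B>. x \<in> V \<and> V \<subseteq> U"
    using assms unfolding second_countable_def by metis
  show ?thesis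
    unfolding second_countable_def
  proof (intro exI [of _ "(\<lambda>V. f -` V \<inter> A) ` \<B>"] conjI ballI allI impI)
    show "countable ((\<lambda>V. f -` V \<inter> A) ` \<B>)" using B(1) by blast
    show "openin (pullback_topology A f Y) V" if "V \<in> (\<lambda>V. f -` V \<inter> A) ` \<B>" for V
      using that B(2) by (auto simp: openin_pullback_topology)
    fix U x assume "openin (pullback_topology A f Y) U \<and> x \<in> U"
    then obtain V where V: "openin Y V" "U = f -` V \<inter> A" "x \<in> U" by (auto simp: openin_pullback_topology)
    then obtain W where "W \<in> \<B>" "f x \<in> W" "W \<subseteq> V" using B(3) [of V "f x"] by blast
    then show "\<exists>V\<in>(\<lambda>V. f -` V \<inter> A) ` \<B>. x \<in> V \<and> V \<subseteq> U" using V by (intro bexI [of _ "f -` W \<inter> A"]) auto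
  qed
qed

lemma restrict_mfd_restrict_mfd: "restrict_mfd (restrict_mfd M A) B = restrict_mfd M (A \<inter> B)"
proof -
  have "{(U \<inter> B, \<phi>) |U \<phi>. (U, \<phi>) \<in> {(U \<inter> A, \<phi>) |U \<phi>. (U, \<phi>) \<in> atlas M}} =
      {(U \<inter> A \<inter> B, \<phi>) |U \<phi>. (U, \<phi>) \<in> atlas M}" by blast
  then show ?thesis by (simp add: restrict_mfd_def subtopology_subtopology Int_assoc)
qed

text \<open>Equality of records, not just of structures. It reconciles
  \<open>restrict_mfd S (carr S \<inter> U)\<close>, demanded by the definition of a bundle
  trivialization, with \<open>restrict_mfd S U\<close>, from which the charts of the link bundle are
  made.\<close>

lemma restrict_mfd_cong:
  assumes "smooth_manifold M" and "carr M \<inter> A = carr M \<inter> B"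
  shows "restrict_mfd M A = restrict_mfd M B"
proof -
  have "U \<inter> A = U \<inter> B" if "(U, \<phi>) \<in> atlas M" for U \<phi>
    using chart_subset [OF assms(1) that] assms(2) by blast
  then have "{(U \<inter> A, \<phi>) |U \<phi>. (U, \<phi>) \<in> atlas M} = {(U \<inter> B, \<phi>) |U \<phi>. (U, \<phi>) \<in> atlas M}" by blast
  moreover have "subtopology (mtop M) A = subtopology (mtop M) B"
    using assms(2) by (metis subtopology_restrict)
  ultimately show ?thesis unfolding restrict_mfd_def by simp
qed

section \<open>The cone topology away from the vertex\<close>

lemma topspace_cone_topology: "topspace (cone_topology L) = cone_carr L"
proof
  show "topspace (cone_topology L) \<subseteq> cone_carr L"
    using openin_topspace [of "cone_topology L"] unfolding openin_cone_topology by blast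
  have "{z \<in> topspace L \<times> {0..<2}. cone_proj z \<in> cone_carr L} = topspace (prod_topology L (top_of_set {0..<2}))"
    by (auto simp: cone_proj_def cone_carr_def)
  then have "openin (cone_topology L) (cone_carr L)" unfolding openin_cone_topology by (simp del: topspace_prod_topology)
  then show "cone_carr L \<subseteq> topspace (cone_topology L)" by (rule openin_subset)
qed

lemma continuous_map_cone_section:
  assumes "t \<in> {0<..<2}"
  shows "continuous_map L (cone_topology L) (\<lambda>l. Some (l, t))"
  unfolding continuous_map_def
proof (intro conjI allI impI)
  show "(\<lambda>l. Some (l, t)) \<in> topspace L \<rightarrow> topspace (cone_topology L)"
    using assms by (auto simp: topspace_cone_topology cone_carr_def)
  fix W assume "openin (cone_topology L) W"
  then have W: "openin (prod_topology L (top_of_set {0..<2})) {z \<in> topspace L \<times> {0..<2}. cone_proj z \<in> W}"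
    unfolding openin_cone_topology by blast
  have "continuous_map L (prod_topology L (top_of_set {0..<2})) (\<lambda>l. (l, t))"
    using assms by (intro continuous_map_pairedI) auto
  from openin_continuous_map_preimage [OF this W]
  have "openin L {l \<in> topspace L. (l, t) \<in> {z \<in> topspace L \<times> {0..<2}. cone_proj z \<in> W}}" .
  also have "{l \<in> topspace L. (l, t) \<in> {z \<in> topspace L \<times> {0..<2}. cone_proj z \<in> W}}
      = {l \<in> topspace L. Some (l, t) \<in> W}"
    using assms by (auto simp: cone_proj_def)
  finally show "openin L {l \<in> topspace L. Some (l, t) \<in> W}" .
qed

lemma continuous_map_cone_link_coordinate:
  "continuous_map (subtopology (cone_topology L) (- {None})) L (\<lambda>z. fst (the z))"
  unfolding continuous_map_def
proof (intro conjI allI impI)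
  show "(\<lambda>z. fst (the z)) \<in> topspace (subtopology (cone_topology L) (- {None})) \<rightarrow> topspace L"
    by (auto simp: topspace_cone_topology cone_carr_def)
  fix W assume W: "openin L W"
  have WL: "W \<subseteq> topspace L" using W by (rule openin_subset)
  have "openin (cone_topology L) (Some ` (W \<times> {0<..<2}))"
    unfolding openin_cone_topology
  proof
    show "Some ` (W \<times> {0<..<2}) \<subseteq> cone_carr L" using WL by (auto simp: cone_carr_def)
    have "{z \<in> topspace L \<times> {0..<2}. cone_proj z \<in> Some ` (W \<times> {0<..<2})} = W \<times> {0<..<2}"
      using WL by (auto simp: cone_proj_def split: if_splits)
    moreover have "openin (top_of_set {0..<2}) {0<..<2::real}"
      unfolding openin_open by (intro exI [of _ "{0<..<2}"]) auto
    ultimately show "openin (prod_topology L (top_of_set {0..<2}))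
        {z \<in> topspace L \<times> {0..<2}. cone_proj z \<in> Some ` (W \<times> {0<..<2})}"
      using W by (simp add: openin_prod_Times_iff)
  qed
  then have "openin (subtopology (cone_topology L) (- {None})) (Some ` (W \<times> {0<..<2}) \<inter> - {None})"
    using openin_subtopology by blast
  moreover have "{z \<in> topspace (subtopology (cone_topology L) (- {None})). fst (the z) \<in> W}
      = Some ` (W \<times> {0<..<2}) \<inter> - {None}"
    using WL by (auto simp: topspace_cone_topology cone_carr_def)
  ultimately show "openin (subtopology (cone_topology L) (- {None}))
      {z \<in> topspace (subtopology (cone_topology L) (- {None})). fst (the z) \<in> W}" by simp
qed

text \<open>The level 1 is the one at which \<open>\<rho>\<close> cuts out the link bundle. This is
  the map \<open>h\<close> that occurs in the atlas of \<open>link_bundle_over\<close>.\<close>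

definition link_section :: "('x \<times> 'l cone \<Rightarrow> 'x) \<Rightarrow> 'x \<times> 'l \<Rightarrow> 'x" where
  "link_section \<psi> = (\<lambda>(u, l). \<psi> (u, Some (l, 1)))"

context two_strata_space
begin

section \<open>Points in a local trivialization of the cone bundle\<close>

lemma singular_smooth: "smooth_manifold S\<^sub>0" and link_manifold: "smooth_manifold L"
  using singular_manifold(1) L by (auto simp: closed_manifold_def)

lemma cone_triv_open: "cone_triv X S\<^sub>0 T \<pi> \<rho> L U \<psi> \<Longrightarrow> openin (mtop S\<^sub>0) U"
  and cone_triv_homeo: "cone_triv X S\<^sub>0 T \<pi> \<rho> L U \<psi> \<Longrightarrow>
     homeomorphic_map (prod_topology (subtopology (mtop S\<^sub>0) U) (cone_topology (mtop L)))
       (subtopology X {x \<in> T. \<pi> x \<in> U}) \<psi>"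
  by (auto simp: cone_triv_def)

lemma cone_triv_subset: "cone_triv X S\<^sub>0 T \<pi> \<rho> L U \<psi> \<Longrightarrow> U \<subseteq> carr S\<^sub>0"
  using cone_triv_open openin_subset by blast

lemma cone_triv_topspace:
  assumes "cone_triv X S\<^sub>0 T \<pi> \<rho> L U \<psi>"
  shows "topspace (prod_topology (subtopology (mtop S\<^sub>0) U) (cone_topology (mtop L))) = U \<times> cone_carr (mtop L)"
    and "topspace (subtopology X {x \<in> T. \<pi> x \<in> U}) = {x \<in> T. \<pi> x \<in> U}"
  using cone_triv_subset [OF assms] T(1) openin_subset
  by (auto simp: topspace_cone_topology)

lemma cone_triv_image:
  assumes "cone_triv X S\<^sub>0 T \<pi> \<rho> L U \<psi>"
  shows "\<psi> ` (U \<times> cone_carr (mtop L)) = {x \<in> T. \<pi> x \<in> U}"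
  using homeomorphic_imp_surjective_map [OF cone_triv_homeo [OF assms]]
  unfolding cone_triv_topspace [OF assms] .

lemma cone_triv_inj:
  assumes "cone_triv X S\<^sub>0 T \<pi> \<rho> L U \<psi>"
  shows "inj_on \<psi> (U \<times> cone_carr (mtop L))"
  using homeomorphic_imp_injective_map [OF cone_triv_homeo [OF assms]]
  unfolding cone_triv_topspace [OF assms] .

lemma cone_triv_point:
  assumes c: "cone_triv X S\<^sub>0 T \<pi> \<rho> L U \<psi>" and "u \<in> U" "l \<in> carr L" "t \<in> {0<..<2}"
  shows "\<psi> (u, Some (l, t)) \<in> T" "\<pi> (\<psi> (u, Some (l, t))) = u" "\<rho> (\<psi> (u, Some (l, t))) = t"
proof -
  have "(u, Some (l, t)) \<in> U \<times> cone_carr (mtop L)" using assms by (auto simp: cone_carr_def)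
  then show "\<psi> (u, Some (l, t)) \<in> T" using cone_triv_image [OF c] by blast
  show "\<pi> (\<psi> (u, Some (l, t))) = u" "\<rho> (\<psi> (u, Some (l, t))) = t"
    using assms unfolding cone_triv_def by (auto simp: cone_carr_def)
qed

lemma cone_triv_eqD:
  assumes c: "cone_triv X S\<^sub>0 T \<pi> \<rho> L U \<psi>" and "u \<in> U" "l \<in> carr L" "t \<in> {0<..<2}"
    and "u' \<in> U" "l' \<in> carr L" "t' \<in> {0<..<2}"
    and "\<psi> (u, Some (l, t)) = \<psi> (u', Some (l', t'))"
  shows "u = u'" "l = l'" "t = t'"
proof -
  have "(u, Some (l, t)) = (u', Some (l', t'))"
    by (rule inj_onD [OF cone_triv_inj [OF c] assms(8)]) (use assms in \<open>auto simp: cone_carr_def\<close>)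
  then show "u = u'" "l = l'" "t = t'" by auto
qed

lemma cone_triv_cases:
  assumes c: "cone_triv X S\<^sub>0 T \<pi> \<rho> L U \<psi>" and x: "x \<in> T" "\<pi> x \<in> U" "\<rho> x = 1"
  obtains l where "l \<in> carr L" "x = \<psi> (\<pi> x, Some (l, 1))"
proof -
  have "x \<in> \<psi> ` (U \<times> cone_carr (mtop L))" unfolding cone_triv_image [OF c] using x by simp
  then obtain u z where uz: "u \<in> U" "z \<in> cone_carr (mtop L)" "x = \<psi> (u, z)" by auto
  \<comment> \<open>At the vertex \<open>\<psi>\<close> returns the base point, which lies in the
    singular stratum, where \<open>\<rho>\<close> is 0 and not 1.\<close>
  have "z \<noteq> None"
  proof
    assume "z = None"
    then have "x = u" using uz c by (auto simp: cone_triv_def)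
    then have "\<rho> x = 0" using uz cone_triv_subset [OF c] \<rho>(2) by blast
    then show False using x by simp
  qed
  then obtain l t where "z = Some (l, t)" "l \<in> carr L" "t \<in> {0<..<2}" using uz(2) by (auto simp: cone_carr_def)
  then show thesis using cone_triv_point [OF c uz(1)] uz(3) x that by fastforce
qed

lemma cone_triv_atlas:
  assumes "(U, \<psi>) \<in> \<A>"
  shows "bundle_cone_triv X S\<^sub>0 T \<pi> \<rho> L \<A> U \<psi>"
  unfolding bundle_cone_triv_def using triv [OF assms] triv_change assms by blast

end

text \<open>\<open>S\<close> will be a leaf of \<open>\<S>\<close> with its own, possibly finer,
  topology. Smoothness of the inclusion is what makes traces of open sets of
  \<open>S\<^sub>0\<close> open in \<open>S\<close> and lets families that vary smoothly over
  \<open>S\<^sub>0\<close> be restricted to \<open>S\<close>.\<close>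

locale immersed_link_bundle = two_strata_space X S\<^sub>0 R T \<pi> \<rho> L \<A>
  for X :: "'x topology" and S\<^sub>0 R :: "'x mfd"
    and T :: "'x set" and \<pi> :: "'x \<Rightarrow> 'x" and \<rho> :: "'x \<Rightarrow> real"
    and L :: "'l mfd" and \<A> :: "('x set \<times> ('x \<times> 'l cone \<Rightarrow> 'x)) set" +
  fixes S :: "'x mfd"
  assumes S: "smooth_manifold S" and S_incl: "smooth_map S S\<^sub>0 (\<lambda>x. x)"
begin

abbreviation "E \<equiv> link_bundle_over X T \<pi> \<rho> L \<A> S"

abbreviation piece where "piece U \<equiv> prod_mfd (restrict_mfd S U) L"

lemma S_subset: "carr S \<subseteq> carr S\<^sub>0"
  using smooth_map_imp_into [OF S_incl] by auto

lemma S_open: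
  assumes "openin (mtop S\<^sub>0) U"
  shows "openin (mtop S) (carr S \<inter> U)"
  using openin_continuous_map_preimage [OF smooth_map_imp_continuous [OF S_incl] assms]
  by (simp add: Collect_conj_eq)

lemma piece_manifold:
  assumes "openin (mtop S\<^sub>0) U"
  shows "smooth_manifold (piece U)"
  by (intro smooth_manifold_prod smooth_manifold_restrict S S_open assms link_manifold)

lemma carr_piece: "carr (piece U) = (carr S \<inter> U) \<times> carr L"
  by simp

lemma mtop_E: "mtop E = pullback_topology {x \<in> T. \<pi> x \<in> carr S \<and> \<rho> x = 1} (\<lambda>x. (\<pi> x, x)) (prod_topology (mtop S) X)"
  and mdim_E: "mdim E = mdim S + mdim L"
  by (simp_all add: link_bundle_over_def)

lemma atlas_E: "atlas E = glued_atlas {(piece U, link_section \<psi>) |U \<psi>. (U, \<psi>) \<in> \<A>}"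
proof -
  have "atlas E = {(h ` Z, \<theta> \<circ> inv_into Z h) |U \<psi> h Z \<theta>.
      (U, \<psi>) \<in> \<A> \<and> h = link_section \<psi> \<and> (Z, \<theta>) \<in> atlas (piece U)}"
    by (simp only: link_bundle_over_def link_section_def mfd.select_convs)
  also have "\<dots> = glued_atlas {(piece U, link_section \<psi>) |U \<psi>. (U, \<psi>) \<in> \<A>}"
    unfolding glued_atlas_def by (intro Collect_cong) (simp only: mem_Collect_eq prod.inject, metis)
  finally show ?thesis .
qed

lemma carr_E: "carr E = {x \<in> T. \<pi> x \<in> carr S \<and> \<rho> x = 1}"
  unfolding mtop_E topspace_pullback_topology using openin_subset [OF T(1)] by auto

text \<open>Continuity into the leaf topology is built into the pullback topology of
  \<open>E\<close>; it would not follow from continuity of \<open>\<pi>\<close> into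
  \<open>S\<^sub>0\<close>.\<close>

lemma continuous_map_E_base: "continuous_map (mtop E) (mtop S) \<pi>"
  using continuous_map_pullback [OF continuous_map_fst, of _ "\<lambda>x. (\<pi> x, x)" "mtop S" X]
  unfolding mtop_E by (simp add: o_def)

lemma continuous_map_E_incl: "continuous_map (mtop E) X (\<lambda>x. x)"
  using continuous_map_pullback [OF continuous_map_snd, of _ "\<lambda>x. (\<pi> x, x)" "mtop S" X]
  unfolding mtop_E by (simp add: o_def)

lemma link_section_image:
  assumes c: "cone_triv X S\<^sub>0 T \<pi> \<rho> L U \<psi>"
  shows "link_section \<psi> ` carr (piece U) = {x \<in> carr E. \<pi> x \<in> U}"
  unfolding carr_piece
proof (intro equalityI subsetI)
  fix x assume "x \<in> link_section \<psi> ` ((carr S \<inter> U) \<times> carr L)"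
  then show "x \<in> {x \<in> carr E. \<pi> x \<in> U}"
    using cone_triv_point [OF c] by (auto simp: link_section_def carr_E)
next
  fix x assume "x \<in> {x \<in> carr E. \<pi> x \<in> U}"
  then have x: "x \<in> T" "\<pi> x \<in> carr S" "\<rho> x = 1" "\<pi> x \<in> U" by (auto simp: carr_E)
  obtain l where "l \<in> carr L" "x = \<psi> (\<pi> x, Some (l, 1))" using cone_triv_cases [OF c x(1,4,3)] .
  then have "x = link_section \<psi> (\<pi> x, l)" "(\<pi> x, l) \<in> (carr S \<inter> U) \<times> carr L"
    using x by (auto simp: link_section_def)
  then show "x \<in> link_section \<psi> ` ((carr S \<inter> U) \<times> carr L)" by blast
qed

lemma link_section_base:
  assumes c: "cone_triv X S\<^sub>0 T \<pi> \<rho> L U \<psi>" and "z \<in> carr (piece U)"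
  shows "\<pi> (link_section \<psi> z) = fst z"
  using assms(2) cone_triv_point [OF c] by (auto simp: link_section_def)

lemma link_section_inj:
  assumes c: "cone_triv X S\<^sub>0 T \<pi> \<rho> L U \<psi>"
  shows "inj_on (link_section \<psi>) (carr (piece U))"
proof (rule inj_onI)
  fix z z' assume z: "z \<in> carr (piece U)" "z' \<in> carr (piece U)" "link_section \<psi> z = link_section \<psi> z'"
  obtain u l u' l' where eq: "z = (u, l)" "z' = (u', l')" by fastforce
  then show "z = z'"
    using z cone_triv_eqD [OF c, of u l 1 u' l' 1] by (auto simp: link_section_def)
qed

lemma link_section_open:
  assumes c: "cone_triv X S\<^sub>0 T \<pi> \<rho> L U \<psi>"
  shows "openin (mtop E) (link_section \<psi> ` carr (piece U))"
proof -
  have "{x \<in> carr E. \<pi> x \<in> carr S \<inter> U} = {x \<in> carr E. \<pi> x \<in> U}" by (auto simp: carr_E)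
  then show ?thesis
    unfolding link_section_image [OF c]
    using openin_continuous_map_preimage [OF continuous_map_E_base S_open [OF cone_triv_open [OF c]]] by simp
qed

text \<open>Continuity of the section into \<open>E\<close> is tested by the two maps defining the
  pullback topology: followed by \<open>\<pi>\<close> it is \<open>fst\<close>, and followed by the
  inclusion into \<open>X\<close> it is \<open>\<psi>\<close> on the level 1.\<close>

lemma link_section_homeo:
  assumes c: "cone_triv X S\<^sub>0 T \<pi> \<rho> L U \<psi>"
  shows "homeomorphic_map (mtop (piece U)) (subtopology (mtop E) (link_section \<psi> ` carr (piece U))) (link_section \<psi>)"
proof -
  obtain g where g: "homeomorphic_maps (prod_topology (subtopology (mtop S\<^sub>0) U) (cone_topology (mtop L)))
       (subtopology X {x \<in> T. \<pi> x \<in> U}) \<psi> g"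
    using cone_triv_homeo [OF c] homeomorphic_map_maps by blast
  have gc: "continuous_map (subtopology X {x \<in> T. \<pi> x \<in> U}) (prod_topology (subtopology (mtop S\<^sub>0) U) (cone_topology (mtop L))) g"
    and \<psi>c: "continuous_map (prod_topology (subtopology (mtop S\<^sub>0) U) (cone_topology (mtop L))) (subtopology X {x \<in> T. \<pi> x \<in> U}) \<psi>"
    using g by (auto simp: homeomorphic_maps_def)
  have g\<psi>: "g (\<psi> (u, Some (l, 1))) = (u, Some (l, 1))" if "u \<in> U" "l \<in> carr L" for u l
    using g that cone_triv_subset [OF c] by (auto simp: homeomorphic_maps_def topspace_cone_topology cone_carr_def)
  let ?P = "mtop (piece U)" and ?Q = "subtopology (mtop E) (link_section \<psi> ` carr (piece U))"
  have fstS: "continuous_map ?P (mtop S) fst"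
    using continuous_map_fst [of "subtopology (mtop S) U" "mtop L"] by (simp add: continuous_map_in_subtopology)
  have h: "continuous_map ?P ?Q (link_section \<psi>)"
    unfolding continuous_map_in_subtopology
  proof
    have "continuous_map ?P (subtopology (mtop S\<^sub>0) U) fst"
      using continuous_map_compose [OF fstS smooth_map_imp_continuous [OF S_incl]]
      by (auto simp: continuous_map_in_subtopology o_def)
    moreover have "continuous_map ?P (cone_topology (mtop L)) (\<lambda>z. Some (snd z, 1))"
      using continuous_map_compose [OF continuous_map_snd continuous_map_cone_section [of 1 "mtop L"], of "subtopology (mtop S) U"]
      by (simp add: o_def)
    ultimately have "continuous_map ?P (prod_topology (subtopology (mtop S\<^sub>0) U) (cone_topology (mtop L)))
        (\<lambda>z. (fst z, Some (snd z, 1)))" by (rule continuous_map_pairedI)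
    from continuous_map_compose [OF this \<psi>c]
    have hX: "continuous_map ?P X (link_section \<psi>)"
      by (simp add: o_def link_section_def case_prod_unfold continuous_map_in_subtopology)
    have "continuous_map ?P (prod_topology (mtop S) X) (\<lambda>z. (fst z, link_section \<psi> z))"
      using fstS hX by (rule continuous_map_pairedI)
    then have "continuous_map ?P (prod_topology (mtop S) X) ((\<lambda>x. (\<pi> x, x)) \<circ> link_section \<psi>)"
      by (rule continuous_map_eq) (use link_section_base [OF c] in simp)
    then show "continuous_map ?P (mtop E) (link_section \<psi>)"
      unfolding mtop_E
    proof (rule continuous_map_pullback')
      have "link_section \<psi> ` carr (piece U) \<subseteq> carr E" unfolding link_section_image [OF c] by blast
      then show "topspace ?P \<subseteq> link_section \<psi> -` {x \<in> T. \<pi> x \<in> carr S \<and> \<rho> x = 1}"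
        unfolding carr_E by blast
    qed
  qed auto
  have EU: "continuous_map ?Q (subtopology X {x \<in> T. \<pi> x \<in> U}) (\<lambda>x. x)"
    using continuous_map_from_subtopology [OF continuous_map_E_incl]
    unfolding continuous_map_in_subtopology link_section_image [OF c] by (auto simp: carr_E)
  \<comment> \<open>The inverse takes its link coordinate from \<open>g\<close>, but its base
    coordinate from \<open>\<pi>\<close>: the first component of \<open>g\<close> is continuous only
    for the topology of \<open>S\<^sub>0\<close>, while \<open>\<pi>\<close> is continuous on
    \<open>E\<close> for that of \<open>S\<close>.\<close>
  have "continuous_map ?Q (prod_topology (mtop (restrict_mfd S U)) (mtop L)) (\<lambda>x. (\<pi> x, fst (the (snd (g x)))))"
  proof (rule continuous_map_pairedI)
    show "continuous_map ?Q (mtop (restrict_mfd S U)) \<pi>"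
      using continuous_map_from_subtopology [OF continuous_map_E_base]
      unfolding restrict_mfd_simps continuous_map_in_subtopology link_section_image [OF c] by auto
    have "continuous_map ?Q (cone_topology (mtop L)) (\<lambda>x. snd (g x))"
      using continuous_map_compose [OF continuous_map_compose [OF EU gc] continuous_map_snd] by (simp add: o_def)
    then have "continuous_map ?Q (subtopology (cone_topology (mtop L)) (- {None})) (\<lambda>x. snd (g x))"
      unfolding continuous_map_in_subtopology
    proof
      show "(\<lambda>x. snd (g x)) \<in> topspace ?Q \<rightarrow> - {None}"
        using g\<psi> by (auto simp: link_section_def)
    qed
    from continuous_map_compose [OF this continuous_map_cone_link_coordinate]
    show "continuous_map ?Q (mtop L) (\<lambda>x. fst (the (snd (g x))))" by (simp add: o_def)
  qed
  then have k: "continuous_map ?Q ?P (\<lambda>x. (\<pi> x, fst (the (snd (g x)))))" by (simp only: prod_mfd_simps)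
  have kh: "(\<lambda>x. (\<pi> x, fst (the (snd (g x))))) (link_section \<psi> z) = z" if "z \<in> topspace ?P" for z
  proof -
    from that obtain u l where "z = (u, l)" "u \<in> U" "l \<in> carr L" by auto
    then show ?thesis using g\<psi> cone_triv_point [OF c, of u l 1] by (simp add: link_section_def)
  qed
  have "homeomorphic_maps ?P ?Q (link_section \<psi>) (\<lambda>x. (\<pi> x, fst (the (snd (g x)))))"
    unfolding homeomorphic_maps_def
  proof (intro conjI ballI h k)
    fix y assume "y \<in> topspace ?Q"
    then obtain z where "z \<in> topspace ?P" "y = link_section \<psi> z" by auto
    then show "link_section \<psi> (\<pi> y, fst (the (snd (g y)))) = y" using kh by simp
  qed (rule kh)
  then show ?thesis using homeomorphic_map_maps by blast
qed

text \<open>The family \<open>\<phi>\<close> is smooth over an open subset of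
  \<open>S\<^sub>0\<close>; composing with the smooth inclusion of \<open>S\<close> makes it smooth
  over \<open>S\<close>. The set \<open>Q\<close> is left general so that both the overlap of two
  section images and a rectangle over \<open>U \<inter> U'\<close> can be inserted.\<close>

lemma smooth_transition:
  assumes U: "openin (mtop S\<^sub>0) U" and U': "openin (mtop S\<^sub>0) U'"
    and \<phi>: "smooth_map (prod_mfd (restrict_mfd S\<^sub>0 (U \<inter> U')) L) L (\<lambda>(u, l). \<phi> u l)"
    and Q: "openin (mtop (piece U)) (carr (piece U) \<inter> Q)"
    and QU': "\<And>z. z \<in> carr (piece U) \<Longrightarrow> z \<in> Q \<Longrightarrow> fst z \<in> U'"
  shows "smooth_map (restrict_mfd (piece U) Q) (piece U') (\<lambda>(u, l). (u, \<phi> u l))"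
proof -
  note P = piece_manifold [OF U]
  let ?M = "restrict_mfd (piece U) Q"
  have M: "smooth_manifold ?M" by (rule smooth_manifold_restrict [OF P Q])
  have SU: "smooth_manifold (restrict_mfd S U)" by (rule smooth_manifold_restrict [OF S S_open [OF U]])
  have SU': "smooth_manifold (restrict_mfd S U')" by (rule smooth_manifold_restrict [OF S S_open [OF U']])
  have o: "openin (mtop S\<^sub>0) (carr S\<^sub>0 \<inter> (U \<inter> U'))" using U U' by blast
  have S0U: "smooth_manifold (restrict_mfd S\<^sub>0 (U \<inter> U'))" by (rule smooth_manifold_restrict [OF singular_smooth o])
  have f: "smooth_map ?M S fst"
    by (rule smooth_map_restrict [OF P S Q smooth_map_from_restrict [OF P S S_open [OF U] smooth_map_fst [OF SU link_manifold]]])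
  have s: "smooth_map ?M L snd"
    by (rule smooth_map_restrict [OF P link_manifold Q smooth_map_snd [OF SU link_manifold]])
  have f': "smooth_map ?M (restrict_mfd S U') fst"
    by (rule smooth_map_into_restrict [OF M S S_open [OF U'] f]) (use QU' in auto)
  have f0: "smooth_map ?M (restrict_mfd S\<^sub>0 (U \<inter> U')) fst"
    by (rule smooth_map_into_restrict [OF M singular_smooth o smooth_map_compose [OF M S singular_smooth f S_incl]])
      (use QU' in auto)
  have "smooth_map ?M L (\<lambda>z. (\<lambda>(u, l). \<phi> u l) (fst z, snd z))"
    by (rule smooth_map_compose [OF M smooth_manifold_prod [OF S0U link_manifold] link_manifold
        smooth_map_Pair [OF M S0U link_manifold f0 s] \<phi>])
  then have "smooth_map ?M L (\<lambda>z. \<phi> (fst z) (snd z))" by (simp add: case_prod_unfold)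
  from smooth_map_Pair [OF M SU' link_manifold f' this]
  show ?thesis by (simp add: case_prod_unfold)
qed

lemma bundle_cone_trivD:
  assumes "bundle_cone_triv X S\<^sub>0 T \<pi> \<rho> L \<A> U \<psi>"
  shows "cone_triv X S\<^sub>0 T \<pi> \<rho> L U \<psi>"
  using assms by (simp add: bundle_cone_triv_def)

text \<open>The cone map \<open>c(\<phi> u)\<close> is the same \<open>\<phi> u\<close> on every
  level, so a change of cone trivializations restricts to the links at level 1.\<close>

lemma change_link_section:
  assumes ch: "cone_triv_change S\<^sub>0 L (U, \<psi>) (U', \<psi>')"
  shows "\<exists>\<phi>. smooth_map (prod_mfd (restrict_mfd S\<^sub>0 (U \<inter> U')) L) L (\<lambda>(u, l). \<phi> u l) \<and>
    (\<forall>u\<in>U \<inter> U'. diffeomorphism L L (\<phi> u) \<and>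
      (\<forall>l\<in>carr L. \<phi> u l \<in> carr L \<and> link_section \<psi> (u, l) = link_section \<psi>' (u, \<phi> u l)))"
proof -
  obtain \<phi> where \<phi>: "\<forall>u \<in> U \<inter> U'. diffeomorphism L L (\<phi> u)"
     "smooth_map (prod_mfd (restrict_mfd S\<^sub>0 (U \<inter> U')) L) L (\<lambda>(u, l). \<phi> u l)"
     "\<forall>u \<in> U \<inter> U'. \<forall>l\<in>carr L. \<forall>t\<in>{0<..<2}. \<psi> (u, Some (l, t)) = \<psi>' (u, Some (\<phi> u l, t))"
    using ch unfolding cone_triv_change_def by auto
  show ?thesis
  proof (intro exI [of _ \<phi>] conjI \<phi>(2) ballI)
    fix u assume u: "u \<in> U \<inter> U'"
    show "diffeomorphism L L (\<phi> u)" using \<phi>(1) u by blast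
    then have "smooth_map L L (\<phi> u)" by (simp add: diffeomorphism_def)
    then show "\<phi> u l \<in> carr L" if "l \<in> carr L" for l using that by (rule smooth_map_imp_into)
    show "link_section \<psi> (u, l) = link_section \<psi>' (u, \<phi> u l)" if "l \<in> carr L" for l
      using \<phi>(3) u that by (auto simp: link_section_def)
  qed
qed

text \<open>The maps between pieces have the form \<open>(u, l) \<mapsto> (u, \<phi> u l)\<close>,
  with \<open>\<phi>\<close> supplied by the structure group, so that
  \<open>smooth_transition\<close> verifies the compatibility. \<open>E\<close> is Hausdorff because
  it maps injectively and continuously to \<open>X\<close>.\<close>

sublocale gluing E "{(piece U, link_section \<psi>) |U \<psi>. (U, \<psi>) \<in> \<A>}"
proof
  show "Hausdorff_space (mtop E)"
    by (rule Hausdorff_space_injective_preimage [OF X(2) continuous_map_E_incl]) simp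
  show "second_countable (mtop E)"
    unfolding mtop_E using S X(3)
    by (intro second_countable_pullback_topology second_countable_prod_topology) (auto simp: smooth_manifold_def)
  show "atlas E = glued_atlas {(piece U, link_section \<psi>) |U \<psi>. (U, \<psi>) \<in> \<A>}" by (rule atlas_E)
  show "carr E \<subseteq> (\<Union>(P, h)\<in>{(piece U, link_section \<psi>) |U \<psi>. (U, \<psi>) \<in> \<A>}. h ` carr P)"
  proof
    fix x assume x: "x \<in> carr E"
    then have "\<pi> x \<in> carr S\<^sub>0" using S_subset carr_E by auto
    then obtain U \<psi> where U: "(U, \<psi>) \<in> \<A>" "\<pi> x \<in> U" using triv_cover by blast
    then have "x \<in> link_section \<psi> ` carr (piece U)" using x link_section_image [OF triv] by blast
    then show "x \<in> (\<Union>(P, h)\<in>{(piece U, link_section \<psi>) |U \<psi>. (U, \<psi>) \<in> \<A>}. h ` carr P)" using U by blast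
  qed
next
  fix P h assume "(P, h) \<in> {(piece U, link_section \<psi>) |U \<psi>. (U, \<psi>) \<in> \<A>}"
  then obtain U \<psi> where U: "(U, \<psi>) \<in> \<A>" and P: "P = piece U" "h = link_section \<psi>" by blast
  note c = triv [OF U]
  show "smooth_manifold P" unfolding P by (rule piece_manifold [OF cone_triv_open [OF c]])
  show "mdim P = mdim E" unfolding P mdim_E by simp
  show "openin (mtop E) (h ` carr P)" unfolding P by (rule link_section_open [OF c])
  show "homeomorphic_map (mtop P) (subtopology (mtop E) (h ` carr P)) h"
    unfolding P by (rule link_section_homeo [OF c])
  fix P' h' assume "(P', h') \<in> {(piece U, link_section \<psi>) |U \<psi>. (U, \<psi>) \<in> \<A>}"
  then obtain U' \<psi>' where U': "(U', \<psi>') \<in> \<A>" and P': "P' = piece U'" "h' = link_section \<psi>'" by blast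
  note c' = triv [OF U']
  obtain \<phi> where \<phi>': "smooth_map (prod_mfd (restrict_mfd S\<^sub>0 (U \<inter> U')) L) L (\<lambda>(u, l). \<phi> u l) \<and>
    (\<forall>u\<in>U \<inter> U'. diffeomorphism L L (\<phi> u) \<and>
      (\<forall>l\<in>carr L. \<phi> u l \<in> carr L \<and> link_section \<psi> (u, l) = link_section \<psi>' (u, \<phi> u l)))"
    using change_link_section [OF triv_change [OF U U']] ..
  have \<phi>: "smooth_map (prod_mfd (restrict_mfd S\<^sub>0 (U \<inter> U')) L) L (\<lambda>(u, l). \<phi> u l)"
    "\<And>u l. u \<in> U \<Longrightarrow> u \<in> U' \<Longrightarrow> l \<in> carr L \<Longrightarrow> \<phi> u l \<in> carr L"
    "\<And>u l. u \<in> U \<Longrightarrow> u \<in> U' \<Longrightarrow> l \<in> carr L \<Longrightarrow> link_section \<psi> (u, l) = link_section \<psi>' (u, \<phi> u l)"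
    using \<phi>' by blast+
  let ?Q = "{x. link_section \<psi> x \<in> link_section \<psi>' ` carr (piece U')}"
  have QU': "fst z \<in> U'" if "z \<in> carr (piece U)" "z \<in> ?Q" for z
    using that link_section_base [OF c that(1)] unfolding link_section_image [OF c'] by simp
  have hc: "continuous_map (mtop (piece U)) (mtop E) (link_section \<psi>)"
    using homeomorphic_imp_continuous_map [OF link_section_homeo [OF c]]
    by (simp only: continuous_map_in_subtopology)
  have Q: "openin (mtop (piece U)) (carr (piece U) \<inter> ?Q)"
    using openin_continuous_map_preimage [OF hc link_section_open [OF c']] by (simp only: Collect_conj_eq Collect_mem_eq)
  note M = smooth_manifold_restrict [OF piece_manifold [OF cone_triv_open [OF c]] Q]
  show "smooth_map (restrict_mfd P {x. h x \<in> h' ` carr P'}) P' (\<lambda>x. inv_into (carr P') h' (h x))"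
    unfolding P P'
  proof (rule smooth_map_cong [OF _ _ M piece_manifold [OF cone_triv_open [OF c']]])
    show "smooth_map (restrict_mfd (piece U) ?Q) (piece U') (\<lambda>(u, l). (u, \<phi> u l))"
      by (rule smooth_transition [OF cone_triv_open [OF c] cone_triv_open [OF c'] \<phi>(1) Q QU'])
    fix z assume z: "z \<in> carr (restrict_mfd (piece U) ?Q)"
    then have z': "z \<in> carr (piece U)" "z \<in> ?Q" by auto
    obtain u l where ul: "z = (u, l)" by (cases z)
    have u: "u \<in> U" "u \<in> carr S" "l \<in> carr L" "u \<in> U'" using z' QU' [OF z'] ul by auto
    then have "link_section \<psi> z = link_section \<psi>' (u, \<phi> u l)" "(u, \<phi> u l) \<in> carr (piece U')"
      using \<phi>(2,3) ul by auto
    then show "(case z of (u, l) \<Rightarrow> (u, \<phi> u l)) = inv_into (carr (piece U')) (link_section \<psi>') (link_section \<psi> z)"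
      using inv_into_f_f [OF link_section_inj [OF c']] ul by simp
  qed
qed

text \<open>For members of \<open>\<A>\<close> this is \<open>smooth_piece\<close>. Any other
  compatible trivialization is, near a given point, a section from \<open>\<A>\<close> after a
  smooth change of the link coordinate.\<close>

lemma smooth_section:
  assumes b: "bundle_cone_triv X S\<^sub>0 T \<pi> \<rho> L \<A> U \<psi>"
  shows "smooth_map (piece U) E (link_section \<psi>)"
proof (rule smooth_map_local)
  note c = bundle_cone_trivD [OF b]
  show P: "smooth_manifold (piece U)" by (rule piece_manifold [OF cone_triv_open [OF c]])
  show "smooth_manifold E" by (rule glued_manifold)
  fix p assume p: "p \<in> carr (piece U)"
  then have "fst p \<in> carr S\<^sub>0" using S_subset by auto
  then obtain U' \<psi>' where U': "(U', \<psi>') \<in> \<A>" "fst p \<in> U'" using triv_cover by blast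
  note c' = triv [OF U'(1)]
  have ch: "cone_triv_change S\<^sub>0 L (U, \<psi>) (U', \<psi>')" using b U'(1) unfolding bundle_cone_triv_def by blast
  obtain \<phi> where \<phi>': "smooth_map (prod_mfd (restrict_mfd S\<^sub>0 (U \<inter> U')) L) L (\<lambda>(u, l). \<phi> u l) \<and>
    (\<forall>u\<in>U \<inter> U'. diffeomorphism L L (\<phi> u) \<and>
      (\<forall>l\<in>carr L. \<phi> u l \<in> carr L \<and> link_section \<psi> (u, l) = link_section \<psi>' (u, \<phi> u l)))"
    using change_link_section [OF ch] ..
  have \<phi>: "smooth_map (prod_mfd (restrict_mfd S\<^sub>0 (U \<inter> U')) L) L (\<lambda>(u, l). \<phi> u l)"
    "\<And>u l. u \<in> U \<Longrightarrow> u \<in> U' \<Longrightarrow> l \<in> carr L \<Longrightarrow> \<phi> u l \<in> carr L"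
    "\<And>u l. u \<in> U \<Longrightarrow> u \<in> U' \<Longrightarrow> l \<in> carr L \<Longrightarrow> link_section \<psi> (u, l) = link_section \<psi>' (u, \<phi> u l)"
    using \<phi>' by blast+
  let ?Q = "(carr S \<inter> U \<inter> U') \<times> carr L"
  have oQ: "openin (mtop (piece U)) ?Q"
  proof -
    have "openin (mtop S) (carr S \<inter> U \<inter> U')"
      using S_open [of "U \<inter> U'"] cone_triv_open [OF c] cone_triv_open [OF c'] by (simp add: Int_assoc openin_Int)
    moreover have "carr S \<inter> U \<inter> U' = (carr S \<inter> U \<inter> U') \<inter> U" by blast
    ultimately have "openin (subtopology (mtop S) U) (carr S \<inter> U \<inter> U')" unfolding openin_subtopology by blast
    then show ?thesis by (simp add: openin_prod_Times_iff)
  qed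
  have oQ': "openin (mtop (piece U)) (carr (piece U) \<inter> ?Q)" using oQ by blast
  note M = smooth_manifold_restrict [OF P oQ']
  have t: "smooth_map (restrict_mfd (piece U) ?Q) (piece U') (\<lambda>(u, l). (u, \<phi> u l))"
    by (rule smooth_transition [OF cone_triv_open [OF c] cone_triv_open [OF c'] \<phi>(1) oQ']) auto
  have h': "smooth_map (piece U') E (link_section \<psi>')" by (rule smooth_piece) (use U' in blast)
  have "smooth_map (restrict_mfd (piece U) ?Q) E (link_section \<psi>)"
    by (rule smooth_map_cong [OF smooth_map_compose [OF M piece_manifold [OF cone_triv_open [OF c']] glued_manifold t h'] _ M glued_manifold])
      (auto simp: \<phi>(3))
  then show "\<exists>W. openin (mtop (piece U)) W \<and> p \<in> W \<and> smooth_map (restrict_mfd (piece U) W) E (link_section \<psi>)"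
    using oQ p U'(2) by (intro exI [of _ ?Q]) auto
qed

lemma smooth_section_inv:
  assumes b: "bundle_cone_triv X S\<^sub>0 T \<pi> \<rho> L \<A> U \<psi>"
  shows "smooth_map (restrict_mfd E (link_section \<psi> ` carr (piece U))) (piece U)
    (inv_into (carr (piece U)) (link_section \<psi>))"
proof (rule smooth_map_local)
  note c = bundle_cone_trivD [OF b]
  let ?EU = "link_section \<psi> ` carr (piece U)"
  have oEU: "openin (mtop E) (carr E \<inter> ?EU)" using link_section_open [OF c] by blast
  show R: "smooth_manifold (restrict_mfd E ?EU)" by (rule smooth_manifold_restrict [OF glued_manifold oEU])
  show P: "smooth_manifold (piece U)" by (rule piece_manifold [OF cone_triv_open [OF c]])
  fix p assume "p \<in> carr (restrict_mfd E ?EU)"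
  then have p: "p \<in> carr E" "p \<in> ?EU" by auto
  then have "\<pi> p \<in> carr S\<^sub>0" using S_subset carr_E by auto
  then obtain U' \<psi>' where U': "(U', \<psi>') \<in> \<A>" "\<pi> p \<in> U'" using triv_cover by blast
  note c' = triv [OF U'(1)]
  note P' = piece_manifold [OF cone_triv_open [OF c']]
  \<comment> \<open>The change is taken from \<open>\<psi>'\<close> to \<open>\<psi>\<close>,
    opposite to the previous lemma. As compatibility is required in both directions, the inverse of
    \<open>\<phi> u\<close> need not be shown to depend smoothly on \<open>u\<close>.\<close>
  have ch: "cone_triv_change S\<^sub>0 L (U', \<psi>') (U, \<psi>)" using b U'(1) unfolding bundle_cone_triv_def by blast
  obtain \<phi> where \<phi>': "smooth_map (prod_mfd (restrict_mfd S\<^sub>0 (U' \<inter> U)) L) L (\<lambda>(u, l). \<phi> u l) \<and>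
    (\<forall>u\<in>U' \<inter> U. diffeomorphism L L (\<phi> u) \<and>
      (\<forall>l\<in>carr L. \<phi> u l \<in> carr L \<and> link_section \<psi>' (u, l) = link_section \<psi> (u, \<phi> u l)))"
    using change_link_section [OF ch] ..
  have \<phi>: "smooth_map (prod_mfd (restrict_mfd S\<^sub>0 (U' \<inter> U)) L) L (\<lambda>(u, l). \<phi> u l)"
    "\<And>u l. u \<in> U' \<Longrightarrow> u \<in> U \<Longrightarrow> l \<in> carr L \<Longrightarrow> \<phi> u l \<in> carr L"
    "\<And>u l. u \<in> U' \<Longrightarrow> u \<in> U \<Longrightarrow> l \<in> carr L \<Longrightarrow> link_section \<psi>' (u, l) = link_section \<psi> (u, \<phi> u l)"
    using \<phi>' by blast+
  let ?EU' = "link_section \<psi>' ` carr (piece U')"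
  let ?W = "?EU \<inter> ?EU'"
  have oW: "openin (mtop E) ?W" using link_section_open [OF c] link_section_open [OF c'] by blast
  \<comment> \<open>Smoothness near \<open>p\<close> is proved inside the image of
    \<open>\<psi>'\<close>, where \<open>smooth_piece_inv\<close> applies, and is carried to the
    image of \<open>\<psi>\<close> by this equality.\<close>
  have W: "restrict_mfd (restrict_mfd E ?EU) ?W = restrict_mfd (restrict_mfd E ?EU') ?W"
    unfolding restrict_mfd_restrict_mfd by (rule arg_cong [where f = "restrict_mfd E"]) blast
  have oW1: "openin (mtop (restrict_mfd E ?EU)) ?W" and oW2: "openin (mtop (restrict_mfd E ?EU')) ?W"
    unfolding restrict_mfd_simps openin_subtopology using oW by blast+
  have oW1': "openin (mtop (restrict_mfd E ?EU)) (carr (restrict_mfd E ?EU) \<inter> ?W)"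
    and oW2': "openin (mtop (restrict_mfd E ?EU')) (carr (restrict_mfd E ?EU') \<inter> ?W)"
    using oW1 oW2 by blast+
  have oEU': "openin (mtop E) (carr E \<inter> ?EU')" using link_section_open [OF c'] by blast
  note R' = smooth_manifold_restrict [OF glued_manifold oEU']
  note M = smooth_manifold_restrict [OF R' oW2']
  let ?Q = "(carr S \<inter> U' \<inter> U) \<times> carr L"
  have oQ: "openin (mtop (piece U')) ?Q"
  proof -
    have "openin (mtop S) (carr S \<inter> U' \<inter> U)"
      using S_open [of "U' \<inter> U"] cone_triv_open [OF c] cone_triv_open [OF c'] by (simp add: Int_assoc openin_Int)
    moreover have "carr S \<inter> U' \<inter> U = (carr S \<inter> U' \<inter> U) \<inter> U'" by blast
    ultimately have "openin (subtopology (mtop S) U') (carr S \<inter> U' \<inter> U)" unfolding openin_subtopology by blast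
    then show ?thesis by (simp add: openin_prod_Times_iff)
  qed
  have oQ': "openin (mtop (piece U')) (carr (piece U') \<inter> ?Q)" using oQ by blast
  have t: "smooth_map (restrict_mfd (piece U') ?Q) (piece U) (\<lambda>(u, l). (u, \<phi> u l))"
    by (rule smooth_transition [OF cone_triv_open [OF c'] cone_triv_open [OF c] \<phi>(1) oQ']) auto
  have key: "\<exists>u l. inv_into (carr (piece U')) (link_section \<psi>') x = (u, l) \<and> (u, l) \<in> ?Q \<and>
      inv_into (carr (piece U)) (link_section \<psi>) x = (u, \<phi> u l)" if x: "x \<in> ?W" for x
  proof -
    from x obtain u l where ul: "x = link_section \<psi>' (u, l)" "(u, l) \<in> carr (piece U')" by auto
    have "\<pi> x = u" using link_section_base [OF c' ul(2)] ul(1) by simp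
    moreover have "\<pi> x \<in> U" using x unfolding link_section_image [OF c] by blast
    ultimately have u: "u \<in> U" by simp
    then have Q: "(u, l) \<in> ?Q" using ul(2) by auto
    have "x = link_section \<psi> (u, \<phi> u l)" "(u, \<phi> u l) \<in> carr (piece U)"
      using \<phi>(2,3) ul u by auto
    then show ?thesis
      using inv_into_f_f [OF link_section_inj [OF c]] inv_into_f_f [OF link_section_inj [OF c'] ul(2)] ul(1) Q
      by (intro exI [of _ u] exI [of _ l]) simp
  qed
  have i0: "smooth_map (restrict_mfd E ?EU') (piece U') (inv_into (carr (piece U')) (link_section \<psi>'))"
    by (rule smooth_piece_inv) (use U' in blast)
  have i1: "smooth_map (restrict_mfd (restrict_mfd E ?EU') ?W) (piece U') (inv_into (carr (piece U')) (link_section \<psi>'))"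
    by (rule smooth_map_restrict [OF R' P' oW2' i0])
  have i2: "smooth_map (restrict_mfd (restrict_mfd E ?EU') ?W) (restrict_mfd (piece U') ?Q)
      (inv_into (carr (piece U')) (link_section \<psi>'))"
  proof (rule smooth_map_into_restrict [OF M P' oQ' i1])
    fix x assume "x \<in> carr (restrict_mfd (restrict_mfd E ?EU') ?W)"
    then have "x \<in> ?W" unfolding restrict_mfd_simps topspace_subtopology by blast
    then show "inv_into (carr (piece U')) (link_section \<psi>') x \<in> ?Q" using key by metis
  qed
  have "smooth_map (restrict_mfd (restrict_mfd E ?EU') ?W) (piece U) (inv_into (carr (piece U)) (link_section \<psi>))"
  proof (rule smooth_map_cong [OF smooth_map_compose [OF M smooth_manifold_restrict [OF P' oQ'] P i2 t] _ M P])
    fix x assume "x \<in> carr (restrict_mfd (restrict_mfd E ?EU') ?W)"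
    then have "x \<in> ?W" unfolding restrict_mfd_simps topspace_subtopology by blast
    then show "(case inv_into (carr (piece U')) (link_section \<psi>') x of (u, l) \<Rightarrow> (u, \<phi> u l)) =
         inv_into (carr (piece U)) (link_section \<psi>) x" using key by fastforce
  qed
  moreover have "p \<in> ?W" using p U'(2) unfolding link_section_image [OF c'] by blast
  ultimately show "\<exists>W. openin (mtop (restrict_mfd E ?EU)) W \<and> p \<in> W \<and>
     smooth_map (restrict_mfd (restrict_mfd E ?EU) W) (piece U) (inv_into (carr (piece U)) (link_section \<psi>))"
    using oW1 W by metis
qed

lemma smooth_bundle_triv_section:
  assumes b: "bundle_cone_triv X S\<^sub>0 T \<pi> \<rho> L \<A> U \<psi>"
  shows "smooth_bundle_triv E S L \<pi> (carr S \<inter> U) (link_section \<psi>)"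
proof -
  note c = bundle_cone_trivD [OF b]
  let ?EU = "link_section \<psi> ` carr (piece U)"
  have r: "restrict_mfd S (carr S \<inter> U) = restrict_mfd S U" by (rule restrict_mfd_cong [OF S]) blast
  have im: "{x \<in> carr E. \<pi> x \<in> carr S \<inter> U} = ?EU"
    unfolding link_section_image [OF c] by (auto simp: carr_E)
  have oEU: "openin (mtop E) (carr E \<inter> ?EU)" using link_section_open [OF c] by blast
  have "diffeomorphism (piece U) (restrict_mfd E ?EU) (link_section \<psi>)"
    unfolding diffeomorphism_def
  proof (intro conjI exI [of _ "inv_into (carr (piece U)) (link_section \<psi>)"] ballI)
    show "smooth_map (piece U) (restrict_mfd E ?EU) (link_section \<psi>)"
      by (rule smooth_map_into_restrict [OF piece_manifold [OF cone_triv_open [OF c]] glued_manifold oEU smooth_section [OF b]]) blast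
    show "smooth_map (restrict_mfd E ?EU) (piece U) (inv_into (carr (piece U)) (link_section \<psi>))"
      by (rule smooth_section_inv [OF b])
    show "inv_into (carr (piece U)) (link_section \<psi>) (link_section \<psi> x) = x" if "x \<in> carr (piece U)" for x
      using inv_into_f_f [OF link_section_inj [OF c] that] .
    show "link_section \<psi> (inv_into (carr (piece U)) (link_section \<psi>) y) = y" if "y \<in> carr (restrict_mfd E ?EU)" for y
      by (rule f_inv_into_f) (use that in \<open>unfold restrict_mfd_simps topspace_subtopology, blast\<close>)
  qed
  then show ?thesis
    unfolding smooth_bundle_triv_def r im
    using S_open [OF cone_triv_open [OF c]] link_section_base [OF c] by auto
qed

text \<open>Locally \<open>\<pi>\<close> is the inverse of a section followed by the first
  projection.\<close>

lemma smooth_projection: "smooth_map E S \<pi>"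
proof (rule smooth_map_local [OF glued_manifold S])
  fix p assume p: "p \<in> carr E"
  then have "\<pi> p \<in> carr S\<^sub>0" using S_subset carr_E by auto
  then obtain U \<psi> where U: "(U, \<psi>) \<in> \<A>" "\<pi> p \<in> U" using triv_cover by blast
  note c = triv [OF U(1)]
  let ?EU = "link_section \<psi> ` carr (piece U)"
  have oEU: "openin (mtop E) (carr E \<inter> ?EU)" using link_section_open [OF c] by blast
  note R = smooth_manifold_restrict [OF glued_manifold oEU]
  note P = piece_manifold [OF cone_triv_open [OF c]]
  have i: "smooth_map (restrict_mfd E ?EU) (piece U) (inv_into (carr (piece U)) (link_section \<psi>))"
    by (rule smooth_section_inv [OF cone_triv_atlas [OF U(1)]])
  have f: "smooth_map (piece U) S fst"
    by (rule smooth_map_from_restrict [OF P S S_open [OF cone_triv_open [OF c]]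
        smooth_map_fst [OF smooth_manifold_restrict [OF S S_open [OF cone_triv_open [OF c]]] link_manifold]])
  have "smooth_map (restrict_mfd E ?EU) S \<pi>"
  proof (rule smooth_map_cong [OF smooth_map_compose [OF R P S i f] _ R S])
    fix x assume "x \<in> carr (restrict_mfd E ?EU)"
    then have x: "x \<in> ?EU" unfolding restrict_mfd_simps topspace_subtopology by blast
    then show "fst (inv_into (carr (piece U)) (link_section \<psi>) x) = \<pi> x"
      using link_section_base [OF c inv_into_into [OF x]] f_inv_into_f [OF x] by simp
  qed
  moreover have "p \<in> ?EU" using p U(2) unfolding link_section_image [OF c] by blast
  ultimately show "\<exists>W. openin (mtop E) W \<and> p \<in> W \<and> smooth_map (restrict_mfd E W) S \<pi>"
    using link_section_open [OF c] by blast
qed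

lemma smooth_fiber_bundle: "smooth_fiber_bundle E S L \<pi>"
  unfolding smooth_fiber_bundle_def
proof (intro conjI ballI)
  show "smooth_manifold E" by (rule glued_manifold)
  show "smooth_manifold S" by (rule S)
  show "smooth_manifold L" by (rule link_manifold)
  show "smooth_map E S \<pi>" by (rule smooth_projection)
  fix b assume b: "b \<in> carr S"
  then obtain U \<psi> where U: "(U, \<psi>) \<in> \<A>" "b \<in> U" using triv_cover S_subset by blast
  then show "\<exists>V h. b \<in> V \<and> smooth_bundle_triv E S L \<pi> V h"
    using smooth_bundle_triv_section [OF cone_triv_atlas [OF U(1)]] b by blast
qed

end

section \<open>Leaves and locally constant transition functions\<close>

lemma locally_connected_Euclidean_space: "locally_connected_space (Euclidean_space n)"
proof -
  have "connected_space euclideanreal"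
    using connected_UNIV [where 'a = real] by (metis connectedin_iff_connected connectedin_topspace topspace_euclidean)
  then show ?thesis
    using homeomorphic_locally_connected_space [OF homeomorphic_Euclidean_space_product_topology [of n]]
    by (simp add: locally_connected_space_product_topology locally_connected_space_euclideanreal)
qed

lemma locally_connected_manifold:
  assumes M: "smooth_manifold M"
  shows "locally_connected_space (mtop M)"
  unfolding locally_connected_space
proof (intro allI impI)
  fix V x assume V: "openin (mtop M) V \<and> x \<in> V"
  then have "x \<in> carr M" using openin_subset by blast
  then obtain U \<phi> where U: "(U, \<phi>) \<in> atlas M" "x \<in> U" using chart_cover [OF M] by blast
  have "locally_connected_space (subtopology (Euclidean_space (mdim M)) (\<phi> ` U))"
    by (rule locally_connected_space_open_subset [OF locally_connected_Euclidean_space chart_image_open' [OF M U(1)]])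
  moreover have "subtopology (mtop M) U homeomorphic_space subtopology (Euclidean_space (mdim M)) (\<phi> ` U)"
    using chart_homeo [OF M U(1)] homeomorphic_map_imp_homeomorphic_space by blast
  ultimately have "locally_connected_space (subtopology (mtop M) U)"
    using homeomorphic_locally_connected_space by blast
  moreover have "openin (subtopology (mtop M) U) (U \<inter> V)" using V openin_subtopology_Int2 by blast
  moreover have "x \<in> U \<inter> V" using V U by blast
  ultimately obtain W where W: "openin (subtopology (mtop M) U) W" "connectedin (subtopology (mtop M) U) W"
    "x \<in> W" "W \<subseteq> U \<inter> V"
    unfolding locally_connected_space by meson
  have "openin (mtop M) W" using W(1) chart_open [OF M U(1)] openin_trans_full by blast
  moreover have "connectedin (mtop M) W" using W(2) connectedin_subtopology by blast
  ultimately show "\<exists>U. openin (mtop M) U \<and> connectedin (mtop M) U \<and> x \<in> U \<and> U \<subseteq> V" using W by blast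
qed

text \<open>Components of a locally connected space are open, so each contains a nonempty member of
  a countable basis. Disjointness of components makes this choice injective.\<close>

lemma countable_connected_components:
  assumes X: "second_countable X" "locally_connected_space X"
  shows "countable (connected_components_of X)"
proof -
  obtain \<B> where B: "countable \<B>" "\<And>U x. openin X U \<Longrightarrow> x \<in> U \<Longrightarrow> \<exists>V\<in>\<B>. x \<in> V \<and> V \<subseteq> U"
    using X(1) unfolding second_countable_def by metis
  have "\<exists>V. V \<in> \<B> \<and> V \<noteq> {} \<and> V \<subseteq> C" if C: "C \<in> connected_components_of X" for C
  proof -
    obtain x where "x \<in> C" using nonempty_connected_components_of [OF C] by blast
    then show ?thesis using B(2) openin_connected_components_of_locally_connected_space [OF X(2) C] by blast
  qed
  then obtain f where f: "\<And>C. C \<in> connected_components_of X \<Longrightarrow> f C \<in> \<B> \<and> f C \<noteq> {} \<and> f C \<subseteq> C" by metis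
  have "inj_on f (connected_components_of X)"
  proof (rule inj_onI)
    fix C D assume C: "C \<in> connected_components_of X" and D: "D \<in> connected_components_of X" and "f C = f D"
    then have "\<not> disjnt C D" using f [OF C] f [OF D] by (auto simp: disjnt_def)
    then show "C = D" using C D pairwise_disjoint_connected_components_of [of X] by (auto simp: pairwise_def)
  qed
  moreover have "countable (f ` connected_components_of X)"
    by (rule countable_subset [OF _ B(1)]) (use f in blast)
  ultimately show ?thesis using countable_image_inj_on by blast
qed

text \<open>If \<open>a\<close> and \<open>b\<close> were distinct, a Urysohn function with values 0
  at \<open>a\<close> and 1 at \<open>b\<close> would map \<open>S\<close> onto a connected set of
  reals with two points, hence onto an uncountable one.\<close>

lemma countable_connectedin_constant:
  assumes Y: "compact_space Y" "Hausdorff_space Y"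
    and S: "connectedin Y S" "countable S" and ab: "a \<in> S" "b \<in> S"
  shows "a = b"
proof (rule ccontr)
  assume ne: "a \<noteq> b"
  have SY: "S \<subseteq> topspace Y" using S(1) connectedin_subset_topspace by blast
  have "normal_space Y" using Y compact_Hausdorff_or_regular_imp_normal_space by blast
  moreover have "closedin Y {a}" "closedin Y {b}"
    using closedin_Hausdorff_singleton [OF Y(2)] SY ab by auto
  moreover have "disjnt {a} {b}" using ne by simp
  ultimately obtain f where f: "continuous_map Y euclideanreal f" "f ` {a} \<subseteq> {0}" "f ` {b} \<subseteq> {1}"
    by (rule Urysohn_lemma_alt)
  have "connected (f ` S)" using connectedin_continuous_map_image [OF f(1) S(1)] by simp
  then have "uncountable (f ` S)"
    by (rule connected_uncountable [where a = 0 and b = 1]) (use f ab in \<open>auto simp: image_iff intro: bexI [of _ a] bexI [of _ b]\<close>)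
  then show False using S(2) by blast
qed

lemma diffeomorphism_compose:
  assumes M: "smooth_manifold M" and N: "smooth_manifold N" and P: "smooth_manifold P"
    and f: "diffeomorphism M N f" and g: "diffeomorphism N P g"
  shows "diffeomorphism M P (\<lambda>x. g (f x))"
proof -
  obtain f' where f': "smooth_map M N f" "smooth_map N M f'" "\<forall>x\<in>carr M. f' (f x) = x" "\<forall>y\<in>carr N. f (f' y) = y"
    using f unfolding diffeomorphism_def by blast
  obtain g' where g': "smooth_map N P g" "smooth_map P N g'" "\<forall>x\<in>carr N. g' (g x) = x" "\<forall>y\<in>carr P. g (g' y) = y"
    using g unfolding diffeomorphism_def by blast
  show ?thesis
    unfolding diffeomorphism_def
  proof (intro conjI exI [of _ "\<lambda>x. f' (g' x)"] ballI)
    show "smooth_map M P (\<lambda>x. g (f x))" by (rule smooth_map_compose [OF M N P f'(1) g'(1)])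
    show "smooth_map P M (\<lambda>x. f' (g' x))" by (rule smooth_map_compose [OF P N M g'(2) f'(2)])
    show "f' (g' (g (f x))) = x" if "x \<in> carr M" for x
      using f'(3) g'(3) smooth_map_imp_into [OF f'(1) that] that by simp
    show "g (f (f' (g' y))) = y" if "y \<in> carr P" for y
      using f'(4) g'(4) smooth_map_imp_into [OF g'(2) that] that by simp
  qed
qed

section \<open>Plaques, leaves and the transition functions over a leaf\<close>

context immersed_link_bundle
begin

lemma countable_link_coordinates_of_leaf:
  assumes \<X>: "smooth_foliation R k \<X>" and F: "F \<in> \<X>"
    and c: "cone_triv X S\<^sub>0 T \<pi> \<rho> L U \<psi>" and pt: "point_foliation L \<L>"
    and fol: "foliated_cone_triv S\<^sub>0 T \<pi> \<X> \<S> U \<psi> \<L>"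
  shows "countable {l \<in> carr L. \<exists>u\<in>U. \<psi> (u, Some (l, 1)) \<in> carr F}"
proof -
  \<comment> \<open>The region in which \<open>foliated_cone_triv\<close> describes
    \<open>\<X>\<close>. It is open in \<open>X\<close>, so its trace on \<open>F\<close> is open in
    the leaf topology and inherits local connectedness.\<close>
  define Y where "Y = {x \<in> T. \<pi> x \<in> U} - carr S\<^sub>0"
  have mF: "smooth_manifold F" and iF: "continuous_map (mtop F) (mtop R) (\<lambda>x. x)"
    using \<X> F unfolding smooth_foliation_def immersion_def by (auto intro: smooth_map_imp_continuous)
  have oT: "openin X {x \<in> T. \<pi> x \<in> U}"
  proof -
    have "openin (subtopology X T) {x \<in> topspace (subtopology X T). \<pi> x \<in> U}"
      by (rule openin_continuous_map_preimage [OF \<pi>(1) cone_triv_open [OF c]])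
    then have "openin X {x \<in> topspace (subtopology X T). \<pi> x \<in> U}" using T(1) openin_trans_full by blast
    moreover have "{x \<in> topspace (subtopology X T). \<pi> x \<in> U} = {x \<in> T. \<pi> x \<in> U}" using openin_subset [OF T(1)] by auto
    ultimately show ?thesis by simp
  qed
  then have "openin X Y" unfolding Y_def using singular_closed by (simp add: openin_diff)
  have cF: "continuous_map (mtop F) X (\<lambda>x. x)"
    using iF unfolding regular_manifold(1) continuous_map_in_subtopology by blast
  have "openin (mtop F) (Y \<inter> carr F)"
    using openin_continuous_map_preimage [OF cF \<open>openin X Y\<close>] by (simp add: Collect_conj_eq Int_commute)
  then have "locally_connected_space (subtopology (mtop F) (Y \<inter> carr F))"
    using locally_connected_manifold [OF mF] locally_connected_space_open_subset by blast
  moreover have "second_countable (subtopology (mtop F) (Y \<inter> carr F))"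
    using mF by (simp add: smooth_manifold_def second_countable_subtopology)
  ultimately have count: "countable (connected_components_of (subtopology (mtop F) (Y \<inter> carr F)))"
    by (rule countable_connected_components [rotated])
  have carrL: "\<exists>l. carr K = {l} \<and> l \<in> carr L" if "K \<in> \<L>" for K
    using pt that unfolding point_foliation_def by blast
  have plaque: "\<exists>l\<in>carr L. \<forall>x\<in>D. \<exists>u\<in>U. \<exists>t\<in>{0<..<2}. x = \<psi> (u, Some (l, t))"
    if D: "D \<in> connected_components_of (subtopology (mtop F) (Y \<inter> carr F))" for D
  proof -
    have "D \<subseteq> carr F" using connected_components_of_subset [OF D] by auto
    then have "D = carr (restrict_mfd F D)" by auto
    moreover have "restrict_mfd F D \<in> restrict_foliation \<X> Y"
      unfolding restrict_foliation_def using F D by blast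
    ultimately have "D \<in> carr ` restrict_foliation \<X> ({x \<in> T. \<pi> x \<in> U} - carr S\<^sub>0)"
      unfolding Y_def by (rule image_eqI)
    then obtain A K t where AK: "D = \<psi> ` (carr A \<times> Some ` (carr K \<times> {t}))" "A \<in> restrict_foliation \<S> U"
      "K \<in> \<L>" "t \<in> {0<..<2}" unfolding fol [unfolded foliated_cone_triv_def, symmetric] by blast
    obtain l where l: "carr K = {l}" "l \<in> carr L" using carrL [OF AK(3)] by blast
    obtain G C where "A = restrict_mfd G C" "C \<in> connected_components_of (subtopology (mtop G) (U \<inter> carr G))"
      using AK(2) unfolding restrict_foliation_def by blast
    then have "carr A \<subseteq> U" using connected_components_of_subset by fastforce
    then have "\<exists>u\<in>U. \<exists>t\<in>{0<..<2}. x = \<psi> (u, Some (l, t))" if "x \<in> D" for x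
    proof -
      from that obtain u where "u \<in> carr A" "x = \<psi> (u, Some (l, t))" using AK(1) l(1) by auto
      then show ?thesis using AK(4) \<open>carr A \<subseteq> U\<close> by blast
    qed
    then show ?thesis using l(2) by blast
  qed
  \<comment> \<open>\<open>f\<close> assigns to a plaque its link coordinate. Injectivity of
    \<open>\<psi>\<close> then shows that a point of link coordinate \<open>l\<close> on the plaque
    \<open>D\<close> has \<open>l = f D\<close>.\<close>
  then obtain f where f: "\<And>D. D \<in> connected_components_of (subtopology (mtop F) (Y \<inter> carr F)) \<Longrightarrow>
     f D \<in> carr L \<and> (\<forall>x\<in>D. \<exists>u\<in>U. \<exists>t\<in>{0<..<2}. x = \<psi> (u, Some (f D, t)))" by metis
  have "{l \<in> carr L. \<exists>u\<in>U. \<psi> (u, Some (l, 1)) \<in> carr F}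
      \<subseteq> f ` connected_components_of (subtopology (mtop F) (Y \<inter> carr F))"
  proof
    fix l assume "l \<in> {l \<in> carr L. \<exists>u\<in>U. \<psi> (u, Some (l, 1)) \<in> carr F}"
    then obtain u where l: "l \<in> carr L" and u: "u \<in> U" "\<psi> (u, Some (l, 1)) \<in> carr F" by blast
    let ?x = "\<psi> (u, Some (l, 1))"
    have x: "?x \<in> T" "\<pi> ?x = u" "\<rho> ?x = 1" using cone_triv_point [OF c u(1) l, of 1] by auto
    then have "?x \<notin> carr S\<^sub>0" unfolding \<rho>(2) [symmetric] by simp
    then have "?x \<in> topspace (subtopology (mtop F) (Y \<inter> carr F))" using u x by (auto simp: Y_def)
    then obtain D where D: "D \<in> connected_components_of (subtopology (mtop F) (Y \<inter> carr F))" "?x \<in> D"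
      using Union_connected_components_of by (metis UnionE)
    then obtain u' t where "u' \<in> U" "t \<in> {0<..<2}" "?x = \<psi> (u', Some (f D, t))" "f D \<in> carr L" using f by blast
    then have "l = f D" using cone_triv_eqD(2) [OF c u(1) l, of 1 u' "f D" t] by auto
    then show "l \<in> f ` connected_components_of (subtopology (mtop F) (Y \<inter> carr F))" using D(1) by blast
  qed
  then show ?thesis using count countable_image countable_subset by blast
qed

text \<open>Being connected in the leaf topology of \<open>S\<close>, the set \<open>N\<close> lies
  in one component \<open>C\<close> of \<open>S\<close> over \<open>U\<close>, that is, in one leaf
  of the restricted foliation. Then \<open>C \<times> {l} \<times> {1}\<close> corresponds to a
  single leaf of the restriction of \<open>\<X>\<close>, which is contained in one leaf
  \<open>F\<close>.\<close>

lemma leaf_of_link_point: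
  assumes S: "S \<in> \<S>" and c: "cone_triv X S\<^sub>0 T \<pi> \<rho> L U \<psi>" and pt: "point_foliation L \<L>"
    and fol: "foliated_cone_triv S\<^sub>0 T \<pi> \<X> \<S> U \<psi> \<L>"
    and N: "connectedin (mtop S) N" "N \<subseteq> U" "N \<noteq> {}" and l: "l \<in> carr L"
  obtains F where "F \<in> \<X>" "\<And>u. u \<in> N \<Longrightarrow> \<psi> (u, Some (l, 1)) \<in> carr F"
proof -
  obtain b where b: "b \<in> N" using N by blast
  have NS: "N \<subseteq> carr S" using N(1) connectedin_subset_topspace by blast
  let ?Y = "subtopology (mtop S) (U \<inter> carr S)"
  have cN: "connectedin ?Y N" using N NS by (simp add: connectedin_subtopology)
  have "b \<in> topspace ?Y" using b N NS by auto
  then obtain C where C: "C \<in> connected_components_of ?Y" "b \<in> C"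
    using Union_connected_components_of by (metis UnionE)
  have NC: "N \<subseteq> C"
    by (rule connected_components_of_maximal [OF C(1) cN]) (use b C in \<open>auto simp: disjnt_def\<close>)
  have "C \<subseteq> carr S" using connected_components_of_subset [OF C(1)] by auto
  then have cC: "carr (restrict_mfd S C) = C" by auto
  have "restrict_mfd S C \<in> restrict_foliation \<S> U" unfolding restrict_foliation_def using S C(1) by blast
  moreover obtain K where K: "K \<in> \<L>" "carr K = {l}"
  proof -
    have "carr ` \<L> = {{x} |x. x \<in> carr L}" using pt by (simp add: point_foliation_def)
    then have "{l} \<in> carr ` \<L>" using l by blast
    then show thesis using that by auto
  qed
  moreover have "(1::real) \<in> {0<..<2}" by simp
  ultimately have "\<psi> ` (carr (restrict_mfd S C) \<times> Some ` (carr K \<times> {1})) \<in>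
     {\<psi> ` (carr A \<times> Some ` (carr K \<times> {t})) |A K t. A \<in> restrict_foliation \<S> U \<and> K \<in> \<L> \<and> t \<in> {0<..<2}}"
    by blast
  then have "\<psi> ` (C \<times> Some ` ({l} \<times> {1})) \<in> carr ` restrict_foliation \<X> ({x \<in> T. \<pi> x \<in> U} - carr S\<^sub>0)"
    unfolding fol [unfolded foliated_cone_triv_def] cC K(2) .
  then obtain F D where F: "F \<in> \<X>" "\<psi> ` (C \<times> Some ` ({l} \<times> {1})) = carr (restrict_mfd F D)"
    unfolding restrict_foliation_def by blast
  have "\<psi> (u, Some (l, 1)) \<in> carr F" if "u \<in> N" for u
  proof -
    have "\<psi> (u, Some (l, 1)) \<in> \<psi> ` (C \<times> Some ` ({l} \<times> {1}))" using NC that by blast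
    then show ?thesis unfolding F(2) by simp
  qed
  then show thesis using that F(1) by blast
qed

lemma locally_constant_transition:
  assumes S\<S>: "S \<in> \<S>" and \<X>: "smooth_foliation R k \<X>"
    and b: "bundle_cone_triv X S\<^sub>0 T \<pi> \<rho> L \<A> U \<psi>" "point_foliation L \<L>" "foliated_cone_triv S\<^sub>0 T \<pi> \<X> \<S> U \<psi> \<L>"
    and b': "bundle_cone_triv X S\<^sub>0 T \<pi> \<rho> L \<A> U' \<psi>'" "point_foliation L \<L>'" "foliated_cone_triv S\<^sub>0 T \<pi> \<X> \<S> U' \<psi>' \<L>'"
    and p: "p \<in> carr S" "p \<in> U" "p \<in> U'"
  shows "\<exists>N g. p \<in> N \<and> openin (mtop S) N \<and> N \<subseteq> (carr S \<inter> U) \<inter> (carr S \<inter> U') \<and> diffeomorphism L L g \<and>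
     (\<forall>t\<in>N. \<forall>x\<in>carr L. link_section \<psi> (t, x) = link_section \<psi>' (t, g x))"
proof -
  note c = bundle_cone_trivD [OF b(1)] and c' = bundle_cone_trivD [OF b'(1)]
  \<comment> \<open>Compatibility of \<open>\<psi>\<close> and \<open>\<psi>'\<close> is known only
    with members of \<open>\<A>\<close>, so their transition function is composed of
    \<open>\<alpha>\<close> into a member \<open>(V, \<xi>)\<close> and \<open>\<beta>\<close> out
    of it.\<close>
  obtain V \<xi> where V: "(V, \<xi>) \<in> \<A>" "p \<in> V" using triv_cover S_subset p by blast
  have ch: "cone_triv_change S\<^sub>0 L (U, \<psi>) (V, \<xi>)" "cone_triv_change S\<^sub>0 L (V, \<xi>) (U', \<psi>')"
    using b(1) b'(1) V(1) unfolding bundle_cone_triv_def by blast+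
  obtain \<alpha> where \<alpha>: "smooth_map (prod_mfd (restrict_mfd S\<^sub>0 (U \<inter> V)) L) L (\<lambda>(u, l). \<alpha> u l) \<and>
    (\<forall>u\<in>U \<inter> V. diffeomorphism L L (\<alpha> u) \<and>
      (\<forall>l\<in>carr L. \<alpha> u l \<in> carr L \<and> link_section \<psi> (u, l) = link_section \<xi> (u, \<alpha> u l)))"
    using change_link_section [OF ch(1)] ..
  obtain \<beta> where \<beta>: "smooth_map (prod_mfd (restrict_mfd S\<^sub>0 (V \<inter> U')) L) L (\<lambda>(u, l). \<beta> u l) \<and>
    (\<forall>u\<in>V \<inter> U'. diffeomorphism L L (\<beta> u) \<and>
      (\<forall>l\<in>carr L. \<beta> u l \<in> carr L \<and> link_section \<xi> (u, l) = link_section \<psi>' (u, \<beta> u l)))"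
    using change_link_section [OF ch(2)] ..
  have "openin (mtop S\<^sub>0) (U \<inter> V \<inter> U')"
    using cone_triv_open [OF c] cone_triv_open [OF c'] cone_triv_open [OF triv [OF V(1)]] by blast
  then have "openin (mtop S) (carr S \<inter> (U \<inter> V \<inter> U'))" by (rule S_open)
  moreover have "p \<in> carr S \<inter> (U \<inter> V \<inter> U')" using p V(2) by blast
  ultimately obtain N where N: "openin (mtop S) N" "connectedin (mtop S) N" "p \<in> N" "N \<subseteq> carr S \<inter> (U \<inter> V \<inter> U')"
    using locally_connected_manifold [OF S] unfolding locally_connected_space by meson
  define \<phi> where "\<phi> = (\<lambda>u l. \<beta> u (\<alpha> u l))"
  have \<phi>L: "\<phi> u l \<in> carr L" and \<phi>eq: "link_section \<psi> (u, l) = link_section \<psi>' (u, \<phi> u l)"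
    if "u \<in> N" "l \<in> carr L" for u l
    using \<alpha> \<beta> that N(4) unfolding \<phi>_def by (auto simp: subset_iff)
  have const: "\<phi> u l = \<phi> p l" if u: "u \<in> N" and l: "l \<in> carr L" for u l
  proof (rule countable_connectedin_constant)
    show "compact_space (mtop L)" "Hausdorff_space (mtop L)"
      using L by (auto simp: closed_manifold_def smooth_manifold_def)
    have inc: "continuous_map (subtopology (mtop S) N) (mtop S\<^sub>0) (\<lambda>u. u)"
      using continuous_map_from_subtopology [OF smooth_map_imp_continuous [OF S_incl]] .
    \<comment> \<open>Used twice: for \<open>\<alpha>\<close> at the constant \<open>l\<close>, then
      for \<open>\<beta>\<close> at the resulting moving point \<open>\<alpha> u l\<close>. Joint
      continuity in base and link variables is what makes the second use possible.\<close>
    have conL: "continuous_map (subtopology (mtop S) N) (mtop L) (\<lambda>u. \<gamma> u (h u))"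
      if \<gamma>: "smooth_map (prod_mfd (restrict_mfd S\<^sub>0 W) L) L (\<lambda>(u, l). \<gamma> u l)" and W: "N \<subseteq> W"
        and h: "continuous_map (subtopology (mtop S) N) (mtop L) h" for W \<gamma> h
    proof -
      have "continuous_map (subtopology (mtop S) N) (prod_topology (subtopology (mtop S\<^sub>0) W) (mtop L)) (\<lambda>u. (u, h u))"
        using inc W h by (intro continuous_map_pairedI) (auto simp: continuous_map_in_subtopology)
      from continuous_map_compose [OF this, of "mtop L" "\<lambda>(u, l). \<gamma> u l"] smooth_map_imp_continuous [OF \<gamma>]
      show ?thesis by (simp add: o_def)
    qed
    have "continuous_map (subtopology (mtop S) N) (mtop L) (\<lambda>u. \<alpha> u l)"
    proof (rule conL [where \<gamma> = \<alpha> and h = "\<lambda>u. l"])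
      show "smooth_map (prod_mfd (restrict_mfd S\<^sub>0 (U \<inter> V)) L) L (\<lambda>(u, l). \<alpha> u l)" using \<alpha> by (elim conjE)
      show "N \<subseteq> U \<inter> V" using N(4) by blast
      show "continuous_map (subtopology (mtop S) N) (mtop L) (\<lambda>u. l)" using l by simp
    qed
    moreover have "smooth_map (prod_mfd (restrict_mfd S\<^sub>0 (V \<inter> U')) L) L (\<lambda>(u, l). \<beta> u l)" using \<beta> by (elim conjE)
    moreover have "N \<subseteq> V \<inter> U'" using N(4) by blast
    ultimately have "continuous_map (subtopology (mtop S) N) (mtop L) (\<lambda>u. \<phi> u l)"
      unfolding \<phi>_def by (intro conL [where \<gamma> = \<beta> and h = "\<lambda>u. \<alpha> u l"])
    then show "connectedin (mtop L) ((\<lambda>u. \<phi> u l) ` N)"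
      by (rule connectedin_continuous_map_image) (use N(2) in \<open>simp add: connectedin_subtopology\<close>)
    obtain F where F: "F \<in> \<X>" "\<And>u. u \<in> N \<Longrightarrow> \<psi> (u, Some (l, 1)) \<in> carr F"
      using leaf_of_link_point [OF S\<S> c b(2,3) N(2) _ _ l] N(3,4) by blast
    \<comment> \<open>The same point of \<open>F\<close> has link coordinate \<open>l\<close> in the
      trivialization \<open>\<psi>\<close> and \<open>\<phi> u l\<close> in \<open>\<psi>'\<close>.
      The coordinate stays fixed in the first and is confined to a countable set in the
      second.\<close>
    have "(\<lambda>u. \<phi> u l) ` N \<subseteq> {l \<in> carr L. \<exists>u\<in>U'. \<psi>' (u, Some (l, 1)) \<in> carr F}"
    proof clarify
      fix u assume u: "u \<in> N"
      have "\<psi>' (u, Some (\<phi> u l, 1)) \<in> carr F"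
        using F(2) [OF u] \<phi>eq [OF u l] by (simp add: link_section_def)
      then show "\<phi> u l \<in> carr L \<and> (\<exists>u'\<in>U'. \<psi>' (u', Some (\<phi> u l, 1)) \<in> carr F)"
        using \<phi>L [OF u l] u N(4) by blast
    qed
    then show "countable ((\<lambda>u. \<phi> u l) ` N)"
      using countable_link_coordinates_of_leaf [OF \<X> F(1) c' b'(2,3)] countable_subset by blast
    show "\<phi> u l \<in> (\<lambda>u. \<phi> u l) ` N" "\<phi> p l \<in> (\<lambda>u. \<phi> u l) ` N" using u N(3) by blast+
  qed
  have "diffeomorphism L L (\<phi> p)"
    unfolding \<phi>_def
  proof (rule diffeomorphism_compose [OF link_manifold link_manifold link_manifold, where f = "\<alpha> p" and g = "\<beta> p"])
    show "diffeomorphism L L (\<alpha> p)" using \<alpha> p V(2) by blast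
    show "diffeomorphism L L (\<beta> p)" using \<beta> p V(2) by blast
  qed
  moreover have "\<forall>t\<in>N. \<forall>x\<in>carr L. link_section \<psi> (t, x) = link_section \<psi>' (t, \<phi> p x)"
    using \<phi>eq const by simp
  ultimately show ?thesis using N by (intro exI [of _ N] exI [of _ "\<phi> p"]) auto
qed

end

theorem theorem11p9:
  fixes X :: "'x topology" and S\<^sub>0 R :: "'x mfd"
    and T :: "'x set" and \<pi> :: "'x \<Rightarrow> 'x" and \<rho> :: "'x \<Rightarrow> real"
    and L :: "'l mfd" and \<A> :: "('x set \<times> ('x \<times> 'l cone \<Rightarrow> 'x)) set"
    and \<X> \<S> :: "'x mfd set"
  assumes "two_strata_space X S\<^sub>0 R T \<pi> \<rho> L \<A>"
    and "stratified_foliation X S\<^sub>0 R T \<pi> \<rho> L \<A> \<X> \<S>"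
    and "zero_dim_on_links X S\<^sub>0 T \<pi> \<rho> L \<A> \<X> \<S>"
  shows "\<forall>S\<in>\<S>. flat_bundle (link_bundle_over X T \<pi> \<rho> L \<A> S) S L \<pi>"
proof
  fix S assume leaf: "S \<in> \<S>"
  interpret two_strata_space X S\<^sub>0 R T \<pi> \<rho> L \<A> by fact
  obtain k k\<^sub>0 where \<X>: "smooth_foliation R k \<X>" and \<S>: "smooth_foliation S\<^sub>0 k\<^sub>0 \<S>"
    using assms(2) unfolding stratified_foliation_def by blast
  interpret immersed_link_bundle X S\<^sub>0 R T \<pi> \<rho> L \<A> S
    by unfold_locales (use \<S> leaf in \<open>auto simp: smooth_foliation_def immersion_def\<close>)
  \<comment> \<open>The flat atlas consists of the trivializations foliated with point leaves on the
    link; those of \<open>\<A>\<close> define the smooth bundle but are not assumed to respect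
    \<open>\<X>\<close>. That the sets cover \<open>S\<close> is the hypothesis of dimension 0 on
    the links.\<close>
  define \<T> where "\<T> = {(carr S \<inter> U, link_section \<psi>) |U \<psi>. \<exists>\<L>. bundle_cone_triv X S\<^sub>0 T \<pi> \<rho> L \<A> U \<psi> \<and>
     point_foliation L \<L> \<and> foliated_cone_triv S\<^sub>0 T \<pi> \<X> \<S> U \<psi> \<L>}"
  show "flat_bundle (link_bundle_over X T \<pi> \<rho> L \<A> S) S L \<pi>"
    unfolding flat_bundle_def
  proof (intro conjI exI [of _ \<T>] smooth_fiber_bundle)
    show "\<forall>(V, h)\<in>\<T>. smooth_bundle_triv E S L \<pi> V h"
      unfolding \<T>_def using smooth_bundle_triv_section by blast
    show "(\<Union>(V, h)\<in>\<T>. V) = carr S"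
    proof (intro equalityI subsetI)
      fix p assume p: "p \<in> carr S"
      then obtain U \<psi> \<L> where U: "p \<in> U" "bundle_cone_triv X S\<^sub>0 T \<pi> \<rho> L \<A> U \<psi>"
        "point_foliation L \<L>" "foliated_cone_triv S\<^sub>0 T \<pi> \<X> \<S> U \<psi> \<L>"
        using assms(3) S_subset unfolding zero_dim_on_links_def by blast
      then have "(carr S \<inter> U, link_section \<psi>) \<in> \<T>" unfolding \<T>_def by blast
      then show "p \<in> (\<Union>(V, h)\<in>\<T>. V)" using U(1) p by blast
    qed (auto simp: \<T>_def)
    show "\<forall>(V, h)\<in>\<T>. \<forall>(V', h')\<in>\<T>. \<forall>b\<in>V \<inter> V'. \<exists>N g. b \<in> N \<and> openin (mtop S) N \<and> N \<subseteq> V \<inter> V' \<and>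
        diffeomorphism L L g \<and> (\<forall>t\<in>N. \<forall>x\<in>carr L. h (t, x) = h' (t, g x))"
    proof clarify
      fix V h V' h' b assume "(V, h) \<in> \<T>" "(V', h') \<in> \<T>" and b: "b \<in> V" "b \<in> V'"
      then obtain U \<psi> \<L> U' \<psi>' \<L>' where eq: "V = carr S \<inter> U" "h = link_section \<psi>" "V' = carr S \<inter> U'" "h' = link_section \<psi>'"
        and U: "bundle_cone_triv X S\<^sub>0 T \<pi> \<rho> L \<A> U \<psi>" "point_foliation L \<L>" "foliated_cone_triv S\<^sub>0 T \<pi> \<X> \<S> U \<psi> \<L>"
        and U': "bundle_cone_triv X S\<^sub>0 T \<pi> \<rho> L \<A> U' \<psi>'" "point_foliation L \<L>'" "foliated_cone_triv S\<^sub>0 T \<pi> \<X> \<S> U' \<psi>' \<L>'"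
        unfolding \<T>_def by blast
      show "\<exists>N g. b \<in> N \<and> openin (mtop S) N \<and> N \<subseteq> V \<inter> V' \<and>
        diffeomorphism L L g \<and> (\<forall>t\<in>N. \<forall>x\<in>carr L. h (t, x) = h' (t, g x))"
        unfolding eq by (rule locally_constant_transition [OF leaf \<X> U U']) (use b eq in auto)
    qed
  qed
qed

end
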